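(* Let $M$ be a compact connected smooth manifold without boundary of dimension $n\geq 2$, let $I\subseteq\mathbb{R}$ be an interval, and let $\{g(t)\}_{t\in I}$ be a family of Riemannian metrics on $M$ that varies continuously in $t$. Then the isoperimetric profile $h_{g(t)}(\xi)$ is jointly continuous in $t$ and $\xi$, i.e. the map $(t,\xi)\mapsto h_{g(t)}(\xi)$ is continuous on $I\times(0,1)$.
   Context: For a Riemannian metric $g$ on $M$, $|E|_g$ denotes the Riemannian volume of a measurable set $E\subseteq M$. The perimeter of a measurable set $E$ of finite volume is $$P_g(E)=\sup\Big\{\int_E \operatorname{div}_g(Y)\,dV_g : Y \text{ a smooth compactly supported vector field on } M,\ |Y|_g\leq 1\Big\}.$$ The isoperimetric profile of the compact Riemannian manifold $(M,g)$, as a function of the volume ratio $\xi\in(0,1)$, is $$h_g(\xi)=\inf\{P_g(\Omega): \Omega\subseteq M \text{ measurable},\ |\Omega|_g=\xi|M|_g,\ P_g(\Omega)<\infty\}.$$ (The same value is obtained if the infimum of the boundary area $|\partial\Omega|_g$ is taken over $\Omega$ with smooth boundary and $|\Omega|_g=\xi|M|_g$.) That $g(t)$ varies continuously means that $g(t)\to g(t_0)$ uniformly on $M$ as $t\to t_0$ for each $t_0\in I$; equivalently, for every $\epsilon>0$, $(1+\epsilon)^{-2}g(t_0)\leq g(t)\leq(1+\epsilon)^2g(t_0)$ on $M$ for all $t\in I$ close enough to $t_0$. *)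

theory Defs
  imports "HOL-Analysis.Analysis"
begin

text \<open>A chart is a pair of its domain and its coordinate map. A smooth manifold modelled on
  \<open>real ^ 'n\<close> is a topological space together with a smooth atlas \<open>A\<close>; all notions below depend
  only on the smooth structure generated by \<open>A\<close>.\<close>

type_synonym ('m, 'n) chart = "'m set \<times> ('m \<Rightarrow> real ^ 'n)"

abbreviation chart_inv :: "('m, 'n::finite) chart \<Rightarrow> real ^ 'n \<Rightarrow> 'm" where
  "chart_inv c \<equiv> inv_into (fst c) (snd c)"

abbreviation chart_image :: "('m, 'n::finite) chart \<Rightarrow> (real ^ 'n) set" where
  "chart_image c \<equiv> snd c ` fst c"

text \<open>\<open>Ck_on k S f\<close>: \<open>f\<close> is \<open>k\<close> times continuously differentiable on the open set \<open>S\<close>. In finite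
  dimension it suffices that every directional derivative is \<open>k - 1\<close> times continuously
  differentiable.\<close>

primrec Ck_on :: "nat \<Rightarrow> 'a::euclidean_space set \<Rightarrow> ('a \<Rightarrow> 'b::real_normed_vector) \<Rightarrow> bool" where
  "Ck_on 0 = (\<lambda>S f. continuous_on S f)"
| "Ck_on (Suc k) = (\<lambda>S f. (\<forall>x\<in>S. f differentiable (at x)) \<and>
     (\<forall>v. Ck_on k S (\<lambda>x. frechet_derivative f (at x) v)))"

definition smooth_on :: "'a::euclidean_space set \<Rightarrow> ('a \<Rightarrow> 'b::real_normed_vector) \<Rightarrow> bool" where
  "smooth_on S f \<longleftrightarrow> (\<forall>k. Ck_on k S f)"

definition transition ::
  "('m, 'n::finite) chart \<Rightarrow> ('m, 'n) chart \<Rightarrow> real ^ 'n \<Rightarrow> real ^ 'n" where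
  "transition c d = snd d \<circ> chart_inv c"

definition smooth_atlas :: "('m::topological_space, 'n::finite) chart set \<Rightarrow> bool" where
  "smooth_atlas A \<longleftrightarrow>
     (\<forall>c\<in>A. open (fst c) \<and> open (chart_image c) \<and>
        homeomorphism (fst c) (chart_image c) (snd c) (chart_inv c)) \<and>
     (\<Union>c\<in>A. fst c) = UNIV \<and>
     (\<forall>c\<in>A. \<forall>d\<in>A. smooth_on (snd c ` (fst c \<inter> fst d)) (transition c d))"

text \<open>Tensor fields are given by their components in every chart of the atlas, subject to the
  transformation law. For a vector field \<open>Y\<close>, the vector \<open>Y c p\<close> consists of the components of
  \<open>Y\<close> at the point \<open>p\<close> with respect to the coordinate frame of the chart \<open>c\<close>; for a metric \<open>g\<close>,
  the form \<open>g c p\<close> expresses the inner product on the tangent space at \<open>p\<close> in that frame. Values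
  at charts outside \<open>A\<close> or at points outside the chart domain are irrelevant.\<close>

type_synonym ('m, 'n) vec_field = "('m, 'n) chart \<Rightarrow> 'm \<Rightarrow> real ^ 'n"

type_synonym ('m, 'n) metric_field =
  "('m, 'n) chart \<Rightarrow> 'm \<Rightarrow> real ^ 'n \<Rightarrow> real ^ 'n \<Rightarrow> real"

definition smooth_vector_field ::
  "('m, 'n::finite) chart set \<Rightarrow> ('m, 'n) vec_field \<Rightarrow> bool" where
  "smooth_vector_field A Y \<longleftrightarrow>
     (\<forall>c\<in>A. smooth_on (chart_image c) (\<lambda>x. Y c (chart_inv c x))) \<and>
     (\<forall>c\<in>A. \<forall>d\<in>A. \<forall>p\<in>fst c \<inter> fst d.
        Y d p = frechet_derivative (transition c d) (at (snd c p)) (Y c p))"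

definition vector_field_support ::
  "('m::topological_space, 'n::finite) chart set \<Rightarrow> ('m, 'n) vec_field \<Rightarrow> 'm set" where
  "vector_field_support A Y = closure {p. \<exists>c\<in>A. p \<in> fst c \<and> Y c p \<noteq> 0}"

definition riemannian_metric ::
  "('m, 'n::finite) chart set \<Rightarrow> ('m, 'n) metric_field \<Rightarrow> bool" where
  "riemannian_metric A g \<longleftrightarrow>
     (\<forall>c\<in>A. \<forall>p\<in>fst c. bilinear (g c p) \<and> (\<forall>u v. g c p u v = g c p v u) \<and>
        (\<forall>v. v \<noteq> 0 \<longrightarrow> 0 < g c p v v)) \<and>
     (\<forall>c\<in>A. \<forall>u v. smooth_on (chart_image c) (\<lambda>x. g c (chart_inv c x) u v)) \<and>
     (\<forall>c\<in>A. \<forall>d\<in>A. \<forall>p\<in>fst c \<inter> fst d. \<forall>u v.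
        g c p u v = g d p (frechet_derivative (transition c d) (at (snd c p)) u)
                          (frechet_derivative (transition c d) (at (snd c p)) v))"

definition continuous_metric_family ::
  "('m, 'n::finite) chart set \<Rightarrow> real set \<Rightarrow> (real \<Rightarrow> ('m, 'n) metric_field) \<Rightarrow> bool" where
  "continuous_metric_family A I g \<longleftrightarrow>
     (\<forall>t0\<in>I. \<forall>\<epsilon>>0. \<forall>\<^sub>F t in at t0 within I. \<forall>c\<in>A. \<forall>p\<in>fst c. \<forall>v.
        g t0 c p v v / (1 + \<epsilon>)\<^sup>2 \<le> g t c p v v \<and>
        g t c p v v \<le> (1 + \<epsilon>)\<^sup>2 * g t0 c p v v)"

definition volume_density :: "('m, 'n::finite) metric_field \<Rightarrow> ('m, 'n) chart \<Rightarrow> 'm \<Rightarrow> real" where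
  "volume_density g c p = sqrt (det (\<chi> i j. g c p (axis i 1) (axis j 1)))"

definition manifold_lebesgue_sets :: "('m, 'n::finite) chart set \<Rightarrow> 'm set set" where
  "manifold_lebesgue_sets A = {E. \<forall>c\<in>A. snd c ` (E \<inter> fst c) \<in> sets lebesgue}"

text \<open>The Riemannian volume measure is the unique measure on the Lebesgue measurable subsets of the
  manifold that is \<open>sqrt (det g\<^sub>i\<^sub>j) dx\<close> in every chart (for a second countable manifold,
  existence is the change of variables formula).\<close>

definition riemannian_volume ::
  "('m, 'n::finite) chart set \<Rightarrow> ('m, 'n) metric_field \<Rightarrow> 'm measure" where
  "riemannian_volume A g = (THE \<mu>. space \<mu> = UNIV \<and> sets \<mu> = manifold_lebesgue_sets A \<and>
     (\<forall>c\<in>A. \<forall>E\<in>sets \<mu>. E \<subseteq> fst c \<longrightarrow>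
        emeasure \<mu> E =
          (\<integral>\<^sup>+ x \<in> snd c ` E. ennreal (volume_density g c (chart_inv c x)) \<partial>lebesgue)))"

definition chart_divergence ::
  "('m, 'n::finite) metric_field \<Rightarrow> ('m, 'n) vec_field \<Rightarrow> ('m, 'n) chart \<Rightarrow> 'm \<Rightarrow> real" where
  "chart_divergence g Y c p =
     (\<Sum>i\<in>UNIV. frechet_derivative
        (\<lambda>x. volume_density g c (chart_inv c x) * Y c (chart_inv c x) $ i)
        (at (snd c p)) (axis i 1)) / volume_density g c p"

text \<open>The coordinate expression does not depend on the chart around the point.\<close>

definition divergence ::
  "('m, 'n::finite) chart set \<Rightarrow> ('m, 'n) metric_field \<Rightarrow> ('m, 'n) vec_field \<Rightarrow> 'm \<Rightarrow> real" where
  "divergence A g Y p = chart_divergence g Y (SOME c. c \<in> A \<and> p \<in> fst c) p"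

definition perimeter ::
  "('m::topological_space, 'n::finite) chart set \<Rightarrow> ('m, 'n) metric_field \<Rightarrow> 'm set \<Rightarrow> ereal" where
  "perimeter A g E =
     (SUP Y \<in> {Y. smooth_vector_field A Y \<and> compact (vector_field_support A Y) \<and>
                  (\<forall>c\<in>A. \<forall>p\<in>fst c. sqrt (g c p (Y c p) (Y c p)) \<le> 1)}.
        ereal (LINT p:E|riemannian_volume A g. divergence A g Y p))"

definition isoperimetric_profile ::
  "('m::topological_space, 'n::finite) chart set \<Rightarrow> ('m, 'n) metric_field \<Rightarrow> real \<Rightarrow> ereal" where
  "isoperimetric_profile A g \<xi> =
     (INF \<Omega> \<in> {\<Omega>. \<Omega> \<in> sets (riemannian_volume A g) \<and>
                  emeasure (riemannian_volume A g) \<Omega> =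
                    ennreal \<xi> * emeasure (riemannian_volume A g) UNIV \<and>
                  perimeter A g \<Omega> < \<infinity>}.
        perimeter A g \<Omega>)"

end

theory Submission
  imports Defs
begin

text \<open>If \<open>g(t)\<close> is close to \<open>g(t\<^sub>0)\<close>, then multiplying a vector field by the smooth ratio of the volume
  densities turns \<open>div\<^sub>g Y dV\<^sub>g\<close> into \<open>div\<^sub>g\<^sub>0 Z dV\<^sub>g\<^sub>0\<close> with \<open>Z\<close> almost as short as \<open>Y\<close>. Hence volumes and
  perimeters of all sets change by factors uniformly close to \<open>1\<close>, and a competitor for \<open>(t\<^sub>0, \<xi>\<^sub>0)\<close>
  is almost one for a nearby \<open>(t, \<xi>)\<close> and vice versa; only its volume ratio is slightly wrong. The
  ratio is corrected by adding or removing a small coordinate ball \<open>B\<close>: for \<open>n \<ge> 2\<close> this costs little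
  perimeter, because \<open>\<Omega>\<close> can be cut by a smooth function of small total variation that is close to
  the indicator of \<open>B\<close>. Among the finitely many balls of a fixed covering one always has a
  definite amount of volume inside (or outside) \<open>\<Omega>\<close>, and the intermediate value theorem in the
  radius produces the exact ratio.\<close>


subsection \<open>Smooth functions\<close>

text \<open>Closeness of \<open>g(t)\<close> to \<open>g(t0)\<close> is only uniform closeness of
  the tensors. Their derivatives are not controlled, so the divergence of a fixed field need not
  vary continuously in \<open>t\<close>. In coordinates, however, the divergence differentiates only
  the products of the volume density with the components of the field. Rescaling the field by the
  ratio of the densities preserves these products, so no derivative of a metric has to be estimated.

  Nothing is known about the shape of an almost optimal set, so the price of correcting its volume
  must be uniform over all measurable sets. A ball of radius at most \<open>r\<close> costs a
  multiple of \<open>r ^ (n - 1)\<close>, with a factor that depends on the metric and the chart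
  only. The cutting is therefore paid for in the fixed metric \<open>g(t0)\<close>, and the other
  metric enters only through the volume ratio to be hit. The volume is a definite description and
  the divergence uses an arbitrarily chosen chart, so existence, uniqueness and independence of the
  chart precede every estimate.\<close>

lemma frechet_derivative_eqI:
  "(f has_derivative f') (at x) \<Longrightarrow> frechet_derivative f (at x) = f'"
  by (rule frechet_derivative_at[symmetric])

lemma Ck_on_SucI:
  assumes "open S"
    and "\<And>x. x \<in> S \<Longrightarrow> (f has_derivative f' x) (at x)"
    and "\<And>v. Ck_on k S (\<lambda>x. frechet_derivative f (at x) v)"
  shows "Ck_on (Suc k) S f"
  using assms by (auto simp: differentiable_def)

text \<open>\<open>frechet_derivative\<close> chooses some \<open>D\<close> with
  \<open>has_derivative\<close>. Functions that agree near \<open>x\<close> satisfy this predicate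
  for the same \<open>D\<close>, so the choices coincide even where no derivative exists.\<close>

lemma frechet_derivative_cong_open:
  assumes "open S" "x \<in> S" "\<And>y. y \<in> S \<Longrightarrow> f y = g y"
  shows "frechet_derivative f (at x) = frechet_derivative g (at x)"
proof -
  have "(f has_derivative D) (at x) \<longleftrightarrow> (g has_derivative D) (at x)" for D
    using assms by (metis has_derivative_transform_within_open)
  then show ?thesis by (simp add: frechet_derivative_def)
qed

lemma Ck_on_cong:
  assumes "open S" "Ck_on k S f" "\<And>x. x \<in> S \<Longrightarrow> f x = g x"
  shows "Ck_on k S g"
  using assms(2,3)
proof (induction k arbitrary: f g)
  case 0
  then show ?case by (metis Ck_on.simps(1) continuous_on_cong)
next
  case (Suc k)
  have "g differentiable at x" if "x \<in> S" for x
    using Suc.prems that assms(1) unfolding Ck_on.simps differentiable_def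
    by (metis has_derivative_transform_within_open)
  moreover have "Ck_on k S (\<lambda>x. frechet_derivative g (at x) v)" for v
  proof (rule Suc.IH)
    show "Ck_on k S (\<lambda>x. frechet_derivative f (at x) v)" using Suc.prems by simp
    show "\<And>x. x \<in> S \<Longrightarrow> frechet_derivative f (at x) v = frechet_derivative g (at x) v"
      using frechet_derivative_cong_open[OF assms(1)] Suc.prems(2) by metis
  qed
  ultimately show ?case by simp
qed

text \<open>Serves the inductions below: the directional derivatives may be checked on an explicit
  formula \<open>f'\<close> instead of the chosen derivative.\<close>

lemma Ck_on_SucI':
  assumes "open S"
    and f': "\<And>x. x \<in> S \<Longrightarrow> (f has_derivative f' x) (at x)"
    and "\<And>v. Ck_on k S (\<lambda>x. f' x v)"
  shows "Ck_on (Suc k) S f"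
proof (rule Ck_on_SucI[OF assms(1,2)])
  show "Ck_on k S (\<lambda>x. frechet_derivative f (at x) v)" for v
    using frechet_derivative_eqI[OF f'] by (intro Ck_on_cong[OF assms(1) assms(3)]) auto
qed

lemma Ck_on_SucD: "Ck_on (Suc k) S f \<Longrightarrow> Ck_on k S f"
proof (induction k arbitrary: f)
  case 0
  then show ?case
    by (auto intro!: continuous_at_imp_continuous_on differentiable_imp_continuous_within)
qed simp

lemma Ck_on_SucD_deriv: "Ck_on (Suc k) S f \<Longrightarrow> x \<in> S \<Longrightarrow>
   (f has_derivative frechet_derivative f (at x)) (at x)"
  unfolding Ck_on.simps frechet_derivative_works[symmetric] by blast

lemma Ck_on_Un:
  assumes "open S" "open T" shows "Ck_on k S f \<Longrightarrow> Ck_on k T f \<Longrightarrow> Ck_on k (S \<union> T) f"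
  using assms by (induction k arbitrary: f) (auto intro: continuous_on_open_Un)

lemma Ck_on_const [simp]: "Ck_on k S (\<lambda>x. c)"
proof (induction k arbitrary: c)
  case (Suc k)
  have "frechet_derivative (\<lambda>x. c) (at x) = (\<lambda>v. 0)" for x
    by (rule frechet_derivative_eqI) simp
  with Suc[of 0] show ?case by simp
qed simp

lemma Ck_on_bounded_linear:
  assumes "open S" "bounded_linear L" "Ck_on k S f"
  shows "Ck_on k S (\<lambda>x. L (f x))"
  using assms(3)
proof (induction k arbitrary: f)
  case 0
  then show ?case using assms(2) by (simp add: bounded_linear.continuous_on)
next
  case (Suc k)
  show ?case
  proof (rule Ck_on_SucI'[OF assms(1)])
    show "\<And>x. x \<in> S \<Longrightarrow> ((\<lambda>x. L (f x)) has_derivative (\<lambda>v. L (frechet_derivative f (at x) v))) (at x)"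
      by (rule bounded_linear.has_derivative[OF assms(2) Ck_on_SucD_deriv[OF Suc.prems]])
    show "\<And>v. Ck_on k S (\<lambda>x. L (frechet_derivative f (at x) v))"
      by (rule Suc.IH) (use Suc.prems in simp)
  qed
qed

lemma Ck_on_id: "open S \<Longrightarrow> Ck_on k S (\<lambda>x. x)"
  by (cases k) (auto intro!: Ck_on_SucI'[where f'="\<lambda>_ v. v"])

lemma Ck_on_add:
  assumes "open S" shows "Ck_on k S f \<Longrightarrow> Ck_on k S g \<Longrightarrow> Ck_on k S (\<lambda>x. f x + g x)"
proof (induction k arbitrary: f g)
  case (Suc k)
  show ?case
    by (rule Ck_on_SucI'[OF assms has_derivative_add[OF Ck_on_SucD_deriv[OF Suc.prems(1)]
      Ck_on_SucD_deriv[OF Suc.prems(2)]]]) (use Suc in auto)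
qed (auto intro: continuous_on_add)

lemma Ck_on_scaleR:
  fixes f :: "'a::euclidean_space \<Rightarrow> real"
  assumes "open S" shows "Ck_on k S f \<Longrightarrow> Ck_on k S g \<Longrightarrow> Ck_on k S (\<lambda>x. f x *\<^sub>R g x)"
proof (induction k arbitrary: f g)
  case (Suc k)
  show ?case
  proof (rule Ck_on_SucI'[OF assms has_derivative_scaleR[OF Ck_on_SucD_deriv[OF Suc.prems(1)]
      Ck_on_SucD_deriv[OF Suc.prems(2)]]])
    show "Ck_on k S (\<lambda>x. f x *\<^sub>R frechet_derivative g (at x) v + frechet_derivative f (at x) v *\<^sub>R g x)" for v
      by (intro Ck_on_add[OF assms] Suc.IH Ck_on_SucD[OF Suc.prems(1)] Ck_on_SucD[OF Suc.prems(2)])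
        (use Suc.prems in auto)
  qed auto
qed (auto intro: continuous_on_scaleR)

text \<open>The derivative is that of \<open>f\<close> times the derivative of \<open>\<psi>\<close>
  composed with \<open>f\<close>, and the derivative of \<open>\<psi>\<close> is again a function of
  one real variable. Hence the induction runs over all \<open>\<psi>\<close> for a fixed
  \<open>f\<close>.\<close>

lemma Ck_on_compose_real:
  fixes f :: "'a::euclidean_space \<Rightarrow> real" and \<psi> :: "real \<Rightarrow> real"
  assumes "open S"
  shows "Ck_on k T \<psi> \<Longrightarrow> Ck_on k S f \<Longrightarrow> f ` S \<subseteq> T \<Longrightarrow> Ck_on k S (\<lambda>x. \<psi> (f x))"
proof (induction k arbitrary: \<psi>)
  case 0
  then show ?case by (auto intro: continuous_on_compose2)
next
  case (Suc k)
  have \<psi>': "frechet_derivative \<psi> (at y) v = v * frechet_derivative \<psi> (at y) 1" if "y \<in> T" for y v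
    using linear_cmul[OF linear_frechet_derivative, of \<psi> "at y" v 1] Suc.prems(1) that by simp
  show ?case
  proof (rule Ck_on_SucI'[OF assms])
    fix x assume x: "x \<in> S"
    show "((\<lambda>x. \<psi> (f x)) has_derivative
      (\<lambda>v. frechet_derivative f (at x) v *\<^sub>R frechet_derivative \<psi> (at (f x)) 1)) (at x)"
    proof -
      have "((\<lambda>x. \<psi> (f x)) has_derivative
         (\<lambda>v. frechet_derivative \<psi> (at (f x)) (frechet_derivative f (at x) v))) (at x)"
        using Ck_on_SucD_deriv[OF Suc.prems(1), of "f x"] Ck_on_SucD_deriv[OF Suc.prems(2) x] x Suc.prems(3)
        by (intro has_derivative_compose[of f _ x UNIV \<psi>]) auto
      also have "(\<lambda>v. frechet_derivative \<psi> (at (f x)) (frechet_derivative f (at x) v))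
         = (\<lambda>v. frechet_derivative f (at x) v *\<^sub>R frechet_derivative \<psi> (at (f x)) 1)"
        using \<psi>'[of "f x"] x Suc.prems(3) by auto
      finally show ?thesis .
    qed
  next
    fix v
    show "Ck_on k S (\<lambda>x. frechet_derivative f (at x) v *\<^sub>R frechet_derivative \<psi> (at (f x)) 1)"
      by (intro Ck_on_scaleR[OF assms] Suc.IH[of "\<lambda>y. frechet_derivative \<psi> (at y) 1"]
         Ck_on_SucD[OF Suc.prems(2)]) (use Suc.prems in auto)
  qed
qed

lemma smooth_onI: "(\<And>k. Ck_on k S f) \<Longrightarrow> smooth_on S f"
  unfolding smooth_on_def by (rule allI)

lemma smooth_onD: "smooth_on S f \<Longrightarrow> Ck_on k S f"
  unfolding smooth_on_def by (rule spec)

lemma smooth_on_cong: "open S \<Longrightarrow> smooth_on S f \<Longrightarrow> (\<And>x. x \<in> S \<Longrightarrow> f x = g x) \<Longrightarrow> smooth_on S g"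
  by (rule smooth_onI, rule Ck_on_cong[OF _ smooth_onD])

lemma smooth_on_Un: "open S \<Longrightarrow> open T \<Longrightarrow> smooth_on S f \<Longrightarrow> smooth_on T f \<Longrightarrow> smooth_on (S \<union> T) f"
  by (rule smooth_onI, rule Ck_on_Un[OF _ _ smooth_onD smooth_onD])

lemma smooth_on_const [simp]: "smooth_on S (\<lambda>x. c)"
  by (simp add: smooth_on_def)

lemma smooth_on_id: "open S \<Longrightarrow> smooth_on S (\<lambda>x. x)"
  by (simp add: smooth_on_def Ck_on_id)

lemma smooth_on_bounded_linear:
  "open S \<Longrightarrow> bounded_linear L \<Longrightarrow> smooth_on S f \<Longrightarrow> smooth_on S (\<lambda>x. L (f x))"
  by (rule smooth_onI, rule Ck_on_bounded_linear[OF _ _ smooth_onD])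

lemma smooth_on_nth: "open S \<Longrightarrow> smooth_on S f \<Longrightarrow> smooth_on S (\<lambda>x. f x $ i)"
  by (rule smooth_on_bounded_linear[OF _ bounded_linear_vec_nth])

lemma smooth_on_add: "open S \<Longrightarrow> smooth_on S f \<Longrightarrow> smooth_on S g \<Longrightarrow> smooth_on S (\<lambda>x. f x + g x)"
  by (rule smooth_onI, rule Ck_on_add[OF _ smooth_onD smooth_onD])

lemma smooth_on_scaleR:
  fixes f :: "'a::euclidean_space \<Rightarrow> real"
  shows "open S \<Longrightarrow> smooth_on S f \<Longrightarrow> smooth_on S g \<Longrightarrow> smooth_on S (\<lambda>x. f x *\<^sub>R g x)"
  by (rule smooth_onI, rule Ck_on_scaleR[OF _ smooth_onD smooth_onD])

lemma smooth_on_mult: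
  fixes f g :: "'a::euclidean_space \<Rightarrow> real"
  shows "open S \<Longrightarrow> smooth_on S f \<Longrightarrow> smooth_on S g \<Longrightarrow> smooth_on S (\<lambda>x. f x * g x)"
  using smooth_on_scaleR[of S f g] by simp

lemma smooth_on_uminus: "open S \<Longrightarrow> smooth_on S f \<Longrightarrow> smooth_on S (\<lambda>x. - f x)"
  by (rule smooth_on_bounded_linear[OF _ bounded_linear_minus[OF bounded_linear_ident]])

lemma smooth_on_diff:
  "open S \<Longrightarrow> smooth_on S f \<Longrightarrow> smooth_on S g \<Longrightarrow> smooth_on S (\<lambda>x. f x - g x)"
  unfolding diff_conv_add_uminus by (rule smooth_on_add[OF _ _ smooth_on_uminus])

lemma smooth_on_sum:
  assumes "open S" "\<And>i. i \<in> J \<Longrightarrow> smooth_on S (f i)"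
  shows "smooth_on S (\<lambda>x. \<Sum>i\<in>J. f i x)"
  using assms(2) by (induction J rule: infinite_finite_induct) (auto intro: smooth_on_add[OF assms(1)])

lemma smooth_on_prod:
  fixes f :: "'i \<Rightarrow> 'a::euclidean_space \<Rightarrow> real"
  assumes "open S" "\<And>i. i \<in> J \<Longrightarrow> smooth_on S (f i)"
  shows "smooth_on S (\<lambda>x. \<Prod>i\<in>J. f i x)"
  using assms(2) by (induction J rule: infinite_finite_induct) (auto intro: smooth_on_mult[OF assms(1)])

lemma smooth_on_compose_real:
  fixes f :: "'a::euclidean_space \<Rightarrow> real" and \<psi> :: "real \<Rightarrow> real"
  shows "open S \<Longrightarrow> smooth_on T \<psi> \<Longrightarrow> smooth_on S f \<Longrightarrow> f ` S \<subseteq> T \<Longrightarrow> smooth_on S (\<lambda>x. \<psi> (f x))"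
  by (rule smooth_onI, rule Ck_on_compose_real[OF _ smooth_onD smooth_onD])

lemma smooth_on_differentiable: "smooth_on S f \<Longrightarrow> x \<in> S \<Longrightarrow> f differentiable (at x)"
  using smooth_onD[of S f "Suc 0"] unfolding Ck_on.simps by blast

lemma smooth_on_has_derivative:
  "smooth_on S f \<Longrightarrow> x \<in> S \<Longrightarrow> (f has_derivative frechet_derivative f (at x)) (at x)"
  unfolding frechet_derivative_works[symmetric] by (rule smooth_on_differentiable)

lemma smooth_on_frechet_derivative: "smooth_on S f \<Longrightarrow> smooth_on S (\<lambda>x. frechet_derivative f (at x) v)"
  by (rule smooth_onI, drule_tac k="Suc k" in smooth_onD) simp

lemma smooth_on_continuous_on: "smooth_on S f \<Longrightarrow> continuous_on S f"
  using smooth_onD[of S f 0] by simp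

text \<open>Real powers are closed under differentiation up to constant factors, so the induction
  over \<open>k\<close> leaves the exponent arbitrary. The exponents \<open>1/2\<close> and
  \<open>-1\<close> yield square roots and inverses.\<close>

lemma smooth_on_powr: "smooth_on {0<..} (\<lambda>x::real. x powr a)"
proof -
  have "Ck_on k {0<..} (\<lambda>x::real. x powr a)" for k
  proof (induction k arbitrary: a)
    case 0
    then show ?case by (auto intro!: continuous_intros)
  next
    case (Suc k)
    show ?case
    proof (rule Ck_on_SucI')
      fix x :: real assume "x \<in> {0<..}"
      then have "((\<lambda>x. x powr a) has_real_derivative a * x powr (a - 1)) (at x)"
        using has_real_derivative_powr[of x a] by auto
      then show "((\<lambda>x. x powr a) has_derivative (\<lambda>v. v *\<^sub>R a *\<^sub>R x powr (a - 1))) (at x)"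
        by (simp add: has_field_derivative_def mult.commute[of _ "_ * _"] mult_commute_abs)
    next
      show "Ck_on k {0<..} (\<lambda>x. v *\<^sub>R a *\<^sub>R x powr (a - 1))" for v
        by (intro Ck_on_scaleR Suc.IH) auto
    qed auto
  qed
  then show ?thesis by (simp add: smooth_on_def)
qed

lemma smooth_on_sqrt:
  assumes "open S" "smooth_on S f" "\<And>x. x \<in> S \<Longrightarrow> f x > 0"
  shows "smooth_on S (\<lambda>x. sqrt (f x))"
  by (rule smooth_on_cong[OF assms(1)
        smooth_on_compose_real[OF assms(1) smooth_on_powr[of "1/2"] assms(2)]])
    (auto simp: assms(3) powr_half_sqrt less_imp_le)

lemma smooth_on_inverse:
  fixes f :: "'a::euclidean_space \<Rightarrow> real"
  assumes "open S" "smooth_on S f" "\<And>x. x \<in> S \<Longrightarrow> f x > 0"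
  shows "smooth_on S (\<lambda>x. inverse (f x))"
  by (rule smooth_on_cong[OF assms(1)
        smooth_on_compose_real[OF assms(1) smooth_on_powr[of "-1"] assms(2)]])
    (auto simp: assms(3) powr_minus less_imp_le)

text \<open>\<open>flat_fun 0\<close> is the classical function \<open>exp (- 1 / x)\<close>, flat
  at \<open>0\<close>. The powers of \<open>inverse x\<close> are included because the derivative of
  such a function is a linear combination of others of this form.\<close>

definition flat_fun :: "nat \<Rightarrow> real \<Rightarrow> real" where
  "flat_fun m x = (if x > 0 then exp (- inverse x) * inverse x ^ m else 0)"


text \<open>The exponential series at \<open>1 / x\<close> dominates its single term of degree
  \<open>m + 2\<close>. The two degrees beyond \<open>m\<close> leave a factor \<open>x ^ 2\<close>,
  enough to make the difference quotient at \<open>0\<close> vanish.\<close>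

lemma flat_fun_le:
  assumes "x > 0" shows "flat_fun m x \<le> fact (m + 2) * x ^ 2"
proof -
  have "(inverse x ^ (m + 2)) /\<^sub>R fact (m + 2) \<le> (\<Sum>n. inverse x ^ n /\<^sub>R fact n)"
    using sum_le_suminf[OF summable_exp_generic[of "inverse x"], of "{m + 2}"] assms by simp
  then have "inverse x ^ (m + 2) / fact (m + 2) \<le> exp (inverse x)"
    by (simp add: exp_def divide_inverse mult.commute del: fact_Suc power_Suc)
  then have "inverse x ^ (m + 2) \<le> exp (inverse x) * fact (m + 2)"
    by (simp add: divide_le_eq del: fact_Suc)
  then have "inverse x ^ m * exp (- inverse x) * inverse x ^ 2 \<le> fact (m + 2)"
    using assms by (simp add: exp_minus field_simps power_add power2_eq_square del: fact_Suc)
  then show ?thesis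
    using assms by (simp add: flat_fun_def field_simps power2_eq_square del: fact_Suc)
qed

lemma flat_fun_has_derivative:
  "(flat_fun m has_real_derivative flat_fun (m + 2) x - m * flat_fun (m + 1) x) (at x)"
proof -
  consider "x > 0" | "x < 0" | "x = 0" by linarith
  then show ?thesis
  proof cases
    case 1
    have "((\<lambda>x. exp (- inverse x) * inverse x ^ m) has_real_derivative
        flat_fun (m + 2) x - m * flat_fun (m + 1) x) (at x)"
    proof (cases m)
      case 0
      then show ?thesis
        using 1 by (auto intro!: derivative_eq_intros simp: flat_fun_def field_simps power2_eq_square)
    next
      case (Suc j)
      have "((\<lambda>x. exp (- inverse x) * inverse x ^ m) has_real_derivative
          exp (- inverse x) * (inverse x * inverse x) * inverse x ^ m +
          exp (- inverse x) * (real m * inverse x ^ (m - Suc 0) * - (inverse x * inverse x))) (at x)"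
        using 1 by (auto intro!: derivative_eq_intros simp: power2_eq_square)
      then show ?thesis
        using 1 Suc by (simp add: flat_fun_def algebra_simps)
    qed
    then show ?thesis
      by (rule has_field_derivative_transform_within_open[of _ _ _ "{0<..}"])
        (use 1 in \<open>auto simp: flat_fun_def\<close>)
  next
    case 2
    have "((\<lambda>x. 0) has_real_derivative flat_fun (m + 2) x - m * flat_fun (m + 1) x) (at x)"
      using 2 by (auto simp: flat_fun_def)
    then show ?thesis
      by (rule has_field_derivative_transform_within_open[of _ _ _ "{..<0}"])
        (use 2 in \<open>auto simp: flat_fun_def\<close>)
  next
    case 3
    have "((\<lambda>y. (flat_fun m y - flat_fun m 0) / (y - 0)) \<longlongrightarrow> 0) (at 0)"
    proof (rule Lim_null_comparison)
      show "\<forall>\<^sub>F y in at 0. norm ((flat_fun m y - flat_fun m 0) / (y - 0)) \<le> fact (m + 2) * \<bar>y\<bar>"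
      proof (rule always_eventually, rule allI)
        fix y :: real
        show "norm ((flat_fun m y - flat_fun m 0) / (y - 0)) \<le> fact (m + 2) * \<bar>y\<bar>"
        proof (cases "y > 0")
          case True
          then have "flat_fun m y / y \<le> fact (m + 2) * y"
            using flat_fun_le[OF True, of m] by (simp add: field_simps power2_eq_square del: fact_Suc)
          then show ?thesis using True by (simp add: flat_fun_def)
        next
          case False
          then have "norm ((flat_fun m y - flat_fun m 0) / (y - 0)) = 0" by (simp add: flat_fun_def)
          also have "0 \<le> fact (m + 2) * \<bar>y\<bar>" by (intro mult_nonneg_nonneg) auto
          finally show ?thesis .
        qed
      qed
      show "((\<lambda>y. fact (m + 2) * \<bar>y\<bar>) \<longlongrightarrow> (0::real)) (at 0)"
        by (auto intro!: tendsto_eq_intros)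
    qed
    then show ?thesis using 3 by (simp add: has_field_derivative_iff flat_fun_def)
  qed
qed

lemma smooth_on_flat_fun: "smooth_on UNIV (flat_fun m)"
proof -
  have "Ck_on k UNIV (flat_fun m)" for k
  proof (induction k arbitrary: m)
    case 0
    show ?case
      using DERIV_isCont[OF flat_fun_has_derivative] by (auto intro: continuous_at_imp_continuous_on)
  next
    case (Suc k)
    show ?case
    proof (rule Ck_on_SucI')
      show "(flat_fun m has_derivative
          (\<lambda>v. v *\<^sub>R (flat_fun (m + 2) x + (- real m) *\<^sub>R flat_fun (m + 1) x))) (at x)" for x
        using flat_fun_has_derivative[of m x]
        by (simp add: has_field_derivative_def mult.commute[of _ "_ - _"] mult_commute_abs)
    next
      show "Ck_on k UNIV (\<lambda>x. v *\<^sub>R (flat_fun (m + 2) x + (- real m) *\<^sub>R flat_fun (m + 1) x))" for v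
        by (intro Ck_on_scaleR Ck_on_add Suc.IH) auto
    qed auto
  qed
  then show ?thesis by (simp add: smooth_on_def)
qed

lemma smooth_step_exists:
  obtains \<psi> :: "real \<Rightarrow> real" and K where "smooth_on UNIV \<psi>" "\<And>x. 0 \<le> \<psi> x" "\<And>x. \<psi> x \<le> 1"
    "\<And>x. x \<le> 0 \<Longrightarrow> \<psi> x = 1" "\<And>x. 1 \<le> x \<Longrightarrow> \<psi> x = 0"
    "\<And>x. \<bar>deriv \<psi> x\<bar> \<le> K"
    "\<And>x. x \<notin> {0..1} \<Longrightarrow> deriv \<psi> x = 0"
proof -
  define f where "f = flat_fun 0"
  have f: "smooth_on UNIV f" "f x \<ge> 0" "x \<le> 0 \<Longrightarrow> f x = 0" "x > 0 \<Longrightarrow> f x > 0" for x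
    unfolding f_def by (rule smooth_on_flat_fun) (auto simp: flat_fun_def)
  \<comment> \<open>The denominator is positive because \<open>x\<close> and \<open>1 - x\<close>
    are never both at most \<open>0\<close>. As \<open>f\<close> vanishes exactly for nonpositive
    arguments, the quotient is \<open>1\<close> for \<open>x \<le> 0\<close> and \<open>0\<close>
    for \<open>x \<ge> 1\<close>.\<close>
  define \<psi> where "\<psi> x = f (1 - x) * inverse (f x + f (1 - x))" for x
  have pos: "f x + f (1 - x) > 0" for x
    using f(2)[of x] f(2)[of "1 - x"] f(4)[of x] f(4)[of "1 - x"] by (cases "x > 0") linarith+
  have sm: "smooth_on UNIV (\<lambda>x. f (1 - x))"
    by (rule smooth_on_compose_real[OF _ f(1)])
      (auto intro: smooth_on_diff[OF _ smooth_on_const smooth_on_id])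
  have 1: "smooth_on UNIV \<psi>"
    unfolding \<psi>_def by (intro smooth_on_mult smooth_on_inverse smooth_on_add sm f(1) pos) auto
  have 2: "0 \<le> \<psi> x" for x
    unfolding \<psi>_def by (intro mult_nonneg_nonneg f(2) less_imp_le[OF positive_imp_inverse_positive] pos)
  have le1: "\<psi> x \<le> 1" for x
  proof -
    have "f (1 - x) / (f x + f (1 - x)) \<le> 1"
      using pos[of x] f(2)[of x] by (simp add: pos_divide_le_eq)
    then show ?thesis by (simp only: \<psi>_def divide_inverse)
  qed
  have 3: "\<psi> x = 1" if "x \<le> 0" for x
    using f(3)[OF that] f(4)[of "1 - x"] that by (simp add: \<psi>_def)
  have 4: "\<psi> x = 0" if "1 \<le> x" for x
    using f(3)[of "1 - x"] that by (simp add: \<psi>_def)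
  have D: "(\<psi> has_real_derivative frechet_derivative \<psi> (at x) 1) (at x)" for x
  proof -
    have lin: "linear (frechet_derivative \<psi> (at x))"
      by (rule linear_frechet_derivative) (rule smooth_on_differentiable[OF 1 UNIV_I])
    have "frechet_derivative \<psi> (at x) v = frechet_derivative \<psi> (at x) 1 * v" for v
      using linear_cmul[OF lin, of v 1] by (simp add: mult.commute[of v])
    then have eq: "frechet_derivative \<psi> (at x) = (*) (frechet_derivative \<psi> (at x) 1)" ..
    show ?thesis
      unfolding has_field_derivative_def
      by (subst eq[symmetric]) (rule smooth_on_has_derivative[OF 1 UNIV_I])
  qed
  then have d: "deriv \<psi> x = frechet_derivative \<psi> (at x) 1" for x by (rule DERIV_imp_deriv)
  have "continuous_on UNIV (deriv \<psi>)"
    using smooth_on_continuous_on[OF smooth_on_frechet_derivative[OF 1, of 1]]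
    unfolding d[symmetric] by simp
  then have "continuous_on {0..1} (deriv \<psi>)" by (rule continuous_on_subset) simp
  then have "bounded (deriv \<psi> ` {0..1})"
    by (intro compact_imp_bounded compact_continuous_image) auto
  then obtain K where "\<forall>y\<in>deriv \<psi> ` {0..1}. norm y \<le> K"
    unfolding bounded_iff by blast
  then have K: "\<And>x. x \<in> {0..1} \<Longrightarrow> \<bar>deriv \<psi> x\<bar> \<le> K" by simp
  have z: "deriv \<psi> x = 0" if "x \<notin> {0..1}" for x
  proof -
    have "x \<in> {..<0} \<or> x \<in> {1<..}" using that by auto
    then show ?thesis
    proof
      assume "x \<in> {..<0}"
      then have "((\<lambda>_. 1) has_real_derivative deriv \<psi> x) (at x)"
        by (intro has_field_derivative_transform_within_open[OF D[of x, folded d], of "{..<0}"]) (auto simp: 3)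
      then show ?thesis by (rule DERIV_unique[OF _ DERIV_const])
    next
      assume "x \<in> {1<..}"
      then have "((\<lambda>_. 0) has_real_derivative deriv \<psi> x) (at x)"
        by (intro has_field_derivative_transform_within_open[OF D[of x, folded d], of "{1<..}"]) (auto simp: 4)
      then show ?thesis by (rule DERIV_unique[OF _ DERIV_const])
    qed
  qed
  have "0 \<le> K" using K[of 0] by force
  then have K': "\<bar>deriv \<psi> x\<bar> \<le> K" for x using K z by (cases "x \<in> {0..1}") auto
  show thesis by (rule that[OF 1 2 le1 3 4 K' z])
qed

subsection \<open>Gram determinants\<close>

definition gram :: "(real ^ 'n \<Rightarrow> real ^ 'n \<Rightarrow> real) \<Rightarrow> real ^ 'n ^ 'n" where
  "gram B = (\<chi> i j. B (axis i 1) (axis j 1))"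

definition inner_form :: "(real ^ 'n::finite \<Rightarrow> real ^ 'n \<Rightarrow> real) \<Rightarrow> bool" where
  "inner_form B \<longleftrightarrow> bilinear B \<and> (\<forall>u v. B u v = B v u) \<and> (\<forall>v. v \<noteq> 0 \<longrightarrow> 0 < B v v)"

lemma bilinear_eq_gram:
  fixes B :: "real ^ 'n::finite \<Rightarrow> real ^ 'n \<Rightarrow> real"
  assumes "bilinear B"
  shows "B u v = u \<bullet> (gram B *v v)"
proof -
  have l: "linear (\<lambda>u. B u v)" "linear (B u)" for u v
    using assms by (auto simp: bilinear_def)
  have "B u v = B (\<Sum>i\<in>UNIV. u $ i *\<^sub>R axis i 1) (\<Sum>j\<in>UNIV. v $ j *\<^sub>R axis j 1)"
    using basis_expansion[of u] basis_expansion[of v] by (simp add: scalar_mult_eq_scaleR)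
  also have "\<dots> = (\<Sum>i\<in>UNIV. u $ i * (\<Sum>j\<in>UNIV. v $ j * B (axis i 1) (axis j 1)))"
    unfolding linear_sum[OF l(1)] linear_cmul[OF l(1)] unfolding linear_sum[OF l(2)] linear_cmul[OF l(2)]
    by simp
  also have "\<dots> = u \<bullet> (gram B *v v)"
    by (simp add: gram_def inner_vec_def matrix_vector_mult_def mult.commute)
  finally show ?thesis .
qed

text \<open>The Gram matrix of the pulled back form is \<open>L^T G L\<close>, whose determinant
  picks up \<open>det L\<close> twice. This is the origin of the transformation law of the volume
  density.\<close>

lemma det_gram_pullback:
  fixes B :: "real ^ 'n::finite \<Rightarrow> real ^ 'n \<Rightarrow> real"
  assumes "bilinear B" "linear L"
  shows "det (gram (\<lambda>u v. B (L u) (L v))) = (det (matrix L))\<^sup>2 * det (gram B)"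
proof -
  have "gram (\<lambda>u v. B (L u) (L v)) = transpose (matrix L) ** gram B ** matrix L"
  proof -
    have "B (L (axis i 1)) (L (axis j 1)) = (transpose (matrix L) ** gram B ** matrix L) $ i $ j" for i j
    proof -
      have "B (L (axis i 1)) (L (axis j 1)) =
          axis i 1 \<bullet> ((transpose (matrix L) ** gram B ** matrix L) *v axis j 1)"
      proof -
        have adj: "a \<bullet> (transpose M *v b) = (M *v a) \<bullet> b" for M :: "real ^ 'n ^ 'n" and a b
          by (metis dot_lmul_matrix transpose_matrix_vector transpose_transpose)
        have mw: "matrix L *v x = L x" for x
          by (rule matrix_works) (simp add: linear_matrix_vector_mul_eq assms(2))
        have "axis i 1 \<bullet> ((transpose (matrix L) ** gram B ** matrix L) *v axis j 1) =
            axis i 1 \<bullet> (transpose (matrix L) *v (gram B *v (matrix L *v axis j 1)))"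
          by (simp only: matrix_vector_mul_assoc matrix_mul_assoc)
        also have "\<dots> = L (axis i 1) \<bullet> (gram B *v L (axis j 1))"
          unfolding mw by (subst adj) (simp only: mw)
        finally show ?thesis by (simp only: bilinear_eq_gram[OF assms(1)])
      qed
      also have "\<dots> = (transpose (matrix L) ** gram B ** matrix L) $ i $ j"
        by (simp add: matrix_vector_mul_component inner_axis' inner_axis)
      finally show ?thesis .
    qed
    then show ?thesis by (simp add: gram_def vec_eq_iff)
  qed
  then show ?thesis by (simp add: det_mul power2_eq_square)
qed

text \<open>Gram-Schmidt with respect to \<open>B\<close>: fewer than \<open>n\<close> orthonormal
  vectors do not span, and a vector outside their span, minus its \<open>B\<close>-projection and
  normalized, is the next one. \<open>L\<close> maps the standard basis to the resulting
  frame.\<close>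

lemma inner_form_orthonormal_frame:
  fixes B :: "real ^ 'n::finite \<Rightarrow> real ^ 'n \<Rightarrow> real"
  assumes "inner_form B"
  obtains L :: "real ^ 'n \<Rightarrow> real ^ 'n" where "linear L" "gram (\<lambda>u v. B (L u) (L v)) = mat 1"
proof -
  have bil: "bilinear B" and sym: "\<And>u v. B u v = B v u" and pos: "\<And>v. v \<noteq> 0 \<Longrightarrow> 0 < B v v"
    using assms by (auto simp: inner_form_def)
  have l: "linear (\<lambda>u. B u v)" "linear (B u)" for u v
    using bil by (auto simp: bilinear_def)
  have "k \<le> CARD('n) \<Longrightarrow> \<exists>S. finite S \<and> card S = k \<and>
      (\<forall>u\<in>S. \<forall>v\<in>S. B u v = (if u = v then 1 else 0))" for k
  proof (induction k)
    case 0
    show ?case by (rule exI[of _ "{}"]) simp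
  next
    case (Suc k)
    then obtain S where S: "finite S" "card S = k"
      "\<And>u v. u \<in> S \<Longrightarrow> v \<in> S \<Longrightarrow> B u v = (if u = v then 1 else 0)" by auto
    have "dim (span S) < DIM(real ^ 'n)"
      using dim_le_card[of "span S" S] S(1,2) Suc.prems by simp
    then have "span S \<noteq> UNIV" by (metis dim_UNIV less_irrefl)
    then obtain w where w: "w \<notin> span S" by auto
    define z where "z = w - (\<Sum>u\<in>S. B u w *\<^sub>R u)"
    have "z \<noteq> 0"
    proof
      assume "z = 0"
      then have "w = (\<Sum>u\<in>S. B u w *\<^sub>R u)" by (simp add: z_def)
      then show False using w by (metis (no_types, lifting) span_sum span_scale span_base)
    qed
    have orth: "B v z = 0" if "v \<in> S" for v
    proof -
      have "B v z = B v w - (\<Sum>u\<in>S. B u w * B v u)"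
        unfolding z_def linear_diff[OF l(2)] linear_sum[OF l(2)] linear_cmul[OF l(2)] by simp
      also have "(\<Sum>u\<in>S. B u w * B v u) = (\<Sum>u\<in>S. if u = v then B v w else 0)"
        by (rule sum.cong) (use S(3) that in auto)
      finally show ?thesis using that S(1) by simp
    qed
    define e where "e = (1 / sqrt (B z z)) *\<^sub>R z"
    have ee: "B e e = 1"
      using pos[OF \<open>z \<noteq> 0\<close>] unfolding e_def linear_cmul[OF l(1)] linear_cmul[OF l(2)] by simp
    have eo: "B v e = 0" "B e v = 0" if "v \<in> S" for v
      using orth[OF that] sym[of e v] unfolding e_def linear_cmul[OF l(2)] by auto
    have "e \<notin> S" using ee eo by force
    show ?case
      by (rule exI[of _ "insert e S"]) (use \<open>e \<notin> S\<close> S ee eo in auto)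
  qed
  from this[of "CARD('n)"] obtain S where S: "finite S" "card S = CARD('n)"
      "\<And>u v. u \<in> S \<Longrightarrow> v \<in> S \<Longrightarrow> B u v = (if u = v then 1 else 0)" by auto
  then obtain f where f: "bij_betw f (UNIV :: 'n set) S"
    using finite_same_card_bij[of "UNIV :: 'n set" S] by auto
  define L where "L v = (\<Sum>i\<in>UNIV. v $ i *\<^sub>R f i)" for v :: "real ^ 'n"
  have "linear L"
    unfolding L_def by (intro linearI) (auto simp: scaleR_left_distrib sum.distrib scaleR_right.sum)
  moreover have La: "L (axis i 1) = f i" for i
    unfolding L_def by (simp add: axis_def if_distrib if_distribR cong: if_cong)
  have "B (f i) (f j) = (if i = j then 1 else 0)" for i j
    using S(3)[of "f i" "f j"] f by (auto simp: bij_betw_def inj_on_def)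
  then have "gram (\<lambda>u v. B (L u) (L v)) = mat 1"
    by (simp add: gram_def La mat_def vec_eq_iff)
  ultimately show thesis by (rule that)
qed

text \<open>In an orthonormal frame the pullback formula reads \<open>(det L)^2 * det G = 1\<close>,
  which excludes a nonpositive \<open>det G\<close>.\<close>

lemma det_gram_pos:
  fixes B :: "real ^ 'n::finite \<Rightarrow> real ^ 'n \<Rightarrow> real"
  assumes "inner_form B" shows "0 < det (gram B)"
proof -
  obtain L :: "real ^ 'n \<Rightarrow> real ^ 'n" where L: "linear L" "gram (\<lambda>u v. B (L u) (L v)) = mat 1"
    using inner_form_orthonormal_frame[OF assms] by blast
  have "(det (matrix L))\<^sup>2 * det (gram B) = 1"
    using det_gram_pullback[of B L] L assms by (simp add: inner_form_def)
  moreover have "0 \<le> (det (matrix L))\<^sup>2" by simp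
  ultimately show ?thesis
    using mult_nonneg_nonpos[of "(det (matrix L))\<^sup>2" "det (gram B)"] by linarith
qed

lemma tendsto_det:
  fixes f :: "'a \<Rightarrow> real ^ 'n::finite ^ 'n"
  assumes "(f \<longlongrightarrow> M) F" shows "((\<lambda>x. det (f x)) \<longlongrightarrow> det M) F"
  unfolding det_def by (intro tendsto_intros tendsto_vec_nth assms)

lemma bilinear_polarization:
  fixes B :: "'a::real_vector \<Rightarrow> 'a \<Rightarrow> real"
  assumes "bilinear B" "\<And>u v. B u v = B v u"
  shows "4 * B u v = B (u + v) (u + v) - B (u - v) (u - v)"
  using assms(2)[of u v]
  by (simp add: bilinear_ladd[OF assms(1)] bilinear_radd[OF assms(1)] bilinear_lsub[OF assms(1)]
    bilinear_rsub[OF assms(1)])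

text \<open>In a \<open>B0\<close>-orthonormal frame the Gram matrix of a form close to \<open>B0\<close> is close to the
  identity, uniformly in \<open>B0\<close>.\<close>

lemma det_gram_ratio:
  assumes "0 < \<eta>"
  obtains \<epsilon> where "0 < \<epsilon>" "\<And>B B0 :: real ^ 'n::finite \<Rightarrow> real ^ 'n \<Rightarrow> real. inner_form B \<Longrightarrow> inner_form B0 \<Longrightarrow>
     (\<And>v. B0 v v / (1 + \<epsilon>)\<^sup>2 \<le> B v v \<and> B v v \<le> (1 + \<epsilon>)\<^sup>2 * B0 v v) \<Longrightarrow>
     \<bar>det (gram B) / det (gram B0) - 1\<bar> < \<eta>"
proof -
  have "((\<lambda>G. det G) \<longlongrightarrow> det (mat 1 :: real ^ 'n ^ 'n)) (nhds (mat 1 :: real ^ 'n ^ 'n))"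
    by (rule tendsto_det[OF filterlim_ident])
  then have "\<forall>\<^sub>F G in nhds (mat 1 :: real ^ 'n ^ 'n). \<bar>det G - 1\<bar> < \<eta>"
    using assms by (auto simp: tendsto_iff dist_real_def)
  then obtain d where d: "0 < d" "\<And>G :: real ^ 'n ^ 'n. dist G (mat 1) < d \<Longrightarrow> \<bar>det G - 1\<bar> < \<eta>"
    unfolding eventually_nhds_metric by blast
  \<comment> \<open>The tolerance for a single matrix entry: there are \<open>n ^ 2\<close> entries,
    and their total deviation must stay below \<open>d\<close>.\<close>
  define \<kappa> where "\<kappa> = d / (2 * (real CARD('n))\<^sup>2)"
  have \<kappa>: "\<kappa> > 0" "(real CARD('n))\<^sup>2 * \<kappa> < d" using d(1) by (auto simp: \<kappa>_def)
  \<comment> \<open>For \<open>\<epsilon> \<le> 1\<close> one has \<open>(1 + \<epsilon>)^2 - 1 = 2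
    * \<epsilon> + \<epsilon>^2 \<le> 3 * \<epsilon> \<le> \<kappa>\<close>.\<close>
  define \<epsilon> where "\<epsilon> = min 1 (\<kappa> / 3)"
  have \<epsilon>: "0 < \<epsilon>" "(1 + \<epsilon>)\<^sup>2 - 1 \<le> \<kappa>"
  proof -
    show "0 < \<epsilon>" using \<kappa> by (simp add: \<epsilon>_def)
    have "\<epsilon> * \<epsilon> \<le> 1 * \<epsilon>" by (rule mult_right_mono) (use \<open>0 < \<epsilon>\<close> in \<open>auto simp: \<epsilon>_def\<close>)
    moreover have "3 * \<epsilon> \<le> \<kappa>" by (auto simp: \<epsilon>_def)
    ultimately show "(1 + \<epsilon>)\<^sup>2 - 1 \<le> \<kappa>" by (simp add: power2_eq_square algebra_simps)
  qed
  show thesis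
  proof (rule that[OF \<epsilon>(1)])
    fix B B0 :: "real ^ 'n \<Rightarrow> real ^ 'n \<Rightarrow> real"
    assume B: "inner_form B" and B0: "inner_form B0"
      and close: "\<And>v. B0 v v / (1 + \<epsilon>)\<^sup>2 \<le> B v v \<and> B v v \<le> (1 + \<epsilon>)\<^sup>2 * B0 v v"
    obtain L :: "real ^ 'n \<Rightarrow> real ^ 'n" where L: "linear L" "gram (\<lambda>u v. B0 (L u) (L v)) = mat 1"
      using inner_form_orthonormal_frame[OF B0] by blast
    have bil: "bilinear B" "bilinear B0" and sym: "\<And>u v. B u v = B v u" "\<And>u v. B0 u v = B0 v u"
      using B B0 by (auto simp: inner_form_def)
    have nn: "0 \<le> B0 v v" for v
      using B0 bilinear_lzero[OF bil(2), of v] by (cases "v = 0") (auto simp: inner_form_def less_imp_le)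
    have diff: "\<bar>B v v - B0 v v\<bar> \<le> \<kappa> * B0 v v" for v
    proof -
      define q where "q = (1 + \<epsilon>)\<^sup>2"
      have q: "q \<ge> 1" "q - 1 \<le> \<kappa>" using \<epsilon> by (auto simp: q_def)
      \<comment> \<open>Equivalent to \<open>1 / q \<ge> 2 - q\<close>: dividing by \<open>q\<close>
        loses no more than multiplying by \<open>q\<close> gains, so the lower bound in
        \<open>close\<close> is covered by the same \<open>\<kappa>\<close> as the upper
        one.\<close>
      have "(2 - q) * q \<le> 1" using zero_le_square[of "q - 1"] by (simp add: algebra_simps)
      then have "2 - q \<le> 1 / q" using q by (simp add: field_simps)
      then have "(2 - q) * B0 v v \<le> B0 v v / q"
        using mult_right_mono[OF _ nn[of v], of "2 - q" "1 / q"] by simp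
      then have "(2 - q) * B0 v v \<le> B v v" "B v v \<le> q * B0 v v"
        using close[of v] by (auto simp: q_def)
      moreover have "(q - 1) * B0 v v \<le> \<kappa> * B0 v v" by (rule mult_right_mono[OF q(2) nn])
      ultimately show ?thesis by (simp add: abs_le_iff algebra_simps)
    qed
    define C where "C u v = B (L u) (L v)" for u v
    define C0 where "C0 u v = B0 (L u) (L v)" for u v
    have C0: "C0 (axis i 1) (axis j 1) = (if i = j then 1 else 0)" for i j
      using L(2) by (simp add: C0_def gram_def mat_def vec_eq_iff)
    have bilC: "bilinear C" "bilinear C0"
      using bil L(1) by (auto simp: C_def C0_def bilinear_def intro: linear_compose[unfolded o_def])
    have symC: "C u v = C v u" "C0 u v = C0 v u" for u v
      using sym by (auto simp: C_def C0_def)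
    have par: "C0 (u + v) (u + v) + C0 (u - v) (u - v) = 2 * C0 u u + 2 * C0 v v" for u v
      using symC(2)[of u v] by (simp add: bilinear_ladd[OF bilC(2)] bilinear_radd[OF bilC(2)]
        bilinear_lsub[OF bilC(2)] bilinear_rsub[OF bilC(2)])
    \<comment> \<open>Polarization reduces an entry to values on the diagonal, where
      \<open>diff\<close> applies. By the parallelogram law the two error terms add up to at most
      \<open>\<kappa> * (2 + 2)\<close>, which cancels the factor \<open>4\<close>.\<close>
    have entry: "\<bar>C (axis i 1) (axis j 1) - C0 (axis i 1) (axis j 1)\<bar> \<le> \<kappa>" for i j
    proof -
      let ?u = "axis i 1" and ?v = "axis j 1 :: real ^ 'n"
      have "4 * (C ?u ?v - C0 ?u ?v) = (C (?u + ?v) (?u + ?v) - C0 (?u + ?v) (?u + ?v))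
          - (C (?u - ?v) (?u - ?v) - C0 (?u - ?v) (?u - ?v))"
        using bilinear_polarization[OF bilC(1) symC(1), of ?u ?v]
          bilinear_polarization[OF bilC(2) symC(2), of ?u ?v] by simp
      then have "4 * \<bar>C ?u ?v - C0 ?u ?v\<bar> \<le> \<kappa> * C0 (?u + ?v) (?u + ?v) + \<kappa> * C0 (?u - ?v) (?u - ?v)"
        using diff[of "L (?u + ?v)", folded C_def C0_def] diff[of "L (?u - ?v)", folded C_def C0_def]
        by linarith
      also have "\<dots> = \<kappa> * (2 * C0 ?u ?u + 2 * C0 ?v ?v)"
        by (simp only: par[symmetric] distrib_left)
      finally show ?thesis by (simp add: C0)
    qed
    have "dist (gram C) (mat 1) \<le> (\<Sum>i\<in>UNIV. \<Sum>j\<in>UNIV. \<bar>(gram C - mat 1) $ i $ j\<bar>)"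
    proof -
      have "dist (gram C) (mat 1) \<le> (\<Sum>i\<in>UNIV. norm ((gram C - mat 1) $ i))"
        unfolding dist_norm by (rule norm_vec_def[THEN eq_refl, THEN order_trans]) (rule L2_set_le_sum, simp)
      also have "\<dots> \<le> (\<Sum>i\<in>UNIV. \<Sum>j\<in>UNIV. \<bar>(gram C - mat 1) $ i $ j\<bar>)"
        by (intro sum_mono norm_le_l1_cart)
      finally show ?thesis .
    qed
    also have "\<dots> \<le> (\<Sum>i\<in>(UNIV::'n set). \<Sum>j\<in>(UNIV::'n set). \<kappa>)"
      using entry by (intro sum_mono) (simp add: gram_def mat_def C0)
    also have "\<dots> < d" using \<kappa>(2) by (simp add: power2_eq_square)
    finally have "\<bar>det (gram C) - 1\<bar> < \<eta>" by (rule d(2))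
    moreover have "det (gram C) = (det (matrix L))\<^sup>2 * det (gram B)"
      "(det (matrix L))\<^sup>2 * det (gram B0) = 1"
      using det_gram_pullback[OF bil(1) L(1)] det_gram_pullback[OF bil(2) L(1)] L(2)
      by (auto simp: C_def[abs_def])
    then have "det (gram C) = det (gram B) / det (gram B0)"
      using det_gram_pos[OF B0] by (simp add: field_simps)
    ultimately show "\<bar>det (gram B) / det (gram B0) - 1\<bar> < \<eta>" by simp
  qed
qed

subsection \<open>Change of variables\<close>

text \<open>Links the nonnegative integrals that define volumes with absolute integrability, in
  terms of which the change of variables formula is phrased: finiteness is integrability, and then
  the values agree.\<close>

lemma nn_integral_eq_absolutely_integrable:
  fixes g :: "'a::euclidean_space \<Rightarrow> real"
  assumes "(\<lambda>x. indicator A x * g x) \<in> borel_measurable lebesgue" "\<And>x. x \<in> A \<Longrightarrow> 0 \<le> g x"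
  shows "(\<integral>\<^sup>+x\<in>A. ennreal (g x) \<partial>lebesgue) < \<infinity> \<longleftrightarrow> g absolutely_integrable_on A"
    and "g absolutely_integrable_on A \<Longrightarrow> (\<integral>\<^sup>+x\<in>A. ennreal (g x) \<partial>lebesgue) = ennreal (integral A g)"
proof -
  have eq: "(\<integral>\<^sup>+x\<in>A. ennreal (g x) \<partial>lebesgue) = (\<integral>\<^sup>+x. ennreal (indicator A x * g x) \<partial>lebesgue)"
    by (intro nn_integral_cong) (auto simp: indicator_def)
  have nn: "0 \<le> indicator A x * g x" for x using assms(2) by (auto simp: indicator_def)
  show "g absolutely_integrable_on A \<Longrightarrow> (\<integral>\<^sup>+x\<in>A. ennreal (g x) \<partial>lebesgue) = ennreal (integral A g)"
  proof -
    assume g: "g absolutely_integrable_on A"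
    then have "integrable lebesgue (\<lambda>x. indicator A x * g x)" by (simp add: set_integrable_def)
    then have "(\<integral>\<^sup>+x. ennreal (indicator A x * g x) \<partial>lebesgue) = ennreal (LINT x|lebesgue. indicator A x * g x)"
      using nn by (intro nn_integral_eq_integral) auto
    also have "(LINT x|lebesgue. indicator A x * g x) = integral A g"
      using set_lebesgue_integral_eq_integral(2)[OF g] by (simp add: set_lebesgue_integral_def)
    finally show ?thesis unfolding eq .
  qed
  then show "(\<integral>\<^sup>+x\<in>A. ennreal (g x) \<partial>lebesgue) < \<infinity> \<longleftrightarrow> g absolutely_integrable_on A"
    unfolding eq set_integrable_def using nn assms(1)
    by (auto intro!: integrableI_nonneg simp: set_integrable_def)
qed

lemma nn_integral_change_of_variables_wellorder:
  fixes T :: "real ^ 'm::{finite,wellorder} \<Rightarrow> real ^ 'm::_" and f :: "real ^ 'm::_ \<Rightarrow> real"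
  assumes S: "S \<in> sets lebesgue" and T': "\<And>x. x \<in> S \<Longrightarrow> (T has_derivative T' x) (at x within S)"
    and inj: "inj_on T S" and f: "\<And>y. y \<in> T ` S \<Longrightarrow> 0 \<le> f y"
    and m1: "(\<lambda>y. indicator (T ` S) y * f y) \<in> borel_measurable lebesgue"
    and m2: "(\<lambda>x. indicator S x * (\<bar>det (matrix (T' x))\<bar> * f (T x))) \<in> borel_measurable lebesgue"
  shows "(\<integral>\<^sup>+y\<in>T ` S. ennreal (f y) \<partial>lebesgue) =
    (\<integral>\<^sup>+x\<in>S. ennreal (\<bar>det (matrix (T' x))\<bar> * f (T x)) \<partial>lebesgue)"
proof -
  let ?D = "\<lambda>x. \<bar>det (matrix (T' x))\<bar> * f (T x)"
  \<comment> \<open>Real functions are regarded as functions into \<open>real ^ 1\<close>, to fit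
    the vector valued formula. The value \<open>b\<close> stays free, so that the integral of either
    side can be inserted.\<close>
  have iff: "?D absolutely_integrable_on S \<and> integral S ?D = b \<longleftrightarrow>
      f absolutely_integrable_on (T ` S) \<and> integral (T ` S) f = b" for b
    using has_absolute_integral_change_of_variables[OF S T' inj, of "\<lambda>x. (vec (f x) :: real ^ 1)" "vec b"]
    by (simp add: absolutely_integrable_on_1_iff integral_on_1_eq o_def)
  have D: "0 \<le> ?D x" if "x \<in> S" for x using f that by simp
  show ?thesis
  proof (cases "f absolutely_integrable_on (T ` S)")
    case True
    then have "?D absolutely_integrable_on S \<and> integral S ?D = integral (T ` S) f"
      using iff[of "integral (T ` S) f"] by simp
    then show ?thesis
      using nn_integral_eq_absolutely_integrable(2)[OF m1 f True]
        nn_integral_eq_absolutely_integrable(2)[OF m2 D] by simp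
  next
    case False
    then have "\<not> ?D absolutely_integrable_on S" using iff[of "integral S ?D"] by auto
    then show ?thesis
      using nn_integral_eq_absolutely_integrable(1)[OF m1 f] False
        nn_integral_eq_absolutely_integrable(1)[OF m2 D] by (simp add: less_top[symmetric])
  qed
qed

text \<open>The library proves the change of variables formula for index types of class \<open>wellorder\<close>;
  every finite index type is in bijection with one of these.\<close>

typedef (overloaded) 'n idx = "{..<CARD('n::finite)}"
  by (auto simp: lessThan_iff intro!: exI[of _ 0])

instance idx :: (finite) finite
proof
  have "(UNIV :: 'a idx set) = Abs_idx ` {..<CARD('a)}"
    using type_definition.Abs_image[OF type_definition_idx] by metis
  then show "finite (UNIV :: 'a idx set)" by (metis finite_imageI finite_lessThan)
qed

instantiation idx :: (finite) wellorder
begin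

definition less_eq_idx :: "'a idx \<Rightarrow> 'a idx \<Rightarrow> bool" where "less_eq_idx i j \<longleftrightarrow> Rep_idx i \<le> Rep_idx j"
definition less_idx :: "'a idx \<Rightarrow> 'a idx \<Rightarrow> bool" where "less_idx i j \<longleftrightarrow> Rep_idx i < Rep_idx j"

instance
proof
  fix P :: "'a idx \<Rightarrow> bool" and a
  assume step: "\<And>x. (\<And>y. y < x \<Longrightarrow> P y) \<Longrightarrow> P x"
  show "P a"
  proof (induction "Rep_idx a" arbitrary: a rule: less_induct)
    case less
    show ?case by (rule step, rule less) (simp add: less_idx_def)
  qed
qed (auto simp: less_eq_idx_def less_idx_def Rep_idx_inject)

end

lemma ex_bij_idx: "\<exists>p :: 'n::finite idx \<Rightarrow> 'n. bij p"
proof -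
  have "bij_betw Abs_idx {..<CARD('n)} (UNIV :: 'n idx set)"
    using type_definition.Abs_image[OF type_definition_idx] Abs_idx_inject
    by (metis bij_betw_def inj_onI)
  then have "card (UNIV :: 'n idx set) = CARD('n)"
    by (metis bij_betw_same_card card_lessThan)
  then show ?thesis using finite_same_card_bij[of "UNIV :: 'n idx set" "UNIV :: 'n set"] by auto
qed

definition reindex :: "('k \<Rightarrow> 'n) \<Rightarrow> real ^ 'n \<Rightarrow> real ^ 'k" where
  "reindex p x = (\<chi> i. x $ p i)"

lemma reindex_nth [simp]: "reindex p x $ i = x $ p i"
  by (simp add: reindex_def)

lemma reindex_inverse:
  assumes "bij p"
  shows "reindex p (reindex (inv p) x) = x" "reindex (inv p) (reindex p y) = y"
  using assms by (auto simp: vec_eq_iff bij_is_surj bij_is_inj surj_f_inv_f)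

lemma bounded_linear_reindex: "bounded_linear (reindex p :: real ^ 'n::finite \<Rightarrow> real ^ 'k::finite)"
proof -
  have "linear (reindex p :: real ^ 'n \<Rightarrow> real ^ 'k)"
    by (rule linearI) (simp_all add: vec_eq_iff)
  then show ?thesis by (rule linear_conv_bounded_linear[THEN iffD1])
qed

text \<open>Conjugation by \<open>p\<close> is a sign preserving bijection between the permutations
  of the two index types, so the Leibniz sums agree term by term.\<close>

lemma det_reindex:
  fixes M :: "real ^ 'n::finite ^ 'n" and p :: "'k::finite \<Rightarrow> 'n"
  assumes p: "bij p"
  shows "det (\<chi> i j. M $ p i $ p j) = det M"
proof -
  have inj: "inj p" and bij: "bij_betw p UNIV UNIV" using p by (auto simp: bij_is_inj)
  have bb: "bij_betw (map_permutation UNIV p) {q. q permutes (UNIV::'k set)} {q. q permutes (UNIV::'n set)}"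
  proof (rule bij_betwI[where g = "map_permutation UNIV (inv p)"])
    show "map_permutation UNIV p \<in> {q. q permutes UNIV} \<rightarrow> {q. q permutes UNIV}"
      using map_permutation_permutes[OF bij] by auto
    show "map_permutation UNIV (inv p) \<in> {q. q permutes UNIV} \<rightarrow> {q. q permutes UNIV}"
      using map_permutation_permutes[OF bij_betw_inv_into[OF bij]] by auto
    have pp: "map_permutation UNIV p q = p \<circ> q \<circ> inv p" for q
      using p by (simp add: map_permutation_def restrict_id_def bij_is_surj fun_eq_iff)
    have qq: "map_permutation UNIV (inv p) q = inv p \<circ> q \<circ> p" for q
      using bij_imp_bij_inv[OF p] inv_inv_eq[OF p]
      by (simp add: map_permutation_def restrict_id_def bij_is_surj fun_eq_iff)
    show "map_permutation UNIV (inv p) (map_permutation UNIV p q) = q" for q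
      unfolding pp qq using inj by (simp add: fun_eq_iff)
    show "map_permutation UNIV p (map_permutation UNIV (inv p) q) = q" for q
      unfolding pp qq using p by (simp add: fun_eq_iff bij_is_surj surj_f_inv_f)
  qed
  have "det M = (\<Sum>q\<in>{q. q permutes (UNIV::'k set)}.
      of_int (sign (map_permutation UNIV p q)) * (\<Prod>i\<in>UNIV. M $ i $ map_permutation UNIV p q i))"
    unfolding det_def by (rule sum.reindex_bij_betw[OF bb, symmetric])
  also have "\<dots> = (\<Sum>q\<in>{q. q permutes (UNIV::'k set)}.
      of_int (sign q) * (\<Prod>i\<in>UNIV. M $ p i $ p (q i)))"
  proof (rule sum.cong[OF refl])
    fix q assume "q \<in> {q. q permutes (UNIV::'k set)}"
    then have "sign (map_permutation UNIV p q) = sign q"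
      by (intro sign_map_permutation inj) auto
    moreover have "(\<Prod>i\<in>UNIV. M $ i $ map_permutation UNIV p q i) =
        (\<Prod>i\<in>UNIV. M $ p i $ map_permutation UNIV p q (p i))"
      by (rule prod.reindex_bij_betw[OF bij, symmetric])
    ultimately show "of_int (sign (map_permutation UNIV p q)) * (\<Prod>i\<in>UNIV. M $ i $ map_permutation UNIV p q i)
        = of_int (sign q) * (\<Prod>i\<in>UNIV. M $ p i $ p (q i))"
      by (simp add: map_permutation_apply[OF inj])
  qed
  finally show ?thesis by (simp add: det_def)
qed

text \<open>The preimage of a box under a renaming of coordinates is a box with the same side
  lengths in another order, and the values on boxes determine Lebesgue measure.\<close>

lemma lborel_distr_reindex:
  fixes p :: "'k::finite \<Rightarrow> 'n::finite"
  assumes "bij p"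
  shows "distr lborel borel (reindex p) = (lborel :: (real ^ 'k) measure)"
proof (rule lborel_eqI[symmetric])
  have [measurable]: "reindex p \<in> borel_measurable (borel :: (real ^ 'n) measure)"
    using bounded_linear_reindex[of p]
    by (intro borel_measurable_continuous_onI linear_continuous_on) auto
  fix l u :: "real ^ 'k" assume lu: "\<And>b. b \<in> Basis \<Longrightarrow> l \<bullet> b \<le> u \<bullet> b"
  have lu': "l $ i \<le> u $ i" for i using lu[of "axis i 1"] by (simp add: axis_in_Basis_iff inner_axis)
  have pre: "reindex p -` box l u = box (reindex (inv p) l) (reindex (inv p) u)"
  proof -
    have "(\<forall>i. l $ i < x $ p i \<and> x $ p i < u $ i) \<longleftrightarrow>
      (\<forall>a. l $ inv p a < x $ a \<and> x $ a < u $ inv p a)" for x :: "real ^ 'n"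
      using assms by (metis bij_inv_eq_iff)
    then show ?thesis by (auto simp: mem_box_cart)
  qed
  have "emeasure (distr lborel borel (reindex p)) (box l u) =
      emeasure lborel (box (reindex (inv p) l) (reindex (inv p) u))"
    by (simp add: emeasure_distr pre)
  also have "\<dots> = ennreal (\<Prod>b\<in>Basis. (reindex (inv p) u - reindex (inv p) l) \<bullet> b)"
    by (rule emeasure_lborel_box) (use lu' in \<open>auto simp: Basis_vec_def inner_axis\<close>)
  also have "(\<Prod>b\<in>Basis. (reindex (inv p) u - reindex (inv p) l) \<bullet> b) = (\<Prod>a\<in>UNIV. (u - l) $ inv p a)"
    by (simp add: Basis_vec_def UNION_singleton_eq_range prod.reindex inj_on_def axis_eq_axis inner_axis)
  also have "\<dots> = (\<Prod>i\<in>UNIV. (u - l) $ i)"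
    by (rule prod.reindex_bij_betw) (use assms bij_imp_bij_inv in auto)
  also have "\<dots> = (\<Prod>b\<in>Basis. (u - l) \<bullet> b)"
    by (simp add: Basis_vec_def UNION_singleton_eq_range prod.reindex inj_on_def axis_eq_axis inner_axis)
  finally show "emeasure (distr lborel borel (reindex p)) (box l u) = ennreal (\<Prod>b\<in>Basis. (u - l) \<bullet> b)" .
qed simp

text \<open>Measurability between the completions requires that preimages of null sets are null, and
  this follows from the invariance on Borel sets.\<close>

lemma lebesgue_distr_reindex:
  fixes p :: "'k::finite \<Rightarrow> 'n::finite"
  assumes "bij p"
  shows "reindex p \<in> lebesgue \<rightarrow>\<^sub>M (lebesgue :: (real ^ 'k) measure)"
    and "distr lebesgue lebesgue (reindex p) = (lebesgue :: (real ^ 'k) measure)"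
proof -
  have m: "reindex p \<in> borel_measurable (borel :: (real ^ 'n) measure)"
    using bounded_linear_reindex[of p]
    by (intro borel_measurable_continuous_onI linear_continuous_on) auto
  then have m': "reindex p \<in> (lebesgue :: (real ^ 'n) measure) \<rightarrow>\<^sub>M lborel"
    by (auto intro: measurable_completion)
  have d: "distr lebesgue lborel (reindex p) = (lborel :: (real ^ 'k) measure)"
  proof -
    have "distr (lebesgue :: (real ^ 'n) measure) lborel (reindex p) = distr lborel lborel (reindex p)"
      by (rule distr_completion) (use m in simp)
    also have "\<dots> = distr lborel borel (reindex p)" by (rule distr_cong) auto
    finally show ?thesis using lborel_distr_reindex[OF assms] by simp
  qed
  show "reindex p \<in> lebesgue \<rightarrow>\<^sub>M (lebesgue :: (real ^ 'k) measure)"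
    by (rule completion.measurable_completion2[OF m']) (simp add: d)
  show "distr lebesgue lebesgue (reindex p) = (lebesgue :: (real ^ 'k) measure)"
    using completion.completion_distr_eq[OF m'] by (simp add: d)
qed

text \<open>\<open>T\<close> is conjugated to a map of the space indexed by \<open>'n idx\<close>.
  The renaming preserves Lebesgue measure and, by \<open>det_reindex\<close>, the Jacobian
  determinant.\<close>

lemma nn_integral_change_of_variables:
  fixes T :: "real ^ 'n::finite \<Rightarrow> real ^ 'n" and f :: "real ^ 'n \<Rightarrow> real"
  assumes S: "S \<in> sets lebesgue" and T': "\<And>x. x \<in> S \<Longrightarrow> (T has_derivative T' x) (at x within S)"
    and inj: "inj_on T S" and f: "\<And>y. y \<in> T ` S \<Longrightarrow> 0 \<le> f y"
    and m1: "(\<lambda>y. indicator (T ` S) y * f y) \<in> borel_measurable lebesgue"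
    and m2: "(\<lambda>x. indicator S x * (\<bar>det (matrix (T' x))\<bar> * f (T x))) \<in> borel_measurable lebesgue"
  shows "(\<integral>\<^sup>+y\<in>T ` S. ennreal (f y) \<partial>lebesgue) =
    (\<integral>\<^sup>+x\<in>S. ennreal (\<bar>det (matrix (T' x))\<bar> * f (T x)) \<partial>lebesgue)"
proof -
  obtain p :: "'n idx \<Rightarrow> 'n" where p: "bij p" using ex_bij_idx by blast
  have q: "bij (inv p)" using p by (rule bij_imp_bij_inv)
  define R :: "real ^ 'n \<Rightarrow> real ^ 'n idx" where "R = reindex p"
  define Q :: "real ^ 'n idx \<Rightarrow> real ^ 'n" where "Q = reindex (inv p)"
  have RQ: "R (Q z) = z" "Q (R x) = x" for z x
    using reindex_inverse[OF p] by (auto simp: R_def Q_def)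
  have bl: "bounded_linear R" "bounded_linear Q" by (auto simp: R_def Q_def bounded_linear_reindex)
  have Qm: "Q \<in> lebesgue \<rightarrow>\<^sub>M lebesgue" and Qd: "distr lebesgue lebesgue Q = lebesgue"
    using lebesgue_distr_reindex[OF q] by (auto simp: Q_def)
  have im: "R ` A = Q -` A \<inter> space lebesgue" for A
  proof -
    have "z \<in> R ` A \<longleftrightarrow> Q z \<in> A" for z by (metis RQ image_iff)
    then show ?thesis by auto
  qed
  have trans: "(\<integral>\<^sup>+x\<in>A. ennreal (h x) \<partial>lebesgue) = (\<integral>\<^sup>+z\<in>R ` A. ennreal (h (Q z)) \<partial>lebesgue)"
    and meas: "(\<lambda>z. indicator (R ` A) z * h (Q z)) \<in> borel_measurable lebesgue"
    if "(\<lambda>x. indicator A x * h x) \<in> borel_measurable lebesgue" for A and h :: "real ^ 'n \<Rightarrow> real"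
  proof -
    have ind: "indicator (R ` A) z = (indicator A (Q z) :: 'z::zero_neq_one)" for z
      using im[of A] by (simp add: indicator_def)
    have e: "ennreal (indicator A x * c) = ennreal c * indicator A x" for x c
      by (cases "x \<in> A") auto
    show "(\<lambda>z. indicator (R ` A) z * h (Q z)) \<in> borel_measurable lebesgue"
      unfolding ind using measurable_compose[OF Qm that] by simp
    have "(\<integral>\<^sup>+x. ennreal (indicator A x * h x) \<partial>distr lebesgue lebesgue Q) =
      (\<integral>\<^sup>+z. ennreal (indicator A (Q z) * h (Q z)) \<partial>lebesgue)"
      by (rule nn_integral_distr[OF Qm]) (use that in measurable)
    then have "(\<integral>\<^sup>+x. ennreal (indicator A x * h x) \<partial>lebesgue) =
      (\<integral>\<^sup>+z. ennreal (indicator A (Q z) * h (Q z)) \<partial>lebesgue)"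
      by (simp only: Qd)
    then show "(\<integral>\<^sup>+x\<in>A. ennreal (h x) \<partial>lebesgue) = (\<integral>\<^sup>+z\<in>R ` A. ennreal (h (Q z)) \<partial>lebesgue)"
      unfolding ind e .
  qed
  define T2 where "T2 = R \<circ> T \<circ> Q"
  define T2' where "T2' z = R \<circ> T' (Q z) \<circ> Q" for z
  have lin: "linear (T' x)" if "x \<in> S" for x
    using has_derivative_linear[OF T'[OF that]] .
  have detT2: "det (matrix (T2' z)) = det (matrix (T' (Q z)))" for z
  proof -
    have Qa: "Q (axis j 1) = axis (p j) 1" for j
    proof -
      have "inv p i = j \<longleftrightarrow> i = p j" for i using p by (metis bij_inv_eq_iff)
      then show ?thesis by (simp add: Q_def vec_eq_iff axis_def)
    qed
    have "matrix (T2' z) = (\<chi> i j. matrix (T' (Q z)) $ p i $ p j)"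
      by (simp add: matrix_def vec_eq_iff T2'_def Qa) (simp add: R_def)
    then show ?thesis using det_reindex[OF p] by simp
  qed
  have im2: "R ` T ` S = T2 ` R ` S" by (auto simp: T2_def RQ image_image)
  have "(\<integral>\<^sup>+y\<in>T ` S. ennreal (f y) \<partial>lebesgue) = (\<integral>\<^sup>+z\<in>T2 ` R ` S. ennreal (f (Q z)) \<partial>lebesgue)"
    unfolding trans[OF m1] im2 ..
  also have "\<dots> = (\<integral>\<^sup>+z\<in>R ` S. ennreal (\<bar>det (matrix (T2' z))\<bar> * f (Q (T2 z))) \<partial>lebesgue)"
  proof (rule nn_integral_change_of_variables_wellorder)
    show "R ` S \<in> sets lebesgue" unfolding im using Qm S by (rule measurable_sets)
    show "inj_on T2 (R ` S)" using inj by (auto simp: inj_on_def T2_def RQ) (metis RQ(2))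
    show "\<And>y. y \<in> T2 ` R ` S \<Longrightarrow> 0 \<le> f (Q y)" using f by (auto simp: T2_def RQ)
    show "(\<lambda>y. indicator (T2 ` R ` S) y * f (Q y)) \<in> borel_measurable lebesgue"
      using meas[OF m1] unfolding im2 .
    show "(\<lambda>x. indicator (R ` S) x * (\<bar>det (matrix (T2' x))\<bar> * f (Q (T2 x)))) \<in> borel_measurable lebesgue"
      using meas[OF m2] by (simp add: detT2 T2_def RQ)
    fix z assume "z \<in> R ` S"
    then have Qz: "Q z \<in> S" by (auto simp: RQ)
    have "(T \<circ> Q has_derivative T' (Q z) \<circ> Q) (at z within R ` S)"
    proof (rule diff_chain_within)
      show "(Q has_derivative Q) (at z within R ` S)"
        by (rule bounded_linear_imp_has_derivative[OF bl(2)])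
      show "(T has_derivative T' (Q z)) (at (Q z) within Q ` R ` S)"
        using T'[OF Qz] by (simp add: image_image RQ)
    qed
    then show "(T2 has_derivative T2' z) (at z within R ` S)"
      using bounded_linear.has_derivative[OF bl(1)] by (simp add: T2_def T2'_def o_def)
  qed
  also have "\<dots> = (\<integral>\<^sup>+x\<in>S. ennreal (\<bar>det (matrix (T' x))\<bar> * f (T x)) \<partial>lebesgue)"
    unfolding trans[OF m2] by (simp add: detT2 T2_def RQ)
  finally show ?thesis .
qed

subsection \<open>Integration by parts and cutoff functions\<close>

lemma integrable_lborel_compact_support:
  fixes f :: "'a::euclidean_space \<Rightarrow> real"
  assumes "continuous_on UNIV f" "compact K" "\<And>x. x \<notin> K \<Longrightarrow> f x = 0"
  shows "integrable lborel f"
proof -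
  have "integrable lborel (\<lambda>x. indicator K x *\<^sub>R f x)"
    by (rule borel_integrable_compact[OF assms(2) continuous_on_subset[OF assms(1)]]) simp
  also have "(\<lambda>x. indicator K x *\<^sub>R f x) = f"
    using assms(3) by (auto simp: indicator_def fun_eq_iff)
  finally show ?thesis .
qed

text \<open>The integral of a difference quotient of \<open>f\<close> vanishes by translation invariance.\<close>

lemma integral_directional_derivative_eq_0:
  fixes f :: "'a::euclidean_space \<Rightarrow> real"
  assumes f: "smooth_on UNIV f" and K: "compact K" "\<And>x. x \<notin> K \<Longrightarrow> f x = 0"
  shows "integrable lebesgue (\<lambda>x. frechet_derivative f (at x) v)"
    and "(LINT x|lebesgue. frechet_derivative f (at x) v) = 0"
proof -
  define D where "D x = frechet_derivative f (at x) v" for x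
  have contf: "continuous_on UNIV f" by (rule smooth_on_continuous_on[OF f])
  have contD: "continuous_on UNIV D"
    unfolding D_def by (rule smooth_on_continuous_on[OF smooth_on_frechet_derivative[OF f]])
  have f': "(f has_derivative frechet_derivative f (at x)) (at x)" for x
    by (rule smooth_on_has_derivative[OF f UNIV_I])
  have D0: "D x = 0" if "x \<notin> K" for x
  proof -
    have "frechet_derivative f (at x) = frechet_derivative (\<lambda>_. 0) (at x)"
      by (rule frechet_derivative_cong_open[of "- K"])
        (use that K compact_imp_closed[OF K(1)] in \<open>auto simp: open_Compl\<close>)
    also have "\<dots> = (\<lambda>_. 0)" by (rule frechet_derivative_eqI) simp
    finally show ?thesis by (simp add: D_def)
  qed
  have intf: "integrable lborel f" and intD: "integrable lborel D"
    using integrable_lborel_compact_support[OF contf K] integrable_lborel_compact_support[OF contD K(1) D0]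
    by auto
  have "bounded (D ` K)"
    using contD K(1) by (intro compact_imp_bounded compact_continuous_image) (auto intro: continuous_on_subset)
  then obtain C0 where C0: "\<forall>y\<in>D ` K. norm y \<le> C0" unfolding bounded_iff by blast
  define C where "C = max C0 0"
  have C: "\<bar>D x\<bar> \<le> C" for x using C0 D0[of x] by (cases "x \<in> K") (auto simp: C_def)
  obtain R where R: "\<forall>x\<in>K. norm x \<le> R" using compact_imp_bounded[OF K(1)] unfolding bounded_iff by blast
  \<comment> \<open>The step lengths tend to \<open>0\<close> without vanishing, and they are at
    most \<open>1\<close>. The latter keeps the supports of all difference quotients in one ball of
    radius \<open>R + norm v\<close>.\<close>
  define h where "h m = 1 / real (Suc m)" for m
  have h: "0 < h m" "h m \<le> 1" for m by (auto simp: h_def)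
  define q where "q m x = (f (h m *\<^sub>R v + x) - f x) / h m" for m x
  have line: "((\<lambda>s. f (s *\<^sub>R v + x)) has_real_derivative D (s *\<^sub>R v + x)) (at s)" for s x
  proof -
    have "((\<lambda>s. f (s *\<^sub>R v + x)) has_derivative (\<lambda>u. frechet_derivative f (at (s *\<^sub>R v + x)) (u *\<^sub>R v))) (at s)"
      by (rule has_derivative_compose[of "\<lambda>s. s *\<^sub>R v + x" "\<lambda>u. u *\<^sub>R v" s UNIV f, OF _ f'])
        (auto intro!: derivative_eq_intros)
    also have "(\<lambda>u. frechet_derivative f (at (s *\<^sub>R v + x)) (u *\<^sub>R v)) = (*) (D (s *\<^sub>R v + x))"
      using linear_cmul[OF has_derivative_linear[OF f'[of "s *\<^sub>R v + x"]]] by (auto simp: D_def fun_eq_iff)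
    finally show ?thesis by (simp add: has_field_derivative_def)
  qed
  \<comment> \<open>By the mean value theorem a difference quotient is a value of the derivative.
    This makes the bound uniform in \<open>m\<close>, as dominated convergence requires.\<close>
  have qb: "\<bar>q m x\<bar> \<le> C" for m x
  proof -
    obtain z where "f (h m *\<^sub>R v + x) - f (0 *\<^sub>R v + x) = (h m - 0) * D (z *\<^sub>R v + x)"
      using MVT2[of 0 "h m" "\<lambda>s. f (s *\<^sub>R v + x)" "\<lambda>s. D (s *\<^sub>R v + x)"] line h(1)[of m] by auto
    then have "q m x = D (z *\<^sub>R v + x)" using h(1)[of m] by (simp add: q_def)
    then show ?thesis using C by simp
  qed
  have q0: "q m x = 0" if "x \<notin> cball 0 (R + norm v)" for m x
  proof -
    have "R < norm x" using that norm_ge_zero[of v] unfolding mem_cball_0 by linarith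
    then have "x \<notin> K" using R by force
    moreover have "h m *\<^sub>R v + x \<notin> K"
    proof
      assume "h m *\<^sub>R v + x \<in> K"
      then have "norm (h m *\<^sub>R v + x) \<le> R" using R by blast
      moreover have "norm x \<le> norm (h m *\<^sub>R v + x) + norm (h m *\<^sub>R v)"
        by (metis add_diff_cancel_left' norm_triangle_ineq4)
      moreover have "norm (h m *\<^sub>R v) \<le> norm v"
        using h[of m] mult_right_mono[of "h m" 1 "norm v"] by simp
      ultimately show False using that by simp
    qed
    ultimately show ?thesis using K(2) by (simp add: q_def)
  qed
  have shift: "(\<lambda>x. f (c + x)) \<in> borel_measurable lborel" "integrable lborel (\<lambda>x. f (c + x))"
     "(LINT x|lborel. f (c + x)) = (LINT x|lborel. f x)" for c
  proof -
    have m: "(+) c \<in> borel_measurable (lborel :: 'a measure)" by simp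
    have mf: "f \<in> borel_measurable borel" by (rule borel_measurable_continuous_onI[OF contf])
    show "(\<lambda>x. f (c + x)) \<in> borel_measurable lborel" using mf by simp
    show "integrable lborel (\<lambda>x. f (c + x))"
      using integrable_distr[OF m, of f] intf by (simp add: lborel_distr_plus)
    show "(LINT x|lborel. f (c + x)) = (LINT x|lborel. f x)"
      using integral_distr[OF m mf] by (simp add: lborel_distr_plus)
  qed
  have intq: "(LINT x|lborel. q m x) = 0" for m
    unfolding q_def using shift[of "h m *\<^sub>R v"] intf by simp
  have "(\<lambda>m. LINT x|lborel. q m x) \<longlonglongrightarrow> (LINT x|lborel. D x)"
  proof (rule integral_dominated_convergence[where w="\<lambda>x. C * indicator (cball 0 (R + norm v)) x"])
    show "D \<in> borel_measurable lborel" using borel_measurable_integrable[OF intD] .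
    show "q m \<in> borel_measurable lborel" for m
      unfolding q_def using shift(1)[of "h m *\<^sub>R v"] borel_measurable_integrable[OF intf] by measurable
    show "integrable lborel (\<lambda>x. C * indicator (cball 0 (R + norm v)) x)"
      by (intro integrable_mult_right integrable_real_indicator emeasure_lborel_cball_finite) auto
    show "AE x in lborel. norm (q m x) \<le> C * indicator (cball 0 (R + norm v)) x" for m
      using qb[of m] q0[of _ m] by (intro AE_I2) (auto simp: indicator_def)
    show "AE x in lborel. (\<lambda>m. q m x) \<longlonglongrightarrow> D x"
    proof (rule AE_I2)
      fix x
      have "((\<lambda>s. (f (s *\<^sub>R v + x) - f (0 *\<^sub>R v + x)) / (s - 0)) \<longlongrightarrow> D (0 *\<^sub>R v + x)) (at 0)"
        using line[of x 0] by (simp add: has_field_derivative_iff)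
      moreover have "filterlim h (at 0) sequentially"
        unfolding h_def[abs_def] filterlim_at
        using LIMSEQ_inverse_real_of_nat by (auto simp: inverse_eq_divide)
      ultimately have "(\<lambda>m. (f (h m *\<^sub>R v + x) - f (0 *\<^sub>R v + x)) / (h m - 0)) \<longlonglongrightarrow> D (0 *\<^sub>R v + x)"
        by (rule filterlim_compose)
      then show "(\<lambda>m. q m x) \<longlonglongrightarrow> D x" by (simp add: q_def)
    qed
  qed
  then have "(LINT x|lborel. D x) = 0" by (simp add: intq LIMSEQ_const_iff)
  then show "(LINT x|lebesgue. frechet_derivative f (at x) v) = 0"
    using integral_completion[OF borel_measurable_integrable[OF intD]] by (simp add: D_def[abs_def])
  show "integrable lebesgue (\<lambda>x. frechet_derivative f (at x) v)"
    using integrable_completion[OF borel_measurable_integrable[OF intD]] intD by (simp add: D_def[abs_def])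
qed

text \<open>A mean value estimate for powers; applied to radii it bounds the volume of a shell by
  its thickness times a power of the outer radius.\<close>

lemma power_Suc_diff_le:
  fixes R s :: real assumes "0 \<le> s" "s \<le> R"
  shows "R ^ Suc m - s ^ Suc m \<le> real (Suc m) * R ^ m * (R - s)"
proof (induction m)
  case (Suc m)
  have "R ^ Suc (Suc m) - s ^ Suc (Suc m) = R * (R ^ Suc m - s ^ Suc m) + s ^ Suc m * (R - s)"
    by (simp add: algebra_simps)
  also have "\<dots> \<le> R * (real (Suc m) * R ^ m * (R - s)) + R ^ Suc m * (R - s)"
    using assms Suc.IH by (intro add_mono mult_left_mono mult_right_mono power_mono) auto
  also have "\<dots> = real (Suc (Suc m)) * R ^ Suc m * (R - s)"
    by (simp add: algebra_simps)
  finally show ?case .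
qed simp

text \<open>The last bound is the point: the gradient of \<open>\<phi> m\<close> lives on \<open>E m\<close> and is at most \<open>G m\<close>, so its
  \<open>L\<^sup>1\<close> norm is of order \<open>r ^ (n - 1)\<close>, however close \<open>\<phi> m\<close> is to the indicator function.\<close>

definition cutoff_family :: "real \<Rightarrow> real ^ 'n::finite \<Rightarrow> real \<Rightarrow> real \<Rightarrow>
    (nat \<Rightarrow> real ^ 'n \<Rightarrow> real) \<Rightarrow> (nat \<Rightarrow> real) \<Rightarrow> (nat \<Rightarrow> (real ^ 'n) set) \<Rightarrow> bool" where
  "cutoff_family C a s r \<phi> G E \<longleftrightarrow>
    (\<forall>m. smooth_on UNIV (\<phi> m) \<and> (\<forall>x. 0 \<le> \<phi> m x \<and> \<phi> m x \<le> 1) \<and>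
      (\<forall>x\<in>cball a s. \<phi> m x = 1) \<and> (\<forall>x. x \<notin> cball a (2 * r) \<longrightarrow> \<phi> m x = 0) \<and>
      E m \<in> sets lborel \<and> E m \<subseteq> cball a (2 * r) \<and> 0 \<le> G m \<and>
      (\<forall>x v. \<bar>frechet_derivative (\<phi> m) (at x) v\<bar> \<le> G m * norm v * indicator (E m) x) \<and>
      G m * measure lborel (E m) \<le> C * r ^ (CARD('n) - 1)) \<and>
    (\<forall>x. (\<lambda>m. \<phi> m x) \<longlonglongrightarrow> indicator (cball a s) x)"

text \<open>The step function is applied to the squared distance, which is smooth at the centre too.
  With \<open>k = k m\<close> and \<open>R = R m\<close>, the cutoff drops from \<open>1\<close> to
  \<open>0\<close> across the shell \<open>s^2 \<le> |x - a|^2 \<le> R^2 = s^2 + 1 / k\<close>. Its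
  gradient is at most a multiple of \<open>k * R\<close> and the volume of the shell at most a
  multiple of \<open>R ^ (n - 1) * (R - s)\<close>. Since
  \<open>R * (R - s) \<le> R^2 - s^2 = 1 / k\<close>, the factor \<open>k\<close> cancels in the
  product, even for \<open>s = 0\<close>.\<close>

lemma ball_cutoffs:
  obtains C where "0 < C" "\<And>(a :: real ^ 'n::finite) s r. 0 \<le> s \<Longrightarrow> s \<le> r \<Longrightarrow> 0 < r \<Longrightarrow>
    \<exists>\<phi> G E. cutoff_family C a s r \<phi> G E"
proof -
  obtain \<psi> :: "real \<Rightarrow> real" and K where \<psi>: "smooth_on UNIV \<psi>" "\<And>x. 0 \<le> \<psi> x" "\<And>x. \<psi> x \<le> 1"
    "\<And>x. x \<le> 0 \<Longrightarrow> \<psi> x = 1" "\<And>x. 1 \<le> x \<Longrightarrow> \<psi> x = 0"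
    "\<And>x. \<bar>deriv \<psi> x\<bar> \<le> K" "\<And>x. x \<notin> {0..1} \<Longrightarrow> deriv \<psi> x = 0"
    using smooth_step_exists by blast
  have K: "0 \<le> K" using \<psi>(6)[of 0] by linarith
  let ?n = "CARD('n)"
  define \<omega> where "\<omega> = unit_ball_vol (real ?n)"
  have \<omega>: "0 \<le> \<omega>" by (simp add: \<omega>_def)
  \<comment> \<open>The power of \<open>2\<close> accounts for outer radii up to
    \<open>2 * r\<close>. The summand \<open>1\<close> makes \<open>C\<close> positive even if
    \<open>K\<close> is \<open>0\<close>.\<close>
  define C where "C = 2 * K * \<omega> * ?n * 2 ^ (?n - 1) + 1"
  have n: "?n = Suc (?n - 1)" using zero_less_card_finite by simp
  show thesis
  proof (rule that[of C])
    show "0 < C" using K \<omega> by (simp add: C_def add_nonneg_pos)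
    fix a :: "real ^ 'n" and s r :: real
    assume s: "0 \<le> s" "s \<le> r" and r: "0 < r"
    \<comment> \<open>From \<open>1 / k m \<le> 3 * r^2\<close> follows
      \<open>s^2 + 1 / k m \<le> (2 * r)^2\<close>, so the support stays in the doubled ball, while
      \<open>1 / k m\<close> tends to \<open>0\<close> and the shell shrinks to the sphere of radius
      \<open>s\<close>.\<close>
    define k where "k m = real (Suc m) / (3 * r\<^sup>2)" for m
    define R where "R m = sqrt (s\<^sup>2 + 1 / k m)" for m
    define \<phi> where "\<phi> m x = \<psi> (k m * ((x - a) \<bullet> (x - a) - s\<^sup>2))" for m and x :: "real ^ 'n"
    define E where "E m = cball a (R m) - ball a s" for m
    define G where "G m = 2 * k m * K * R m" for m
    have k: "0 < k m" for m using r by (simp add: k_def)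
    have k3: "1 / k m \<le> 3 * r\<^sup>2" for m using r by (simp add: k_def field_simps)
    have R2: "(R m)\<^sup>2 = s\<^sup>2 + 1 / k m" "(R m)\<^sup>2 \<le> (2 * r)\<^sup>2" for m
    proof -
      show "(R m)\<^sup>2 = s\<^sup>2 + 1 / k m" using k[of m] by (simp add: R_def)
      then show "(R m)\<^sup>2 \<le> (2 * r)\<^sup>2"
        using k3[of m] power_mono[OF s(2,1), of 2] by (simp add: power_mult_distrib)
    qed
    have Rs: "s \<le> R m" and Rr: "R m \<le> 2 * r" and R0: "0 \<le> R m" for m
    proof -
      show "0 \<le> R m" using k[of m] by (simp add: R_def)
      show "s \<le> R m" unfolding R_def by (rule real_le_rsqrt) (use k[of m] in simp)
      show "R m \<le> 2 * r" by (rule power2_le_imp_le[OF R2(2)]) (use r in simp)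
    qed
    have nrm: "(x - a) \<bullet> (x - a) = (dist a x)\<^sup>2" for x :: "real ^ 'n"
      by (simp only: dist_norm norm_minus_commute[of a] power2_norm_eq_inner)
    have sm: "smooth_on UNIV (\<phi> m)" for m
      unfolding \<phi>_def inner_vec_def inner_real_def
      by (intro smooth_on_compose_real[OF _ \<psi>(1)] smooth_on_mult smooth_on_diff smooth_on_sum smooth_on_nth
          smooth_on_const smooth_on_id) auto
    have D: "(\<phi> m has_derivative (\<lambda>v. (2 * k m * ((x - a) \<bullet> v)) * deriv \<psi> (k m * ((x - a) \<bullet> (x - a) - s\<^sup>2)))) (at x)"
      for m x
    proof -
      have "\<psi> differentiable at y" for y using smooth_on_differentiable[OF \<psi>(1)] by simp
      then have "(\<psi> has_real_derivative deriv \<psi> y) (at y)" for y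
        using DERIV_deriv_iff_real_differentiable by blast
      then have "(\<psi> has_derivative (\<lambda>u. u * deriv \<psi> y)) (at y)" for y
        by (simp add: has_field_derivative_def mult_commute_abs)
      moreover have "((\<lambda>x. k m * ((x - a) \<bullet> (x - a) - s\<^sup>2)) has_derivative (\<lambda>v. 2 * k m * ((x - a) \<bullet> v))) (at x)"
        by (auto intro!: derivative_eq_intros simp: inner_commute algebra_simps)
      ultimately show ?thesis
        unfolding \<phi>_def[abs_def] by (rule has_derivative_compose[rotated])
    qed
    have db: "\<bar>frechet_derivative (\<phi> m) (at x) v\<bar> \<le> G m * norm v * indicator (E m) x" for m x v
    proof (cases "x \<in> E m")
      case True
      have "\<bar>(x - a) \<bullet> v\<bar> \<le> R m * norm v"
        using Cauchy_Schwarz_ineq2[of "x - a" v] True mult_right_mono[of "norm (x - a)" "R m" "norm v"]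
        by (simp add: E_def dist_norm norm_minus_commute)
      then have "\<bar>(x - a) \<bullet> v\<bar> * \<bar>deriv \<psi> (k m * ((x - a) \<bullet> (x - a) - s\<^sup>2))\<bar> \<le> (R m * norm v) * K"
        using \<psi>(6) R0 by (intro mult_mono) auto
      then have "2 * k m * (\<bar>(x - a) \<bullet> v\<bar> * \<bar>deriv \<psi> (k m * ((x - a) \<bullet> (x - a) - s\<^sup>2))\<bar>)
          \<le> 2 * k m * ((R m * norm v) * K)"
        using k[of m] by (intro mult_left_mono) auto
      then show ?thesis
        using True k[of m] unfolding frechet_derivative_eqI[OF D] by (simp add: G_def abs_mult mult_ac)
    next
      case False
      have "k m * ((x - a) \<bullet> (x - a) - s\<^sup>2) \<notin> {0..1}"
      proof
        assume *: "k m * ((x - a) \<bullet> (x - a) - s\<^sup>2) \<in> {0..1}"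
        then have "s\<^sup>2 \<le> (dist a x)\<^sup>2"
          using k[of m] by (simp add: nrm zero_le_mult_iff)
        then have "s \<le> dist a x" by (rule power2_le_imp_le) simp
        moreover have "(dist a x)\<^sup>2 \<le> (R m)\<^sup>2"
          using * k[of m] by (simp add: nrm R2(1) field_simps)
        then have "dist a x \<le> R m" using R0 by (rule power2_le_imp_le)
        ultimately show False using False by (simp add: E_def)
      qed
      then show ?thesis using \<psi>(7) False unfolding frechet_derivative_eqI[OF D] by simp
    qed
    have meas: "G m * measure lborel (E m) \<le> C * r ^ (?n - 1)" for m
    proof -
      have fin: "emeasure lborel (cball a (R m)) < \<infinity>" by (rule emeasure_lborel_cball_finite)
      have "measure lborel (E m) = measure lborel (cball a (R m)) - measure lborel (ball a s)"
        unfolding E_def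
        by (rule measure_Diff) (use fin Rs[of m] in \<open>auto simp: less_top[symmetric]\<close>)
      also have "\<dots> = \<omega> * (R m ^ ?n - s ^ ?n)"
        using content_cball[of "R m" a] content_ball[of s a] R0[of m] s
        by (simp add: \<omega>_def right_diff_distrib)
      also have "R m ^ ?n - s ^ ?n \<le> real ?n * R m ^ (?n - 1) * (R m - s)"
        using power_Suc_diff_le[OF s(1) Rs[of m], of "?n - 1"] n by simp
      finally have "measure lborel (E m) \<le> \<omega> * (real ?n * R m ^ (?n - 1) * (R m - s))"
        using \<omega> by (simp add: mult_left_mono)
      then have "G m * measure lborel (E m) \<le> G m * (\<omega> * (real ?n * R m ^ (?n - 1) * (R m - s)))"
        using k[of m] K R0[of m] by (intro mult_left_mono) (auto simp: G_def)
      also have "\<dots> = 2 * K * \<omega> * ?n * R m ^ (?n - 1) * (k m * (R m * (R m - s)))"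
        by (simp add: G_def algebra_simps)
      also have "\<dots> \<le> 2 * K * \<omega> * ?n * (2 * r) ^ (?n - 1) * 1"
      proof (intro mult_mono power_mono Rr R0)
        have "R m * (R m - s) \<le> (R m + s) * (R m - s)" using s Rs[of m] by (intro mult_right_mono) auto
        also have "\<dots> = 1 / k m" using R2(1)[of m] by (simp add: power2_eq_square algebra_simps)
        finally show "k m * (R m * (R m - s)) \<le> 1" using k[of m] by (simp add: field_simps)
      qed (use K \<omega> s Rs[of m] R0[of m] k[of m] r in \<open>auto simp: mult_nonneg_nonneg\<close>)
      also have "\<dots> \<le> C * r ^ (?n - 1)"
        using r by (simp add: C_def power_mult_distrib algebra_simps)
      finally show ?thesis .
    qed
    have lim: "(\<lambda>m. \<phi> m x) \<longlonglongrightarrow> indicator (cball a s) x" for x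
    proof (cases "x \<in> cball a s")
      case True
      then have "(dist a x)\<^sup>2 \<le> s\<^sup>2" by (simp add: power_mono)
      then have "\<phi> m x = 1" for m
        unfolding \<phi>_def nrm using k[of m] by (intro \<psi>(4)) (simp add: mult_le_0_iff)
      then show ?thesis using True by simp
    next
      case False
      then have d: "0 < (dist a x)\<^sup>2 - s\<^sup>2" using s by (simp add: power_strict_mono)
      obtain m0 where m0: "3 * r\<^sup>2 / ((dist a x)\<^sup>2 - s\<^sup>2) \<le> real m0" using real_arch_simple by blast
      have "\<phi> m x = 0" if "m \<ge> m0" for m
      proof -
        have "3 * r\<^sup>2 / ((dist a x)\<^sup>2 - s\<^sup>2) \<le> real (Suc m)" using m0 that by linarith
        then have "1 \<le> k m * ((dist a x)\<^sup>2 - s\<^sup>2)" using d r by (simp add: k_def field_simps)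
        then show ?thesis unfolding \<phi>_def nrm by (rule \<psi>(5))
      qed
      then have "\<forall>\<^sub>F m in sequentially. \<phi> m x = 0" by (auto simp: eventually_sequentially)
      then show ?thesis using False by (simp add: tendsto_eventually)
    qed
    have out: "\<phi> m x = 0" if "x \<notin> cball a (2 * r)" for m x
    proof -
      have "R m < dist a x" using that Rr[of m] by simp
      then have "(R m)\<^sup>2 < (dist a x)\<^sup>2" using R0 by (intro power_strict_mono) auto
      then have "1 \<le> k m * ((dist a x)\<^sup>2 - s\<^sup>2)" using k[of m] by (simp add: R2(1) field_simps)
      then show ?thesis unfolding \<phi>_def nrm by (rule \<psi>(5))
    qed
    have one: "\<phi> m x = 1" if "x \<in> cball a s" for m x
    proof -
      have "(dist a x)\<^sup>2 \<le> s\<^sup>2" using that by (simp add: power_mono)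
      then show ?thesis unfolding \<phi>_def nrm using k[of m] by (intro \<psi>(4)) (simp add: mult_le_0_iff)
    qed
    show "\<exists>\<phi> G E. cutoff_family C a s r \<phi> G E"
      unfolding cutoff_family_def
    proof (intro exI[of _ \<phi>] exI[of _ G] exI[of _ E] conjI allI ballI impI)
      fix m
      show "E m \<in> sets lborel" by (simp add: E_def)
      show "E m \<subseteq> cball a (2 * r)" using Rr[of m] by (auto simp: E_def)
      show "0 \<le> G m" using k[of m] K R0[of m] by (simp add: G_def)
    qed (use sm db meas lim out one \<psi>(2,3) in \<open>auto simp: \<phi>_def\<close>)
  qed
qed

lemma bump_function:
  fixes a :: "real ^ 'n::finite"
  assumes "0 < r"
  obtains \<phi> :: "real ^ 'n \<Rightarrow> real" where "smooth_on UNIV \<phi>" "\<And>x. 0 \<le> \<phi> x" "\<And>x. x \<in> cball a r \<Longrightarrow> \<phi> x = 1"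
    "\<And>x. x \<notin> cball a (2 * r) \<Longrightarrow> \<phi> x = 0"
proof (rule ball_cutoffs[where ?'n = 'n])
  fix C :: real
  assume "\<And>(a :: real ^ 'n) s r. 0 \<le> s \<Longrightarrow> s \<le> r \<Longrightarrow> 0 < r \<Longrightarrow> \<exists>\<phi> G E. cutoff_family C a s r \<phi> G E"
  from this[of r r a] obtain \<phi> G E where "cutoff_family C a r r \<phi> G E" using assms by auto
  then show thesis unfolding cutoff_family_def by (intro that[of "\<phi> 0"]) blast+
qed

text \<open>\<open>h\<close> will contain \<open>chart_inv\<close>, whose values off the open set
  \<open>U\<close> are arbitrary. Truncating to \<open>U\<close> gives a Borel function, and only
  then the Lebesgue set \<open>S\<close> enters.\<close>

lemma borel_measurable_indicator_mult:
  fixes h :: "'a::euclidean_space \<Rightarrow> real"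
  assumes "S \<in> sets lebesgue" "S \<subseteq> U" "open U" "continuous_on U h"
  shows "(\<lambda>x. indicator S x * h x) \<in> borel_measurable lebesgue"
proof -
  have "(\<lambda>x. indicator U x *\<^sub>R h x) \<in> borel_measurable borel"
    by (rule borel_measurable_continuous_on_indicator) (use assms in auto)
  then have "(\<lambda>x. indicator U x *\<^sub>R h x) \<in> borel_measurable lebesgue"
    by (intro measurable_completion) simp
  then have "(\<lambda>x. indicator S x * (indicator U x *\<^sub>R h x)) \<in> borel_measurable lebesgue"
    using assms(1) by measurable
  also have "(\<lambda>x. indicator S x * (indicator U x *\<^sub>R h x)) = (\<lambda>x. indicator S x * h x)"
    using assms(2) by (auto simp: fun_eq_iff indicator_def)
  finally show ?thesis .
qed

lemma disjoint_family_on_image: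
  assumes "inj_on f U" "\<And>j. j \<in> J \<Longrightarrow> X j \<subseteq> U" "disjoint_family_on X J"
  shows "disjoint_family_on (\<lambda>j. f ` X j) J"
  unfolding disjoint_family_on_def
proof (intro ballI impI)
  fix i j assume "i \<in> J" "j \<in> J" "i \<noteq> j"
  then show "f ` X i \<inter> f ` X j = {}"
    using inj_on_image_Int[OF assms(1,2,2), of i j] assms(3) by (simp add: disjoint_family_on_def)
qed

section \<open>Charts and transition maps of a compact manifold\<close>

locale closed_manifold =
  fixes A :: "('m::t2_space, 'n::finite) chart set"
  assumes atlas: "smooth_atlas A" and compact_M: "compact (UNIV :: 'm set)"
begin

lemma open_chart: "c \<in> A \<Longrightarrow> open (fst c)" "c \<in> A \<Longrightarrow> open (chart_image c)"
  using atlas by (auto simp: smooth_atlas_def)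

lemma chart_homeomorphism:
  "c \<in> A \<Longrightarrow> homeomorphism (fst c) (chart_image c) (snd c) (chart_inv c)"
  using atlas unfolding smooth_atlas_def by blast

lemma chart_inv_left: "c \<in> A \<Longrightarrow> p \<in> fst c \<Longrightarrow> chart_inv c (snd c p) = p"
  using chart_homeomorphism by (auto simp: homeomorphism_def)

lemma chart_inv_right: "c \<in> A \<Longrightarrow> x \<in> chart_image c \<Longrightarrow> snd c (chart_inv c x) = x"
  by (auto simp: f_inv_into_f)

lemma chart_inv_in: "c \<in> A \<Longrightarrow> x \<in> chart_image c \<Longrightarrow> chart_inv c x \<in> fst c"
  by (auto intro: inv_into_into)

lemma inj_on_chart: "c \<in> A \<Longrightarrow> inj_on (snd c) (fst c)"
  by (metis chart_inv_left inj_onI)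

lemma ex_chart: "\<exists>c\<in>A. p \<in> fst c"
  using atlas by (auto simp: smooth_atlas_def)

lemma continuous_on_chart_inv: "c \<in> A \<Longrightarrow> continuous_on (chart_image c) (chart_inv c)"
  using chart_homeomorphism by (auto simp: homeomorphism_def)

lemma continuous_on_chart: "c \<in> A \<Longrightarrow> continuous_on (fst c) (snd c)"
  using chart_homeomorphism by (auto simp: homeomorphism_def)

lemma chart_image_eq_vimage:
  assumes "c \<in> A" "E \<subseteq> fst c" shows "snd c ` E = chart_image c \<inter> chart_inv c -` E"
  using assms chart_inv_left[OF assms(1)] by (auto simp: image_iff)

lemma open_chart_image:
  assumes "c \<in> A" "open U" "U \<subseteq> fst c" shows "open (snd c ` U)"
  unfolding chart_image_eq_vimage[OF assms(1,3)]
  by (rule continuous_open_preimage[OF continuous_on_chart_inv]) (use assms open_chart in auto)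

lemma open_chart_inv_image:
  assumes "c \<in> A" "open V" "V \<subseteq> chart_image c" shows "open (chart_inv c ` V)"
proof -
  have "chart_inv c ` V = fst c \<inter> snd c -` V"
    using assms chart_inv_left[OF assms(1)] chart_inv_right[OF assms(1)] chart_inv_in[OF assms(1)]
    by (auto simp: image_iff subset_iff) metis
  then show ?thesis
    using continuous_open_preimage[OF continuous_on_chart[OF assms(1)] open_chart(1)[OF assms(1)] assms(2)]
    by simp
qed

lemma image_chart_inv_image:
  assumes "c \<in> A" "S \<subseteq> chart_image c" shows "snd c ` chart_inv c ` S = S"
proof -
  have "snd c (chart_inv c x) = x" if "x \<in> S" for x
    using chart_inv_right[OF assms(1)] assms(2) that by blast
  then have "(\<lambda>x. snd c (chart_inv c x)) ` S = (\<lambda>x. x) ` S" by (rule image_cong[OF refl])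
  then show ?thesis by (simp only: image_image image_ident)
qed

lemma transition_chart: "c \<in> A \<Longrightarrow> p \<in> fst c \<Longrightarrow> transition c d (snd c p) = snd d p"
  by (simp add: transition_def chart_inv_left)

lemma transition_smooth: "c \<in> A \<Longrightarrow> d \<in> A \<Longrightarrow> smooth_on (snd c ` (fst c \<inter> fst d)) (transition c d)"
  using atlas by (auto simp: smooth_atlas_def)

lemma transition_has_derivative:
  "c \<in> A \<Longrightarrow> d \<in> A \<Longrightarrow> p \<in> fst c \<Longrightarrow> p \<in> fst d \<Longrightarrow>
   (transition c d has_derivative frechet_derivative (transition c d) (at (snd c p))) (at (snd c p))"
  by (rule smooth_on_has_derivative[OF transition_smooth]) auto

subsection \<open>The volume density\<close>

lemma metric_inner_form: "riemannian_metric A g \<Longrightarrow> c \<in> A \<Longrightarrow> p \<in> fst c \<Longrightarrow> inner_form (g c p)"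
  unfolding riemannian_metric_def inner_form_def by blast

lemma volume_density_gram: "volume_density g c p = sqrt (det (gram (g c p)))"
  by (simp add: volume_density_def gram_def)

lemma volume_density_pos: "riemannian_metric A g \<Longrightarrow> c \<in> A \<Longrightarrow> p \<in> fst c \<Longrightarrow> 0 < volume_density g c p"
  by (simp add: volume_density_gram det_gram_pos metric_inner_form)

text \<open>The square root of \<open>det_gram_pullback\<close>; the absolute value of the Jacobian
  is the root of its square.\<close>

lemma volume_density_transition:
  assumes "riemannian_metric A g" "c \<in> A" "d \<in> A" "p \<in> fst c" "p \<in> fst d"
  shows "volume_density g c p =
    \<bar>det (matrix (frechet_derivative (transition c d) (at (snd c p))))\<bar> * volume_density g d p"
proof -
  let ?L = "frechet_derivative (transition c d) (at (snd c p))"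
  have eq: "g c p = (\<lambda>u v. g d p (?L u) (?L v))"
    using assms unfolding riemannian_metric_def by (intro ext) blast
  have "linear ?L"
    using has_derivative_linear[OF transition_has_derivative[OF assms(2-5)]] .
  moreover have "bilinear (g d p)"
    using metric_inner_form[OF assms(1,3,5)] by (simp add: inner_form_def)
  ultimately have "det (gram (g c p)) = (det (matrix ?L))\<^sup>2 * det (gram (g d p))"
    unfolding eq by (intro det_gram_pullback)
  then show ?thesis by (simp add: volume_density_gram real_sqrt_mult)
qed

lemma volume_density_smooth:
  assumes g: "riemannian_metric A g" and c: "c \<in> A"
  shows "smooth_on (chart_image c) (\<lambda>x. volume_density g c (chart_inv c x))"
proof -
  have o: "open (chart_image c)" using open_chart c by simp
  have "smooth_on (chart_image c) (\<lambda>x. g c (chart_inv c x) u v)" for u v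
    using g c unfolding riemannian_metric_def by blast
  then have e: "smooth_on (chart_image c) (\<lambda>x. gram (g c (chart_inv c x)) $ i $ j)" for i j
    by (simp add: gram_def)
  have "smooth_on (chart_image c) (\<lambda>x. det (gram (g c (chart_inv c x))))"
    unfolding det_def
    by (intro smooth_on_sum[OF o] smooth_on_mult[OF o] smooth_on_prod[OF o] smooth_on_const e)
  then show ?thesis
    unfolding volume_density_gram
    by (rule smooth_on_sqrt[OF o]) (rule det_gram_pos[OF metric_inner_form[OF g c chart_inv_in[OF c]]])
qed

lemma volume_density_continuous:
  assumes g: "riemannian_metric A g" and c: "c \<in> A"
  shows "continuous_on (chart_image c) (\<lambda>x. volume_density g c (chart_inv c x))"
  by (rule smooth_on_continuous_on[OF volume_density_smooth[OF assms]])

subsection \<open>Existence and uniqueness of the Riemannian volume\<close>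

lemma manifold_sets_iff: "E \<in> manifold_lebesgue_sets A \<longleftrightarrow> (\<forall>c\<in>A. snd c ` (E \<inter> fst c) \<in> sets lebesgue)"
  by (simp add: manifold_lebesgue_sets_def)

lemma open_manifold_sets: "open U \<Longrightarrow> U \<in> manifold_lebesgue_sets A"
  using open_chart_image[of _ "U \<inter> fst _"] open_chart by (fastforce simp: manifold_sets_iff)

text \<open>Charts are injective, so taking images commutes with complements inside a chart
  domain.\<close>

lemma sigma_algebra_manifold_sets: "sigma_algebra UNIV (manifold_lebesgue_sets A)"
proof (rule sigma_algebra_iff2[THEN iffD2], intro conjI ballI allI impI)
  fix E assume E: "E \<in> manifold_lebesgue_sets A"
  have "snd c ` ((UNIV - E) \<inter> fst c) = chart_image c - snd c ` (E \<inter> fst c)" if "c \<in> A" for c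
  proof -
    have "(UNIV - E) \<inter> fst c = fst c - E \<inter> fst c" by blast
    then show ?thesis
      using inj_on_image_set_diff[OF inj_on_chart[OF that], of "fst c" "E \<inter> fst c"] by simp
  qed
  then show "UNIV - E \<in> manifold_lebesgue_sets A"
    using E open_chart by (auto simp: manifold_sets_iff)
next
  fix E :: "nat \<Rightarrow> 'm set" assume "range E \<subseteq> manifold_lebesgue_sets A"
  then have *: "snd c ` (E i \<inter> fst c) \<in> sets lebesgue" if "c \<in> A" for c i
    using that unfolding image_subset_iff manifold_sets_iff by blast
  have "snd c ` ((\<Union>i. E i) \<inter> fst c) = (\<Union>i. snd c ` (E i \<inter> fst c))" for c :: "('m, 'n) chart"
    by blast
  then show "(\<Union>i. E i) \<in> manifold_lebesgue_sets A"
    unfolding manifold_sets_iff using * by (auto intro!: sets.countable_UN)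
qed (auto simp: manifold_sets_iff)

lemma manifold_sets_Int: "E \<in> manifold_lebesgue_sets A \<Longrightarrow> F \<in> manifold_lebesgue_sets A \<Longrightarrow>
    E \<inter> F \<in> manifold_lebesgue_sets A"
proof -
  interpret sigma_algebra UNIV "manifold_lebesgue_sets A" by (rule sigma_algebra_manifold_sets)
  show "E \<in> manifold_lebesgue_sets A \<Longrightarrow> F \<in> manifold_lebesgue_sets A \<Longrightarrow>
    E \<inter> F \<in> manifold_lebesgue_sets A" by (rule Int)
qed

text \<open>The volume as seen in coordinates. The density is \<open>0\<close> outside the image,
  where \<open>chart_inv\<close> carries no information, so this is a measure on the whole
  coordinate space.\<close>

definition chart_measure :: "('m, 'n) metric_field \<Rightarrow> ('m, 'n) chart \<Rightarrow> (real ^ 'n) measure" where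
  "chart_measure g c =
     density lebesgue (\<lambda>x. ennreal (indicator (chart_image c) x * volume_density g c (chart_inv c x)))"

lemma sets_chart_measure [simp]: "sets (chart_measure g c) = sets lebesgue" "space (chart_measure g c) = UNIV"
  by (simp_all add: chart_measure_def)

lemma density_measurable:
  assumes "riemannian_metric A g" "c \<in> A"
  shows "(\<lambda>x. indicator (chart_image c) x * volume_density g c (chart_inv c x)) \<in> borel_measurable lebesgue"
  by (rule borel_measurable_indicator_mult[OF _ subset_refl _ volume_density_continuous[OF assms]])
    (use open_chart(2)[OF assms(2)] in auto)

lemma emeasure_chart_measure:
  assumes "riemannian_metric A g" "c \<in> A" "S \<in> sets lebesgue" "S \<subseteq> chart_image c"
  shows "emeasure (chart_measure g c) S = (\<integral>\<^sup>+x\<in>S. ennreal (volume_density g c (chart_inv c x)) \<partial>lebesgue)"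
  unfolding chart_measure_def using density_measurable[OF assms(1,2)] assms(3,4)
  by (subst emeasure_density) (auto intro!: nn_integral_cong simp: indicator_def)

text \<open>The Jacobian factor produced by the change of variables is precisely the factor between
  the two volume densities.\<close>

lemma chart_measure_transition:
  assumes g: "riemannian_metric A g" and c: "c \<in> A" and d: "d \<in> A"
    and E: "E \<in> manifold_lebesgue_sets A" "E \<subseteq> fst c" "E \<subseteq> fst d"
  shows "emeasure (chart_measure g c) (snd c ` E) = emeasure (chart_measure g d) (snd d ` E)"
proof -
  have Ec: "snd c ` E \<in> sets lebesgue" and Ed: "snd d ` E \<in> sets lebesgue"
    using E c d by (metis Int_absorb2 manifold_sets_iff)+
  let ?T = "transition c d" and ?f = "\<lambda>y. volume_density g d (chart_inv d y)"
  let ?D = "\<lambda>x. frechet_derivative ?T (at x)"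
  have im: "?T ` snd c ` E = snd d ` E"
    using transition_chart[OF c] E(2) by (auto simp: image_image subset_iff)
  have eq: "\<bar>det (matrix (?D x))\<bar> * ?f (?T x) = volume_density g c (chart_inv c x)" if x: "x \<in> snd c ` E" for x
  proof -
    obtain p where p: "x = snd c p" "p \<in> E" using x by blast
    then show ?thesis
      using volume_density_transition[OF g c d, of p] E
      by (auto simp: transition_chart[OF c] chart_inv_left[OF c] chart_inv_left[OF d] subset_iff)
  qed
  have "(\<integral>\<^sup>+y\<in>?T ` snd c ` E. ennreal (?f y) \<partial>lebesgue) =
      (\<integral>\<^sup>+x\<in>snd c ` E. ennreal (\<bar>det (matrix (?D x))\<bar> * ?f (?T x)) \<partial>lebesgue)"
  proof (rule nn_integral_change_of_variables)
    show "snd c ` E \<in> sets lebesgue" by (rule Ec)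
    show "(?T has_derivative ?D x) (at x within snd c ` E)" if "x \<in> snd c ` E" for x
      using that E transition_has_derivative[OF c d] by (auto intro: has_derivative_at_withinI)
    show "inj_on ?T (snd c ` E)"
    proof (rule inj_onI)
      fix x y assume xy: "x \<in> snd c ` E" "y \<in> snd c ` E" "?T x = ?T y"
      then obtain p q where pq: "x = snd c p" "y = snd c q" "p \<in> E" "q \<in> E" by blast
      then have "snd d p = snd d q"
        using xy(3) E(2) transition_chart[OF c] by (metis subsetD)
      then show "x = y"
        using pq E(3) inj_on_chart[OF d] by (metis inj_onD subsetD)
    qed
    show "\<And>y. y \<in> ?T ` snd c ` E \<Longrightarrow> 0 \<le> ?f y"
      unfolding im using volume_density_pos[OF g d] E(3)
      by (auto simp: chart_inv_left[OF d] subset_iff intro: less_imp_le)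
    show "(\<lambda>y. indicator (?T ` snd c ` E) y * ?f y) \<in> borel_measurable lebesgue"
      unfolding im
      by (rule borel_measurable_indicator_mult[OF Ed _ open_chart(2)[OF d] volume_density_continuous[OF g d]])
        (use E in auto)
    have "(\<lambda>x. indicator (snd c ` E) x * volume_density g c (chart_inv c x)) \<in> borel_measurable lebesgue"
      by (rule borel_measurable_indicator_mult[OF Ec _ open_chart(2)[OF c] volume_density_continuous[OF g c]])
        (use E in auto)
    also have "(\<lambda>x. indicator (snd c ` E) x * volume_density g c (chart_inv c x)) =
        (\<lambda>x. indicator (snd c ` E) x * (\<bar>det (matrix (?D x))\<bar> * ?f (?T x)))"
      using eq by (auto simp: fun_eq_iff indicator_def)
    finally show "(\<lambda>x. indicator (snd c ` E) x * (\<bar>det (matrix (?D x))\<bar> * ?f (?T x))) \<in> borel_measurable lebesgue" .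
  qed
  also have "\<dots> = (\<integral>\<^sup>+x\<in>snd c ` E. ennreal (volume_density g c (chart_inv c x)) \<partial>lebesgue)"
    using eq by (intro nn_integral_cong) (auto simp: indicator_def)
  finally show ?thesis
    unfolding im emeasure_chart_measure[OF g c Ec image_mono[OF E(2)]]
      emeasure_chart_measure[OF g d Ed image_mono[OF E(3)]] by (rule sym)
qed

text \<open>By compactness finitely many chart domains cover the manifold, and each is reduced by
  the earlier ones. Disjoint pieces, each inside a single chart, let volumes be defined and compared
  by finite sums.\<close>

lemma finite_chart_partition:
  obtains N :: nat and c D where "\<And>i. i < N \<Longrightarrow> c i \<in> A" "\<And>i. i < N \<Longrightarrow> D i \<subseteq> fst (c i)"
    "disjoint_family_on D {..<N}" "(\<Union>i<N. D i) = UNIV" "\<And>i. D i \<in> manifold_lebesgue_sets A"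
proof -
  have "UNIV \<subseteq> (\<Union>c\<in>A. fst c)" using ex_chart by auto
  then obtain F where F: "F \<subseteq> A" "finite F" "UNIV \<subseteq> (\<Union>c\<in>F. fst c)"
    using compactE_image[OF compact_M, of A fst] open_chart by metis
  obtain c where c: "bij_betw c {..<card F} F"
    using ex_bij_betw_nat_finite[OF F(2)] by (auto simp: atLeast0LessThan)
  define D where "D i = (if i < card F then fst (c i) - (\<Union>j<i. fst (c j)) else {})" for i
  have cA: "c i \<in> A" if "i < card F" for i using c F(1) that by (auto simp: bij_betw_def)
  interpret sa: sigma_algebra UNIV "manifold_lebesgue_sets A" by (rule sigma_algebra_manifold_sets)
  have cov: "\<exists>i<card F. p \<in> D i" for p
  proof -
    obtain d where d: "d \<in> F" "p \<in> fst d" using F(3) by blast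
    then have "d \<in> c ` {..<card F}" using bij_betw_imp_surj_on[OF c] by simp
    then have "\<exists>i. i < card F \<and> p \<in> fst (c i)" using d(2) by blast
    then obtain i where "i < card F" "p \<in> fst (c i)" "\<And>j. j < i \<Longrightarrow> \<not> (j < card F \<and> p \<in> fst (c j))"
      using exists_least_iff[of "\<lambda>i. i < card F \<and> p \<in> fst (c i)"] by blast
    then show ?thesis by (intro exI[of _ i]) (auto simp: D_def)
  qed
  show thesis
  proof (rule that[of "card F" c D])
    show "disjoint_family_on D {..<card F}"
    proof -
      have "D i \<inter> D j = {}" if "i < j" for i j using that by (auto simp: D_def)
      then show ?thesis unfolding disjoint_family_on_def by (metis Int_commute linorder_neqE_nat)
    qed
    show "(\<Union>i<card F. D i) = UNIV" using cov by auto
    show "D i \<in> manifold_lebesgue_sets A" for i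
    proof (cases "i < card F")
      case True
      then have "D i = fst (c i) - (\<Union>j<i. fst (c j))" by (simp add: D_def)
      moreover have "open (fst (c i))" "open (\<Union>j<i. fst (c j))"
        using True open_chart(1)[OF cA] by (auto intro!: open_UN)
      ultimately show ?thesis by (simp add: sa.Diff open_manifold_sets)
    qed (simp add: D_def)
  qed (auto simp: D_def cA)
qed

text \<open>The condition under the definite description in \<open>riemannian_volume\<close>, named
  so that existence and uniqueness can be expressed.\<close>

definition is_volume :: "('m, 'n) metric_field \<Rightarrow> 'm measure \<Rightarrow> bool" where
  "is_volume g \<mu> \<longleftrightarrow> space \<mu> = UNIV \<and> sets \<mu> = manifold_lebesgue_sets A \<and>
     (\<forall>c\<in>A. \<forall>E\<in>sets \<mu>. E \<subseteq> fst c \<longrightarrow>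
        emeasure \<mu> E =
          (\<integral>\<^sup>+ x \<in> snd c ` E. ennreal (volume_density g c (chart_inv c x)) \<partial>lebesgue))"

lemma is_volume_chart_measure:
  assumes g: "riemannian_metric A g" and "space \<mu> = UNIV" "sets \<mu> = manifold_lebesgue_sets A"
    and e: "\<And>c E. c \<in> A \<Longrightarrow> E \<in> manifold_lebesgue_sets A \<Longrightarrow> E \<subseteq> fst c \<Longrightarrow>
      emeasure \<mu> E = emeasure (chart_measure g c) (snd c ` E)"
  shows "is_volume g \<mu>"
  unfolding is_volume_def
proof (intro conjI ballI impI)
  fix c E assume *: "c \<in> A" "E \<in> sets \<mu>" "E \<subseteq> fst c"
  then have "snd c ` E \<in> sets lebesgue" using assms(3) by (metis Int_absorb2 manifold_sets_iff)
  then show "emeasure \<mu> E = (\<integral>\<^sup>+ x \<in> snd c ` E. ennreal (volume_density g c (chart_inv c x)) \<partial>lebesgue)"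
    using e[OF *(1) _ *(3)] * assms(3) emeasure_chart_measure[OF g *(1), of "snd c ` E"] by auto
qed (use assms in auto)

lemma is_volumeD:
  assumes "is_volume g \<mu>"
  shows "sets \<mu> = manifold_lebesgue_sets A" "space \<mu> = UNIV"
    "c \<in> A \<Longrightarrow> E \<in> manifold_lebesgue_sets A \<Longrightarrow> E \<subseteq> fst c \<Longrightarrow> emeasure \<mu> E =
      (\<integral>\<^sup>+ x \<in> snd c ` E. ennreal (volume_density g c (chart_inv c x)) \<partial>lebesgue)"
  using assms unfolding is_volume_def by blast+

text \<open>A set is cut along the finite chart partition, and on each piece the defining formula
  leaves no freedom.\<close>

lemma is_volume_unique:
  assumes "is_volume g \<mu>" "is_volume g \<nu>"
  shows "\<mu> = \<nu>"
proof (rule measure_eqI)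
  show "sets \<mu> = sets \<nu>" using assms by (simp add: is_volumeD)
  fix E assume E: "E \<in> sets \<mu>"
  obtain N :: nat and c D where P: "\<And>i. i < N \<Longrightarrow> c i \<in> A" "\<And>i. i < N \<Longrightarrow> D i \<subseteq> fst (c i)"
    "disjoint_family_on D {..<N}" "(\<Union>i<N. D i) = UNIV" "\<And>i. D i \<in> manifold_lebesgue_sets A"
    using finite_chart_partition by blast
  have dis: "disjoint_family_on (\<lambda>i. E \<inter> D i) {..<N}"
    using P(3) by (auto simp: disjoint_family_on_def)
  have E_eq: "E = (\<Union>i<N. E \<inter> D i)" using P(4) by blast
  have split: "emeasure \<kappa> E = (\<Sum>i<N. emeasure \<kappa> (E \<inter> D i))" if "is_volume g \<kappa>" for \<kappa>
  proof -
    have "(\<lambda>i. E \<inter> D i) ` {..<N} \<subseteq> sets \<kappa>"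
      using E P(5) is_volumeD(1)[OF assms(1)] is_volumeD(1)[OF that]
      by (auto intro!: manifold_sets_Int)
    then have "(\<Sum>i<N. emeasure \<kappa> (E \<inter> D i)) = emeasure \<kappa> (\<Union>i<N. E \<inter> D i)"
      by (rule sum_emeasure[OF _ dis]) simp
    then show ?thesis by (simp only: E_eq[symmetric])
  qed
  have "emeasure \<mu> (E \<inter> D i) = emeasure \<nu> (E \<inter> D i)" if i: "i < N" for i
  proof -
    have s: "E \<inter> D i \<in> sets \<mu>" using E P(5)[of i] is_volumeD(1)[OF assms(1)] by (intro sets.Int) auto
    then have "E \<inter> D i \<in> manifold_lebesgue_sets A" "E \<inter> D i \<subseteq> fst (c i)"
      using P(2)[OF i] is_volumeD(1)[OF assms(1)] by auto
    then show ?thesis using is_volumeD(3)[OF assms(1) P(1)[OF i]] is_volumeD(3)[OF assms(2) P(1)[OF i]] by simp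
  qed
  then show "emeasure \<mu> E = emeasure \<nu> E" using split[OF assms(1)] split[OF assms(2)] by simp
qed

text \<open>The chart measures are summed over the partition. That the sum has the required density
  in an arbitrary chart \<open>d\<close> is seen by moving every piece into \<open>d\<close> with
  \<open>chart_measure_transition\<close>.\<close>

lemma is_volume_exists:
  assumes g: "riemannian_metric A g"
  shows "\<exists>\<mu>. is_volume g \<mu>"
proof -
  obtain N :: nat and c D where P: "\<And>i. i < N \<Longrightarrow> c i \<in> A" "\<And>i. i < N \<Longrightarrow> D i \<subseteq> fst (c i)"
    "disjoint_family_on D {..<N}" "(\<Union>i<N. D i) = UNIV" "\<And>i. D i \<in> manifold_lebesgue_sets A"
    using finite_chart_partition by blast
  interpret sa: sigma_algebra UNIV "manifold_lebesgue_sets A" by (rule sigma_algebra_manifold_sets)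
  define vol where "vol d E = emeasure (chart_measure g d) (snd d ` E)" for d E
  have lebE: "snd d ` E \<in> sets lebesgue" if "d \<in> A" "E \<in> manifold_lebesgue_sets A" "E \<subseteq> fst d" for d E
    using that by (metis Int_absorb2 manifold_sets_iff)
  define f where "f E = (\<Sum>i<N. vol (c i) (E \<inter> D i))" for E
  have ca: "countably_additive (manifold_lebesgue_sets A) f"
  proof (rule countably_additiveI)
    fix E :: "nat \<Rightarrow> 'm set" assume E: "range E \<subseteq> manifold_lebesgue_sets A" "disjoint_family E"
    have "(\<Sum>j. f (E j)) = (\<Sum>i<N. \<Sum>j. vol (c i) (E j \<inter> D i))"
      unfolding f_def by (rule suminf_sum) simp
    also have "\<dots> = (\<Sum>i<N. vol (c i) ((\<Union>j. E j) \<inter> D i))"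
    proof (rule sum.cong[OF refl])
      fix i assume "i \<in> {..<N}"
      then have i: "i < N" by simp
      have "(\<Sum>j. vol (c i) (E j \<inter> D i)) =
          emeasure (chart_measure g (c i)) (\<Union>j. snd (c i) ` (E j \<inter> D i))"
        unfolding vol_def
      proof (rule suminf_emeasure)
        show "range (\<lambda>j. snd (c i) ` (E j \<inter> D i)) \<subseteq> sets (chart_measure g (c i))"
          using E(1) P(1,2,5) i by (auto intro!: lebE manifold_sets_Int)
        show "disjoint_family (\<lambda>j. snd (c i) ` (E j \<inter> D i))"
          by (rule disjoint_family_on_image[OF inj_on_chart[OF P(1)[OF i]]])
            (use E(2) P(2)[OF i] in \<open>auto simp: disjoint_family_on_def\<close>)
      qed
      then show "(\<Sum>j. vol (c i) (E j \<inter> D i)) = vol (c i) ((\<Union>j. E j) \<inter> D i)"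
        by (simp add: vol_def image_UN[symmetric])
    qed
    finally show "(\<Sum>j. f (E j)) = f (\<Union>j. E j)" by (simp add: f_def)
  qed
  define \<mu> where "\<mu> = measure_of UNIV (manifold_lebesgue_sets A) f"
  have sp: "space \<mu> = UNIV" and se: "sets \<mu> = manifold_lebesgue_sets A"
    using sa.sets_measure_of_eq by (auto simp: \<mu>_def)
  have em: "emeasure \<mu> E = f E" if "E \<in> manifold_lebesgue_sets A" for E
    unfolding \<mu>_def
    by (rule emeasure_measure_of_sigma[OF sigma_algebra_manifold_sets _ ca that])
      (simp add: positive_def f_def vol_def)
  have "is_volume g \<mu>"
  proof (rule is_volume_chart_measure[OF g sp se])
    fix d E assume d: "d \<in> A" and E: "E \<in> manifold_lebesgue_sets A" "E \<subseteq> fst d"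
    have "emeasure \<mu> E = (\<Sum>i<N. vol d (E \<inter> D i))"
      unfolding em[OF E(1)] f_def
    proof (rule sum.cong[OF refl])
      fix i assume i: "i \<in> {..<N}"
      show "vol (c i) (E \<inter> D i) = vol d (E \<inter> D i)"
        unfolding vol_def
        by (rule chart_measure_transition[OF g]) (use P i d E in \<open>auto intro: manifold_sets_Int\<close>)
    qed
    also have "\<dots> = emeasure (chart_measure g d) (\<Union>i<N. snd d ` (E \<inter> D i))"
      unfolding vol_def
    proof (rule sum_emeasure)
      show "(\<lambda>i. snd d ` (E \<inter> D i)) ` {..<N} \<subseteq> sets (chart_measure g d)"
        using d E P(5) by (auto intro!: lebE manifold_sets_Int)
      show "disjoint_family_on (\<lambda>i. snd d ` (E \<inter> D i)) {..<N}"
        by (rule disjoint_family_on_image[OF inj_on_chart[OF d]])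
          (use E(2) P(3) in \<open>auto simp: disjoint_family_on_def\<close>)
    qed simp
    also have "(\<Union>i<N. snd d ` (E \<inter> D i)) = snd d ` E" using P(4) by blast
    finally show "emeasure \<mu> E = emeasure (chart_measure g d) (snd d ` E)" .
  qed
  then show ?thesis by blast
qed

lemma is_volume_riemannian_volume:
  assumes "riemannian_metric A g" shows "is_volume g (riemannian_volume A g)"
proof -
  have "\<exists>!\<mu>. is_volume g \<mu>"
    using is_volume_exists[OF assms] is_volume_unique by blast
  then have "is_volume g (THE \<mu>. is_volume g \<mu>)" by (rule theI')
  then show ?thesis unfolding is_volume_def riemannian_volume_def .
qed

context
  fixes g assumes g: "riemannian_metric A g"
begin

lemma riemannian_volume_sets [simp]:
  "sets (riemannian_volume A g) = manifold_lebesgue_sets A" "space (riemannian_volume A g) = UNIV"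
  using is_volumeD(1,2)[OF is_volume_riemannian_volume[OF g]] by auto

lemma emeasure_volume_chart:
  assumes c: "c \<in> A" and E: "E \<in> manifold_lebesgue_sets A" "E \<subseteq> fst c"
  shows "emeasure (riemannian_volume A g) E = emeasure (chart_measure g c) (snd c ` E)"
proof -
  have "snd c ` E \<in> sets lebesgue" using E c by (metis Int_absorb2 manifold_sets_iff)
  then show ?thesis
    using is_volumeD(3)[OF is_volume_riemannian_volume[OF g] c E]
      emeasure_chart_measure[OF g c _ image_mono[OF E(2)]] by simp
qed

lemma borel_measurable_volume:
  fixes f :: "'m \<Rightarrow> 'b::topological_space"
  assumes "f \<in> borel_measurable borel" shows "f \<in> borel_measurable (riemannian_volume A g)"
proof (rule measurableI)
  interpret sa: sigma_algebra UNIV "manifold_lebesgue_sets A" by (rule sigma_algebra_manifold_sets)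
  have "sets (borel :: 'm measure) \<subseteq> manifold_lebesgue_sets A"
    unfolding borel_def using open_manifold_sets sa.sigma_sets_subset[of "Collect open"] by auto
  then show "f -` B \<inter> space (riemannian_volume A g) \<in> sets (riemannian_volume A g)" if "B \<in> sets borel" for B
    using measurable_sets[OF assms that] by auto
qed simp

text \<open>Off \<open>chart_image c\<close> the map \<open>chart_inv c\<close> is unspecified and possibly not measurable, hence the
  extension by a constant.\<close>

lemma chart_pushforward:
  assumes c: "c \<in> A"
  defines "J \<equiv> \<lambda>x. if x \<in> chart_image c then chart_inv c x else undefined"
  shows "J \<in> chart_measure g c \<rightarrow>\<^sub>M riemannian_volume A g"
    and "distr (chart_measure g c) (riemannian_volume A g) J =
      density (riemannian_volume A g) (indicator (fst c))"
proof -
  interpret sa: sigma_algebra UNIV "manifold_lebesgue_sets A" by (rule sigma_algebra_manifold_sets)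
  have pre: "J -` E = snd c ` (E \<inter> fst c) \<union> (if undefined \<in> E then - chart_image c else {})" for E
  proof -
    have "snd c ` (E \<inter> fst c) = chart_image c \<inter> chart_inv c -` E"
      using chart_image_eq_vimage[OF c, of "E \<inter> fst c"] chart_inv_in[OF c] by auto
    then show ?thesis by (auto simp: J_def split: if_splits)
  qed
  have op: "chart_image c \<in> sets lebesgue" using open_chart(2)[OF c] by auto
  show m: "J \<in> chart_measure g c \<rightarrow>\<^sub>M riemannian_volume A g"
  proof (rule measurableI)
    fix E assume "E \<in> sets (riemannian_volume A g)"
    then have "snd c ` (E \<inter> fst c) \<in> sets lebesgue" using c by (simp add: manifold_sets_iff)
    then show "J -` E \<inter> space (chart_measure g c) \<in> sets (chart_measure g c)"
      using op sets.compl_sets[OF op] by (auto simp: pre Compl_eq_Diff_UNIV)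
  qed simp
  show "distr (chart_measure g c) (riemannian_volume A g) J =
      density (riemannian_volume A g) (indicator (fst c))"
  proof (rule measure_eqI)
    fix E assume "E \<in> sets (distr (chart_measure g c) (riemannian_volume A g) J)"
    then have E: "E \<in> manifold_lebesgue_sets A" by simp
    have Ec: "E \<inter> fst c \<in> manifold_lebesgue_sets A" "fst c \<in> manifold_lebesgue_sets A"
      using E open_manifold_sets[OF open_chart(1)[OF c]] by auto
    have lE: "snd c ` (E \<inter> fst c) \<in> sets lebesgue" using E c by (simp add: manifold_sets_iff)
    have z: "(if undefined \<in> E then - chart_image c else {}) \<in> null_sets (chart_measure g c)"
    proof -
      have "- chart_image c \<in> null_sets (chart_measure g c)"
        unfolding chart_measure_def
        using density_measurable[OF g c] sets.compl_sets[OF op]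
        by (subst null_sets_density_iff) (auto simp: Compl_eq_Diff_UNIV indicator_def)
      then show ?thesis by auto
    qed
    have "emeasure (distr (chart_measure g c) (riemannian_volume A g) J) E =
        emeasure (chart_measure g c) (J -` E)"
      using emeasure_distr[OF m, of E] E by simp
    also have "\<dots> = emeasure (chart_measure g c) (snd c ` (E \<inter> fst c))"
      unfolding pre by (rule emeasure_Un_null_set) (use lE z in auto)
    also have "\<dots> = emeasure (riemannian_volume A g) (E \<inter> fst c)"
      using emeasure_volume_chart[OF c Ec(1)] by simp
    also have "\<dots> = emeasure (density (riemannian_volume A g) (indicator (fst c))) E"
      using E Ec borel_measurable_indicator[of "fst c" "riemannian_volume A g"]
      by (subst emeasure_density) (auto simp: nn_integral_indicator[symmetric] indicator_inter_arith Int_commute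
          simp del: nn_integral_indicator intro!: nn_integral_cong split: split_indicator)
    finally show "emeasure (distr (chart_measure g c) (riemannian_volume A g) J) E =
      emeasure (density (riemannian_volume A g) (indicator (fst c))) E" .
  qed simp
qed

lemma nn_integral_volume_chart:
  assumes c: "c \<in> A" and f: "f \<in> borel_measurable (riemannian_volume A g)" "\<And>p. p \<notin> fst c \<Longrightarrow> f p = 0"
  shows "(\<integral>\<^sup>+p. f p \<partial>riemannian_volume A g) =
    (\<integral>\<^sup>+x. ennreal (indicator (chart_image c) x * volume_density g c (chart_inv c x)) * f (chart_inv c x) \<partial>lebesgue)"
proof -
  let ?J = "\<lambda>x. if x \<in> chart_image c then chart_inv c x else undefined"
  let ?w = "\<lambda>x. indicator (chart_image c) x * volume_density g c (chart_inv c x)"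
  have o: "fst c \<in> sets (riemannian_volume A g)" using open_manifold_sets[OF open_chart(1)[OF c]] by simp
  have J: "?J \<in> lebesgue \<rightarrow>\<^sub>M riemannian_volume A g"
    using chart_pushforward(1)[OF c] unfolding measurable_cong_sets[OF sets_chart_measure(1) refl] .
  have "(\<integral>\<^sup>+p. f p \<partial>riemannian_volume A g) = (\<integral>\<^sup>+p. f p \<partial>density (riemannian_volume A g) (indicator (fst c)))"
    using f borel_measurable_indicator[OF o] by (subst nn_integral_density) (auto intro!: nn_integral_cong split: split_indicator)
  also have "\<dots> = (\<integral>\<^sup>+x. f (?J x) \<partial>chart_measure g c)"
    unfolding chart_pushforward(2)[OF c, symmetric]
    by (rule nn_integral_distr[OF chart_pushforward(1)[OF c]]) (use f in simp)
  also have "\<dots> = (\<integral>\<^sup>+x. ennreal (?w x) * f (?J x) \<partial>lebesgue)"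
    unfolding chart_measure_def
    using density_measurable[OF g c] measurable_compose[OF J f(1)]
    by (subst nn_integral_density) auto
  \<comment> \<open>\<open>?J\<close> and \<open>chart_inv c\<close> differ only off the image,
    where the weight \<open>?w\<close> is \<open>0\<close>.\<close>
  also have "\<dots> = (\<integral>\<^sup>+x. ennreal (?w x) * f (chart_inv c x) \<partial>lebesgue)"
    by (intro nn_integral_cong) (auto split: split_indicator)
  finally show ?thesis .
qed

lemma integral_volume_chart:
  fixes f :: "'m \<Rightarrow> real"
  assumes c: "c \<in> A" and f: "f \<in> borel_measurable (riemannian_volume A g)" "\<And>p. p \<notin> fst c \<Longrightarrow> f p = 0"
  shows "(LINT p|riemannian_volume A g. f p) =
    (LINT x|lebesgue. indicator (chart_image c) x * volume_density g c (chart_inv c x) * f (chart_inv c x))"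
proof -
  let ?J = "\<lambda>x. if x \<in> chart_image c then chart_inv c x else undefined"
  let ?w = "\<lambda>x. indicator (chart_image c) x * volume_density g c (chart_inv c x)"
  have o: "fst c \<in> sets (riemannian_volume A g)" using open_manifold_sets[OF open_chart(1)[OF c]] by simp
  have J: "?J \<in> lebesgue \<rightarrow>\<^sub>M riemannian_volume A g"
    using chart_pushforward(1)[OF c] unfolding measurable_cong_sets[OF sets_chart_measure(1) refl] .
  have nn: "0 \<le> ?w x" for x
    using less_imp_le[OF volume_density_pos[OF g c chart_inv_in[OF c]], of x] by (simp add: indicator_def)
  have "(LINT p|riemannian_volume A g. f p) = (LINT p|riemannian_volume A g. indicator (fst c) p *\<^sub>R f p)"
    using f(2) by (intro Bochner_Integration.integral_cong) (auto split: split_indicator)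
  also have "\<dots> = (LINT p|density (riemannian_volume A g) (\<lambda>p. ennreal (indicator (fst c) p)). f p)"
    using f borel_measurable_indicator[OF o] by (subst integral_density) auto
  also have "(\<lambda>p. ennreal (indicator (fst c) p)) = indicator (fst c)"
    by (auto simp: fun_eq_iff split: split_indicator)
  also have "(LINT p|density (riemannian_volume A g) (indicator (fst c)). f p) =
      (LINT x|chart_measure g c. f (?J x))"
    unfolding chart_pushforward(2)[OF c, symmetric]
    by (rule integral_distr[OF chart_pushforward(1)[OF c] f(1)])
  also have "\<dots> = (LINT x|lebesgue. ?w x *\<^sub>R f (?J x))"
    unfolding chart_measure_def
    using density_measurable[OF g c] measurable_compose[OF J f(1)] nn
    by (subst integral_density) auto
  also have "\<dots> = (LINT x|lebesgue. ?w x * f (chart_inv c x))"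
    by (intro Bochner_Integration.integral_cong) (auto split: split_indicator)
  finally show ?thesis .
qed

end

end

text \<open>Expanded along the coordinate axes, the chain rule contains \<open>\<phi>\<close> only
  through scalar partial derivatives composed with \<open>T\<close>. The induction over all
  \<open>\<phi>\<close> with \<open>T\<close> fixed therefore closes.\<close>

lemma Ck_on_compose:
  fixes \<phi> :: "real ^ 'n::finite \<Rightarrow> real" and T :: "'a::euclidean_space \<Rightarrow> real ^ 'n"
  assumes S: "open S"
  shows "Ck_on k UNIV \<phi> \<Longrightarrow> Ck_on k S T \<Longrightarrow> Ck_on k S (\<lambda>x. \<phi> (T x))"
proof (induction k arbitrary: \<phi>)
  case 0
  then show ?case by (auto intro: continuous_on_compose2)
next
  case (Suc k)
  have sum: "Ck_on k S (\<lambda>x. \<Sum>i\<in>J. f i x)" if "finite J" "\<And>i. i \<in> J \<Longrightarrow> Ck_on k S (f i)"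
    for J :: "'n set" and f :: "'n \<Rightarrow> 'a \<Rightarrow> real"
    using that by (induction J rule: finite_induct) (auto intro: Ck_on_add[OF S])
  show ?case
  proof (rule Ck_on_SucI'[OF S])
    fix x assume x: "x \<in> S"
    have lin: "linear (frechet_derivative \<phi> (at (T x)))"
      by (rule has_derivative_linear[OF Ck_on_SucD_deriv[OF Suc.prems(1) UNIV_I]])
    have "((\<lambda>x. \<phi> (T x)) has_derivative
       (\<lambda>v. frechet_derivative \<phi> (at (T x)) (frechet_derivative T (at x) v))) (at x)"
      by (rule has_derivative_compose[OF Ck_on_SucD_deriv[OF Suc.prems(2) x] Ck_on_SucD_deriv[OF Suc.prems(1) UNIV_I]])
    also have "(\<lambda>v. frechet_derivative \<phi> (at (T x)) (frechet_derivative T (at x) v)) =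
       (\<lambda>v. \<Sum>i\<in>UNIV. (frechet_derivative T (at x) v $ i) *\<^sub>R frechet_derivative \<phi> (at (T x)) (axis i 1))"
    proof
      fix v
      have "frechet_derivative \<phi> (at (T x)) (\<Sum>i\<in>UNIV. (frechet_derivative T (at x) v $ i) *\<^sub>R axis i 1)
        = (\<Sum>i\<in>UNIV. (frechet_derivative T (at x) v $ i) *\<^sub>R frechet_derivative \<phi> (at (T x)) (axis i 1))"
        by (simp only: linear_sum[OF lin] linear_cmul[OF lin])
      then show "frechet_derivative \<phi> (at (T x)) (frechet_derivative T (at x) v) =
        (\<Sum>i\<in>UNIV. (frechet_derivative T (at x) v $ i) *\<^sub>R frechet_derivative \<phi> (at (T x)) (axis i 1))"
        using basis_expansion[of "frechet_derivative T (at x) v"] by (simp add: scalar_mult_eq_scaleR)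
    qed
    finally show "((\<lambda>x. \<phi> (T x)) has_derivative
       (\<lambda>v. \<Sum>i\<in>UNIV. (frechet_derivative T (at x) v $ i) *\<^sub>R frechet_derivative \<phi> (at (T x)) (axis i 1))) (at x)" .
  next
    fix v
    show "Ck_on k S (\<lambda>x. \<Sum>i\<in>UNIV. (frechet_derivative T (at x) v $ i) *\<^sub>R frechet_derivative \<phi> (at (T x)) (axis i 1))"
    proof (rule sum)
      fix i :: 'n
      have "Ck_on k S (\<lambda>x. frechet_derivative T (at x) v $ i)"
        by (rule Ck_on_bounded_linear[OF S bounded_linear_vec_nth]) (use Suc.prems(2) in simp)
      moreover have "Ck_on k S (\<lambda>x. frechet_derivative \<phi> (at (T x)) (axis i 1))"
        by (rule Suc.IH[OF _ Ck_on_SucD[OF Suc.prems(2)]]) (use Suc.prems(1) in simp)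
      ultimately show "Ck_on k S (\<lambda>x. (frechet_derivative T (at x) v $ i) *\<^sub>R frechet_derivative \<phi> (at (T x)) (axis i 1))"
        by (rule Ck_on_scaleR[OF S])
    qed simp
  qed
qed

lemma smooth_on_compose:
  fixes \<phi> :: "real ^ 'n::finite \<Rightarrow> real" and T :: "'a::euclidean_space \<Rightarrow> real ^ 'n"
  shows "open S \<Longrightarrow> smooth_on UNIV \<phi> \<Longrightarrow> smooth_on S T \<Longrightarrow> smooth_on S (\<lambda>x. \<phi> (T x))"
  by (rule smooth_onI, rule Ck_on_compose[OF _ smooth_onD smooth_onD])

text \<open>The extension is \<open>f\<close> on \<open>U\<close> and \<open>0\<close> on the
  complement of \<open>K\<close>; both sets are open and together they cover the space.\<close>

lemma smooth_on_extend_0: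
  assumes U: "open U" and K: "closed K" "K \<subseteq> U" and f: "smooth_on U f" "\<And>x. x \<in> U \<Longrightarrow> x \<notin> K \<Longrightarrow> f x = 0"
  shows "smooth_on UNIV (\<lambda>x. if x \<in> U then f x else 0)"
proof -
  have "smooth_on (U \<union> - K) (\<lambda>x. if x \<in> U then f x else 0)"
  proof (rule smooth_on_Un[OF U])
    show "smooth_on U (\<lambda>x. if x \<in> U then f x else 0)" by (rule smooth_on_cong[OF U f(1)]) simp
    show "open (- K)" using K by (simp add: open_Compl)
    then show "smooth_on (- K) (\<lambda>x. if x \<in> U then f x else 0)"
      by (rule smooth_on_cong[OF _ smooth_on_const[of _ 0]]) (use f(2) in auto)
  qed
  moreover have "U \<union> - K = UNIV" using K(2) by blast
  ultimately show ?thesis by simp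
qed

section \<open>Smooth real functions on the manifold\<close>

context closed_manifold
begin

lemma open_overlap: "c \<in> A \<Longrightarrow> d \<in> A \<Longrightarrow> open (fst c \<inter> fst d)"
  by (intro open_Int open_chart(1))

definition smooth_fun :: "('m \<Rightarrow> real) \<Rightarrow> bool" where
  "smooth_fun f \<longleftrightarrow> (\<forall>c\<in>A. smooth_on (chart_image c) (\<lambda>x. f (chart_inv c x)))"

lemma smooth_funD: "smooth_fun f \<Longrightarrow> c \<in> A \<Longrightarrow> smooth_on (chart_image c) (\<lambda>x. f (chart_inv c x))"
  by (simp add: smooth_fun_def)

lemma continuous_on_chartI:
  assumes c: "c \<in> A" and "continuous_on (chart_image c) (\<lambda>x. f (chart_inv c x))"
  shows "continuous_on (fst c) f"
proof -
  have "continuous_on (fst c) (\<lambda>p. f (chart_inv c (snd c p)))"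
    by (rule continuous_on_compose2[OF assms(2) continuous_on_chart[OF c]]) auto
  then show ?thesis
    by (rule continuous_on_eq) (simp add: chart_inv_left[OF c])
qed

lemma continuous_on_UNIV_chartI:
  assumes "\<And>c. c \<in> A \<Longrightarrow> continuous_on (fst c) f"
  shows "continuous_on UNIV f"
proof -
  have "continuous_on (\<Union>c\<in>A. fst c) f"
    by (rule continuous_on_open_UN) (use assms open_chart(1) in auto)
  moreover have "(\<Union>c\<in>A. fst c) = UNIV" using ex_chart by auto
  ultimately show ?thesis by simp
qed

lemma smooth_fun_continuous: "smooth_fun f \<Longrightarrow> continuous_on UNIV f"
  by (intro continuous_on_UNIV_chartI continuous_on_chartI smooth_on_continuous_on smooth_funD)

lemma compact_chart_inv_image:
  assumes "c \<in> A" "compact K" "K \<subseteq> chart_image c" shows "compact (chart_inv c ` K)" "closed (chart_inv c ` K)"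
proof -
  show "compact (chart_inv c ` K)"
    by (rule compact_continuous_image[OF continuous_on_subset[OF continuous_on_chart_inv[OF assms(1)] assms(3)] assms(2)])
  then show "closed (chart_inv c ` K)" by (rule compact_imp_closed)
qed

subsection \<open>Volumes of open sets and coordinate balls\<close>

text \<open>The density is positive, and a nonempty open set of coordinates is not negligible. This
  turns almost everywhere statements about continuous functions into statements at every point, and
  it allows division by the total volume.\<close>

lemma emeasure_volume_open_pos:
  assumes g: "riemannian_metric A g" and U: "open U" "p \<in> U"
  shows "0 < emeasure (riemannian_volume A g) U"
proof -
  obtain c where c: "c \<in> A" "p \<in> fst c" using ex_chart by blast
  let ?V = "snd c ` (U \<inter> fst c)"
  let ?w = "\<lambda>x. indicator (chart_image c) x * volume_density g c (chart_inv c x)"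
  have UO: "open (U \<inter> fst c)" by (rule open_Int[OF U(1) open_chart(1)[OF c(1)]])
  have V: "open ?V" by (rule open_chart_image[OF c(1) UO]) auto
  have ne: "snd c p \<in> ?V" using U c by auto
  have Vl: "?V \<in> sets lebesgue" using V by auto
  have "emeasure (chart_measure g c) ?V \<noteq> 0"
  proof
    assume "emeasure (chart_measure g c) ?V = 0"
    then have "?V \<in> null_sets (chart_measure g c)" using Vl by (auto simp: null_sets_def)
    then have "AE x in lebesgue. x \<in> ?V \<longrightarrow> ennreal (?w x) = 0"
      unfolding chart_measure_def using density_measurable[OF g c(1)]
      by (subst (asm) null_sets_density_iff) auto
    moreover have pos: "0 < ?w x" if "x \<in> ?V" for x
      using that volume_density_pos[OF g c(1) chart_inv_in[OF c(1), of x]] by (auto simp: indicator_def)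
    ultimately have "AE x in lebesgue. x \<notin> ?V"
      by (elim eventually_mono) (metis ennreal_eq_0_iff not_le)
    then have "?V \<in> null_sets lebesgue" using Vl by (simp add: AE_iff_null_sets)
    then show False using open_not_negligible[OF V] ne by (auto simp: negligible_iff_null_sets)
  qed
  then have "0 < emeasure (riemannian_volume A g) (U \<inter> fst c)"
    using emeasure_volume_chart[OF g c(1), of "U \<inter> fst c"] open_manifold_sets[OF UO]
    by (simp add: zero_less_iff_neq_zero)
  also have "\<dots> \<le> emeasure (riemannian_volume A g) U"
    by (rule emeasure_mono) (use open_manifold_sets[OF U(1)] g in auto)
  finally show ?thesis .
qed

lemma volume_chart_bound:
  assumes g: "riemannian_metric A g" and c: "c \<in> A" and K: "compact K" "K \<subseteq> chart_image c"
  obtains W where "0 \<le> W" "\<And>x. x \<in> K \<Longrightarrow> volume_density g c (chart_inv c x) \<le> W"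
    "\<And>S. S \<in> sets lebesgue \<Longrightarrow> S \<subseteq> K \<Longrightarrow>
       chart_inv c ` S \<in> manifold_lebesgue_sets A \<Longrightarrow>
       emeasure (riemannian_volume A g) (chart_inv c ` S) \<le> ennreal W * emeasure lebesgue S"
proof -
  let ?w = "\<lambda>x. volume_density g c (chart_inv c x)"
  have "bounded (?w ` K)"
    by (intro compact_imp_bounded compact_continuous_image
        continuous_on_subset[OF volume_density_continuous[OF g c] K(2)] K(1))
  then obtain W0 where W0: "\<forall>y\<in>?w ` K. norm y \<le> W0" unfolding bounded_iff by blast
  \<comment> \<open>The maximum with \<open>0\<close> covers an empty \<open>K\<close>, for which
    \<open>W0\<close> may be negative.\<close>
  define W where "W = max W0 0"
  have W: "0 \<le> W" "\<And>x. x \<in> K \<Longrightarrow> ?w x \<le> W" using W0 by (force simp: W_def)+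
  show thesis
  proof (rule that[OF W])
    fix S assume S: "S \<in> sets lebesgue" "S \<subseteq> K" "chart_inv c ` S \<in> manifold_lebesgue_sets A"
    have Sc: "S \<subseteq> chart_image c" using S K by auto
    then have "chart_inv c ` S \<subseteq> fst c" using chart_inv_in[OF c] by auto
    then have "emeasure (riemannian_volume A g) (chart_inv c ` S) = emeasure (chart_measure g c) S"
      using emeasure_volume_chart[OF g c S(3)] image_chart_inv_image[OF c Sc] by simp
    also have "\<dots> = (\<integral>\<^sup>+x\<in>S. ennreal (?w x) \<partial>lebesgue)"
      by (rule emeasure_chart_measure[OF g c S(1) Sc])
    also have "\<dots> \<le> (\<integral>\<^sup>+x. ennreal W * indicator S x \<partial>lebesgue)"
      using W(2) S(2) by (intro nn_integral_mono) (auto simp: indicator_def intro!: ennreal_leI)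
    also have "\<dots> = ennreal W * emeasure lebesgue S"
      using S(1) by (rule nn_integral_cmult_indicator)
    finally show "emeasure (riemannian_volume A g) (chart_inv c ` S) \<le> ennreal W * emeasure lebesgue S" .
  qed
qed

text \<open>A small coordinate ball has finite volume since the density is bounded on its closure,
  and by compactness finitely many such balls cover the manifold.\<close>

lemma finite_measure_volume:
  assumes g: "riemannian_metric A g" shows "finite_measure (riemannian_volume A g)"
proof -
  have "\<exists>U. open U \<and> p \<in> U \<and> emeasure (riemannian_volume A g) U < \<infinity>" for p
  proof -
    obtain c where c: "c \<in> A" "p \<in> fst c" using ex_chart by blast
    then obtain r where r: "0 < r" "cball (snd c p) r \<subseteq> chart_image c"
      using open_chart(2)[OF c(1)] open_contains_cball by blast
    obtain W where W: "0 \<le> W" "\<And>S. S \<in> sets lebesgue \<Longrightarrow> S \<subseteq> cball (snd c p) r \<Longrightarrow>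
       chart_inv c ` S \<in> manifold_lebesgue_sets A \<Longrightarrow>
       emeasure (riemannian_volume A g) (chart_inv c ` S) \<le> ennreal W * emeasure lebesgue S"
      using volume_chart_bound[OF g c(1) compact_cball r(2)] by metis
    let ?B = "ball (snd c p) r"
    have o: "open (chart_inv c ` ?B)" by (rule open_chart_inv_image[OF c(1)]) (use r in auto)
    have "emeasure (riemannian_volume A g) (chart_inv c ` ?B) \<le> ennreal W * emeasure lebesgue ?B"
      by (rule W(2)) (use o open_manifold_sets in auto)
    also have "\<dots> < \<infinity>" using emeasure_lborel_ball_finite[of "snd c p" r] by (simp add: ennreal_mult_less_top)
    finally show ?thesis using o r(1) chart_inv_left[OF c] by (intro exI[of _ "chart_inv c ` ?B"]) (auto simp: image_iff intro!: bexI[of _ "snd c p"])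
  qed
  then obtain U where U: "\<And>p. open (U p)" "\<And>p. p \<in> U p" "\<And>p. emeasure (riemannian_volume A g) (U p) < \<infinity>"
    by metis
  have "UNIV \<subseteq> (\<Union>p\<in>UNIV. U p)" using U(2) by auto
  then obtain F where F: "finite F" "UNIV \<subseteq> (\<Union>p\<in>F. U p)"
    using compactE_image[OF compact_M, of UNIV U] U(1) by metis
  have "emeasure (riemannian_volume A g) UNIV \<le> emeasure (riemannian_volume A g) (\<Union>p\<in>F. U p)"
    by (rule emeasure_mono) (use F(2) open_manifold_sets[OF open_UN[of F U]] U(1) g in auto)
  also have "\<dots> \<le> (\<Sum>p\<in>F. emeasure (riemannian_volume A g) (U p))"
    by (rule emeasure_subadditive_finite) (use F(1) open_manifold_sets[OF U(1)] g in auto)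
  also have "\<dots> < \<infinity>" using F(1) U(3) by (simp add: less_top)
  finally show ?thesis by (intro finite_measureI) (use g in auto)
qed

lemma integrable_volume_continuous:
  fixes f :: "'m \<Rightarrow> real"
  assumes g: "riemannian_metric A g" and f: "continuous_on UNIV f"
  shows "f \<in> borel_measurable (riemannian_volume A g)" "integrable (riemannian_volume A g) f"
proof -
  interpret finite_measure "riemannian_volume A g" by (rule finite_measure_volume[OF g])
  show m: "f \<in> borel_measurable (riemannian_volume A g)"
    by (rule borel_measurable_volume[OF g borel_measurable_continuous_onI[OF f]])
  obtain C where "\<forall>y\<in>range f. norm y \<le> C"
    using compact_imp_bounded[OF compact_continuous_image[OF f compact_M]] unfolding bounded_iff by blast
  then show "integrable (riemannian_volume A g) f"
    by (intro integrable_const_bound[of _ C] m) auto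
qed

subsection \<open>Vector fields and their divergence\<close>

lemma smooth_vector_field_scale:
  assumes Y: "smooth_vector_field A Y" and f: "smooth_fun f"
  shows "smooth_vector_field A (\<lambda>c p. f p *\<^sub>R Y c p)"
  unfolding smooth_vector_field_def
proof (intro conjI ballI)
  fix c assume c: "c \<in> A"
  have "smooth_on (chart_image c) (\<lambda>x. Y c (chart_inv c x))"
    using Y c by (simp add: smooth_vector_field_def)
  then show "smooth_on (chart_image c) (\<lambda>x. f (chart_inv c x) *\<^sub>R Y c (chart_inv c x))"
    by (rule smooth_on_scaleR[OF open_chart(2)[OF c] smooth_funD[OF f c]])
next
  fix c d p assume *: "c \<in> A" "d \<in> A" "p \<in> fst c \<inter> fst d"
  let ?L = "frechet_derivative (transition c d) (at (snd c p))"
  have "linear ?L" using has_derivative_linear[OF transition_has_derivative] * by blast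
  moreover have "Y d p = ?L (Y c p)" using Y * unfolding smooth_vector_field_def by blast
  ultimately show "f p *\<^sub>R Y d p = ?L (f p *\<^sub>R Y c p)" by (simp add: linear_cmul)
qed

definition chart_diff :: "('m \<Rightarrow> real) \<Rightarrow> ('m, 'n) chart \<Rightarrow> 'm \<Rightarrow> real ^ 'n \<Rightarrow> real" where
  "chart_diff f c p = frechet_derivative (\<lambda>x. f (chart_inv c x)) (at (snd c p))"

text \<open>\<open>chart_diff f c p (Y c p)\<close> is the derivative of \<open>f\<close> along
  \<open>Y\<close>. The Jacobian from the chain rule for \<open>f\<close> is absorbed by the
  transformation law of \<open>Y\<close>.\<close>

lemma chart_diff_transition:
  assumes f: "smooth_fun f" and Y: "smooth_vector_field A Y"
    and c: "c \<in> A" "d \<in> A" "p \<in> fst c" "p \<in> fst d"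
  shows "chart_diff f c p (Y c p) = chart_diff f d p (Y d p)"
proof -
  let ?T = "transition c d"
  let ?V = "snd c ` (fst c \<inter> fst d)"
  have V: "open ?V" by (rule open_chart_image[OF c(1) open_overlap[OF c(1,2)]]) auto
  have "((\<lambda>x. f (chart_inv d x)) has_derivative chart_diff f d p) (at (?T (snd c p)))"
    unfolding transition_chart[OF c(1,3)] chart_diff_def
    by (rule smooth_on_has_derivative[OF smooth_funD[OF f c(2)]]) (use c in auto)
  from has_derivative_compose[OF transition_has_derivative[OF c] this]
  have "((\<lambda>x. f (chart_inv d (?T x))) has_derivative
     (\<lambda>v. chart_diff f d p (frechet_derivative ?T (at (snd c p)) v))) (at (snd c p))" .
  then have "((\<lambda>x. f (chart_inv c x)) has_derivative
     (\<lambda>v. chart_diff f d p (frechet_derivative ?T (at (snd c p)) v))) (at (snd c p))"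
    by (rule has_derivative_transform_within_open[OF _ V])
      (use c in \<open>auto simp: transition_chart chart_inv_left\<close>)
  from frechet_derivative_eqI[OF this]
  have "chart_diff f c p (Y c p) = chart_diff f d p (frechet_derivative ?T (at (snd c p)) (Y c p))"
    by (simp add: chart_diff_def)
  also have "frechet_derivative ?T (at (snd c p)) (Y c p) = Y d p"
    using Y c unfolding smooth_vector_field_def by (metis IntI)
  finally show ?thesis .
qed

lemma smooth_density_field:
  assumes g: "riemannian_metric A g" and Y: "smooth_vector_field A Y" and c: "c \<in> A"
  shows "smooth_on (chart_image c) (\<lambda>x. volume_density g c (chart_inv c x) * Y c (chart_inv c x) $ i)"
proof -
  have "smooth_on (chart_image c) (\<lambda>x. Y c (chart_inv c x))"
    using Y c by (simp add: smooth_vector_field_def)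
  then show ?thesis
    by (intro smooth_on_mult smooth_on_nth volume_density_smooth[OF g c] open_chart(2)[OF c])
qed

text \<open>The product rule separates the divergence of \<open>Y\<close>, whose independence of the
  chart is still open, from the derivative of \<open>f\<close> along \<open>Y\<close>, which is the
  same in all charts by \<open>chart_diff_transition\<close>.\<close>

lemma chart_divergence_scale:
  assumes g: "riemannian_metric A g" and Y: "smooth_vector_field A Y" and f: "smooth_fun f"
    and c: "c \<in> A" "p \<in> fst c"
  shows "chart_divergence g (\<lambda>c p. f p *\<^sub>R Y c p) c p =
    f p * chart_divergence g Y c p + chart_diff f c p (Y c p)"
proof -
  let ?x = "snd c p" let ?w = "\<lambda>x. volume_density g c (chart_inv c x)"
  let ?f = "\<lambda>x. f (chart_inv c x)" let ?Y = "\<lambda>i x. ?w x * Y c (chart_inv c x) $ i"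
  have x: "?x \<in> chart_image c" and inv: "chart_inv c ?x = p" using c chart_inv_left by auto
  have Df: "(?f has_derivative chart_diff f c p) (at ?x)"
    unfolding chart_diff_def by (rule smooth_on_has_derivative[OF smooth_funD[OF f c(1)] x])
  have DY: "(?Y i has_derivative frechet_derivative (?Y i) (at ?x)) (at ?x)" for i
    by (rule smooth_on_has_derivative[OF smooth_density_field[OF g Y c(1)] x])
  have D: "frechet_derivative (\<lambda>x. ?w x * (?f x *\<^sub>R Y c (chart_inv c x)) $ i) (at ?x) (axis i 1) =
     f p * frechet_derivative (?Y i) (at ?x) (axis i 1) +
     chart_diff f c p (axis i 1) * (volume_density g c p * Y c p $ i)" for i
  proof -
    have "((\<lambda>x. ?f x * ?Y i x) has_derivative (\<lambda>v. ?f ?x * frechet_derivative (?Y i) (at ?x) v +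
        chart_diff f c p v * ?Y i ?x)) (at ?x)"
      by (rule has_derivative_mult[OF Df DY])
    also have "(\<lambda>x. ?f x * ?Y i x) = (\<lambda>x. ?w x * (?f x *\<^sub>R Y c (chart_inv c x)) $ i)"
      by (simp add: fun_eq_iff)
    finally show ?thesis by (simp add: frechet_derivative_eqI inv)
  qed
  have lin: "linear (chart_diff f c p)" by (rule has_derivative_linear[OF Df])
  have "chart_diff f c p (\<Sum>i\<in>UNIV. (Y c p $ i) *\<^sub>R axis i 1) = (\<Sum>i\<in>UNIV. (Y c p $ i) * chart_diff f c p (axis i 1))"
    by (simp only: linear_sum[OF lin] linear_cmul[OF lin] real_scaleR_def)
  then have "chart_diff f c p (Y c p) = (\<Sum>i\<in>UNIV. (Y c p $ i) * chart_diff f c p (axis i 1))"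
    using basis_expansion[of "Y c p"] by (simp add: scalar_mult_eq_scaleR)
  then have "volume_density g c p * chart_diff f c p (Y c p) =
     (\<Sum>i\<in>UNIV. chart_diff f c p (axis i 1) * (volume_density g c p * Y c p $ i))"
    by (simp add: sum_distrib_left mult_ac)
  then show ?thesis
    using volume_density_pos[OF g c] unfolding chart_divergence_def D
    by (simp add: sum.distrib sum_distrib_left[symmetric] field_simps)
qed

lemma chart_divergence_continuous:
  assumes g: "riemannian_metric A g" and Y: "smooth_vector_field A Y" and c: "c \<in> A"
  shows "continuous_on (fst c) (chart_divergence g Y c)"
proof (rule continuous_on_chartI[OF c])
  let ?w = "\<lambda>x. volume_density g c (chart_inv c x)"
  have "continuous_on (chart_image c) (\<lambda>x. (\<Sum>i\<in>UNIV. frechet_derivative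
        (\<lambda>x. ?w x * Y c (chart_inv c x) $ i) (at x) (axis i 1)) / ?w x)"
    by (intro continuous_on_divide continuous_on_sum volume_density_continuous[OF g c]
       smooth_on_continuous_on[OF smooth_on_frechet_derivative[OF smooth_density_field[OF g Y c]]])
      (use volume_density_pos[OF g c] chart_inv_in[OF c] in force)
  then show "continuous_on (chart_image c) (\<lambda>x. chart_divergence g Y c (chart_inv c x))"
    by (rule continuous_on_eq) (simp add: chart_divergence_def chart_inv_right[OF c])
qed

lemma chart_divergence_eq_0:
  assumes c: "c \<in> A" and K: "closed K" and Y: "\<And>p. p \<in> fst c \<Longrightarrow> snd c p \<notin> K \<Longrightarrow> Y c p = 0"
    and p: "p \<in> fst c" "snd c p \<notin> K"
  shows "chart_divergence g Y c p = 0"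
proof -
  have "frechet_derivative (\<lambda>x. volume_density g c (chart_inv c x) * Y c (chart_inv c x) $ i) (at (snd c p))
      = frechet_derivative (\<lambda>_. 0) (at (snd c p))" for i
  proof (rule frechet_derivative_cong_open[of "chart_image c - K"])
    show "open (chart_image c - K)" using open_chart(2)[OF c] K by (rule open_Diff)
    show "snd c p \<in> chart_image c - K" using p by auto
    fix x assume x: "x \<in> chart_image c - K"
    then have "Y c (chart_inv c x) = 0"
      using chart_inv_in[OF c, of x] chart_inv_right[OF c, of x] by (intro Y) auto
    then show "volume_density g c (chart_inv c x) * Y c (chart_inv c x) $ i = 0" by simp
  qed
  moreover have "frechet_derivative (\<lambda>_. 0 :: real) (at x) = (\<lambda>_. 0)" for x :: "real ^ 'n"
    by (rule frechet_derivative_eqI) simp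
  ultimately show ?thesis by (simp add: chart_divergence_def)
qed

text \<open>The volume density cancels the denominator in \<open>chart_divergence\<close>. What
  remains is a Euclidean divergence of compactly supported components, and each partial derivative
  has integral \<open>0\<close>.\<close>

lemma integral_chart_divergence_eq_0:
  assumes g: "riemannian_metric A g" and Y: "smooth_vector_field A Y" and c: "c \<in> A"
    and K: "compact K" "K \<subseteq> chart_image c" and Y0: "\<And>p. p \<in> fst c \<Longrightarrow> snd c p \<notin> K \<Longrightarrow> Y c p = 0"
  defines "G \<equiv> \<lambda>p. if p \<in> fst c then chart_divergence g Y c p else 0"
  shows "continuous_on UNIV G" "(LINT p|riemannian_volume A g. G p) = 0"
proof -
  have G0: "G p = 0" if "p \<notin> chart_inv c ` K" for p
  proof (cases "p \<in> fst c")
    case True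
    then have "snd c p \<notin> K" using that chart_inv_left[OF c True] by (metis imageI)
    then show ?thesis using chart_divergence_eq_0[where Y = Y and p = p, OF c compact_imp_closed[OF K(1)] Y0 True] by (simp add: G_def)
  qed (simp add: G_def)
  have "continuous_on (fst c \<union> - chart_inv c ` K) G"
  proof (rule continuous_on_open_Un)
    show "open (fst c)" by (rule open_chart(1)[OF c])
    show "open (- chart_inv c ` K)" using compact_chart_inv_image(2)[OF c K] by (simp add: open_Compl)
    show "continuous_on (fst c) G"
      by (rule continuous_on_eq[OF chart_divergence_continuous[OF g Y c]]) (simp add: G_def)
    show "continuous_on (- chart_inv c ` K) G"
      by (rule continuous_on_eq[OF continuous_on_const[of _ 0]]) (simp add: G0)
  qed
  moreover have "chart_inv c ` K \<subseteq> fst c" using K(2) chart_inv_in[OF c] by blast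
  then have "fst c \<union> - chart_inv c ` K = UNIV" by blast
  ultimately show contG: "continuous_on UNIV G" by simp
  let ?w = "\<lambda>x. volume_density g c (chart_inv c x)"
  define F where "F i x = (if x \<in> chart_image c then ?w x * Y c (chart_inv c x) $ i else 0)" for i x
  have smF: "smooth_on UNIV (F i)" for i
    unfolding F_def
  proof (rule smooth_on_extend_0[OF open_chart(2)[OF c] compact_imp_closed[OF K(1)] K(2) smooth_density_field[OF g Y c]])
    fix x assume "x \<in> chart_image c" "x \<notin> K"
    then show "?w x * Y c (chart_inv c x) $ i = 0"
      using Y0[of "chart_inv c x"] chart_inv_in[OF c, of x] chart_inv_right[OF c, of x] by simp
  qed
  have F0: "F i x = 0" if "x \<notin> K" for i x
    using Y0[of "chart_inv c x"] chart_inv_in[OF c, of x] chart_inv_right[OF c, of x] that by (simp add: F_def)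
  have FD: "indicator (chart_image c) x * ?w x * G (chart_inv c x) =
      (\<Sum>i\<in>UNIV. frechet_derivative (F i) (at x) (axis i 1))" for x
  proof (cases "x \<in> chart_image c")
    case True
    have "frechet_derivative (F i) (at x) = frechet_derivative (\<lambda>x. ?w x * Y c (chart_inv c x) $ i) (at x)" for i
      by (rule frechet_derivative_cong_open[OF open_chart(2)[OF c] True]) (simp add: F_def)
    then show ?thesis
      using True volume_density_pos[OF g c chart_inv_in[OF c True]] chart_inv_in[OF c True]
      by (simp add: G_def chart_divergence_def chart_inv_right[OF c True])
  next
    case False
    have "frechet_derivative (F i) (at x) = frechet_derivative (\<lambda>_. 0) (at x)" for i
      by (rule frechet_derivative_cong_open[of "- K"])
        (use F0 False K(2) compact_imp_closed[OF K(1)] in \<open>auto simp: open_Compl\<close>)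
    moreover have "frechet_derivative (\<lambda>_. 0 :: real) (at x) = (\<lambda>_. 0)" by (rule frechet_derivative_eqI) simp
    ultimately show ?thesis using False by simp
  qed
  have "(LINT p|riemannian_volume A g. G p) =
      (LINT x|lebesgue. indicator (chart_image c) x * ?w x * G (chart_inv c x))"
    by (rule integral_volume_chart[OF g c integrable_volume_continuous(1)[OF g contG]]) (simp add: G_def)
  also have "\<dots> = (LINT x|lebesgue. (\<Sum>i\<in>UNIV. frechet_derivative (F i) (at x) (axis i 1)))"
    by (simp only: FD)
  also have "\<dots> = (\<Sum>i\<in>UNIV. (LINT x|lebesgue. frechet_derivative (F i) (at x) (axis i 1)))"
    by (rule Bochner_Integration.integral_sum) (rule integral_directional_derivative_eq_0(1)[OF smF K(1) F0])
  also have "\<dots> = 0" using integral_directional_derivative_eq_0(2)[OF smF K(1) F0] by simp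
  finally show "(LINT p|riemannian_volume A g. G p) = 0" .
qed

definition chart_lift :: "('m, 'n) chart \<Rightarrow> (real ^ 'n \<Rightarrow> real) \<Rightarrow> 'm \<Rightarrow> real" where
  "chart_lift c \<phi> p = (if p \<in> fst c then \<phi> (snd c p) else 0)"

text \<open>On the overlap with \<open>c\<close> the lift is \<open>\<phi>\<close> composed with a
  transition map, and off the image of \<open>K\<close> it is \<open>0\<close>. Compact sets in a
  Hausdorff space are closed, so both regions are open.\<close>

lemma smooth_fun_chart_lift:
  assumes c: "c \<in> A" and \<phi>: "smooth_on UNIV \<phi>" and K: "compact K" "K \<subseteq> chart_image c"
    and \<phi>0: "\<And>x. x \<notin> K \<Longrightarrow> \<phi> x = 0"
  shows "smooth_fun (chart_lift c \<phi>)"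
  unfolding smooth_fun_def
proof
  fix d assume d: "d \<in> A"
  let ?U = "snd d ` (fst d \<inter> fst c)" and ?V = "snd d ` (fst d - chart_inv c ` K)"
  have U: "open ?U" by (rule open_chart_image[OF d open_overlap[OF d c]]) auto
  have V: "open ?V"
    by (rule open_chart_image[OF d open_Diff[OF open_chart(1)[OF d] compact_chart_inv_image(2)[OF c K]]]) auto
  have "smooth_on (?U \<union> ?V) (\<lambda>x. chart_lift c \<phi> (chart_inv d x))"
  proof (rule smooth_on_Un[OF U V])
    have "smooth_on ?U (\<lambda>x. \<phi> (transition d c x))"
      by (rule smooth_on_compose[OF U \<phi> transition_smooth[OF d c]])
    then show "smooth_on ?U (\<lambda>x. chart_lift c \<phi> (chart_inv d x))"
      by (rule smooth_on_cong[OF U]) (auto simp: chart_lift_def transition_chart[OF d] chart_inv_left[OF d])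
    have z: "chart_lift c \<phi> p = 0" if "p \<notin> chart_inv c ` K" for p
    proof (cases "p \<in> fst c")
      case True
      then have "snd c p \<notin> K" using that chart_inv_left[OF c True] by (metis imageI)
      then show ?thesis by (simp add: chart_lift_def \<phi>0)
    qed (simp add: chart_lift_def)
    show "smooth_on ?V (\<lambda>x. chart_lift c \<phi> (chart_inv d x))"
      by (rule smooth_on_cong[OF V smooth_on_const[of _ 0]]) (auto simp: chart_inv_left[OF d] z)
  qed
  moreover have "chart_image d = ?U \<union> ?V"
  proof -
    have "chart_inv c ` K \<subseteq> fst c" using K(2) chart_inv_in[OF c] by blast
    then show ?thesis by blast
  qed
  ultimately show "smooth_on (chart_image d) (\<lambda>x. chart_lift c \<phi> (chart_inv d x))" by simp
qed

text \<open>Independence of the chart, in weak form: integrating by parts against a bump function in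
  either chart gives the same result, so no second derivatives of the transition map occur.\<close>

lemma chart_divergence_le:
  assumes g: "riemannian_metric A g" and Y: "smooth_vector_field A Y"
    and c: "c \<in> A" "d \<in> A" "p \<in> fst c" "p \<in> fst d"
  shows "chart_divergence g Y c p \<le> chart_divergence g Y d p"
proof (rule ccontr)
  assume neg: "\<not> chart_divergence g Y c p \<le> chart_divergence g Y d p"
  let ?h = "\<lambda>p. chart_divergence g Y c p - chart_divergence g Y d p"
  let ?O = "fst c \<inter> fst d"
  have conth: "continuous_on ?O ?h"
    by (intro continuous_on_diff) (auto intro: continuous_on_subset[OF chart_divergence_continuous[OF g Y]] c)
  \<comment> \<open>An open neighbourhood of \<open>p\<close>, by continuity of both coordinate
    divergences, with room for a bump function.\<close>
  define V where "V = ?O \<inter> ?h -` {0<..}"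
  have V: "open V" unfolding V_def
    by (rule continuous_open_preimage[OF conth open_overlap[OF c(1,2)]]) auto
  have pV: "p \<in> V" using neg c by (auto simp: V_def)
  have "open (snd c ` V)" by (rule open_chart_image[OF c(1) V]) (auto simp: V_def)
  then obtain r0 where r0: "0 < r0" "cball (snd c p) r0 \<subseteq> snd c ` V"
    using open_contains_cball pV by blast
  define r where "r = r0 / 2"
  define K where "K = cball (snd c p) (2 * r)"
  have r: "0 < r" and KV: "K \<subseteq> snd c ` V" using r0 by (auto simp: r_def K_def)
  have K: "compact K" "K \<subseteq> chart_image c" using KV by (auto simp: K_def V_def)
  have "\<exists>\<phi>0. smooth_on UNIV \<phi>0 \<and> (\<forall>x. 0 \<le> \<phi>0 x) \<and> (\<forall>x\<in>cball (snd c p) r. \<phi>0 x = (1::real)) \<and>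
    (\<forall>x. x \<notin> K \<longrightarrow> \<phi>0 x = 0)"
    unfolding K_def by (rule bump_function[OF r, of "snd c p"]) blast
  then obtain \<phi>0 :: "real ^ 'n \<Rightarrow> real" where \<phi>: "smooth_on UNIV \<phi>0" "\<And>x. 0 \<le> \<phi>0 x"
    "\<And>x. x \<in> cball (snd c p) r \<Longrightarrow> \<phi>0 x = 1" "\<And>x. x \<notin> K \<Longrightarrow> \<phi>0 x = 0"
    by blast
  define F where "F = chart_lift c \<phi>0"
  have F: "smooth_fun F" unfolding F_def by (rule smooth_fun_chart_lift[OF c(1) \<phi>(1) K \<phi>(4)])
  let ?Z = "\<lambda>c p. F p *\<^sub>R Y c p"
  have Z: "smooth_vector_field A ?Z" by (rule smooth_vector_field_scale[OF Y F])
  have Fz: "F q = 0" if "q \<notin> chart_inv c ` K" for q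
  proof (cases "q \<in> fst c")
    case True
    then have "snd c q \<notin> K" using that chart_inv_left[OF c(1) True] by (metis imageI)
    then show ?thesis by (simp add: F_def chart_lift_def \<phi>)
  qed (simp add: F_def chart_lift_def)
  have KM: "chart_inv c ` K \<subseteq> V"
  proof
    fix q assume "q \<in> chart_inv c ` K"
    then obtain q' where "q' \<in> V" "q = chart_inv c (snd c q')" using KV by blast
    then show "q \<in> V" using chart_inv_left[OF c(1), of q'] by (auto simp: V_def)
  qed
  have cK: "compact (chart_inv c ` K)" by (rule compact_chart_inv_image(1)[OF c(1) K])
  let ?Gc = "\<lambda>q. if q \<in> fst c then chart_divergence g ?Z c q else 0"
  let ?Gd = "\<lambda>q. if q \<in> fst d then chart_divergence g ?Z d q else 0"
  have Zc: "?Z c q = 0" if "q \<in> fst c" "snd c q \<notin> K" for q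
    using that by (simp add: F_def chart_lift_def \<phi>)
  have Gc: "continuous_on UNIV ?Gc" "(LINT p|riemannian_volume A g. ?Gc p) = 0"
    using integral_chart_divergence_eq_0[OF g Z c(1) K Zc] by auto
  define Kd where "Kd = snd d ` chart_inv c ` K"
  have Kd: "compact Kd" "Kd \<subseteq> chart_image d"
    unfolding Kd_def using KM
    by (auto intro!: compact_continuous_image[OF continuous_on_subset[OF continuous_on_chart[OF c(2)]] cK] simp: V_def)
  have Zd: "?Z d q = 0" if "q \<in> fst d" "snd d q \<notin> Kd" for q
  proof -
    have "q \<notin> chart_inv c ` K" using that by (auto simp: Kd_def)
    then show ?thesis by (simp add: Fz)
  qed
  have Gd: "continuous_on UNIV ?Gd" "(LINT p|riemannian_volume A g. ?Gd p) = 0"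
    using integral_chart_divergence_eq_0[OF g Z c(2) Kd Zd] by auto
  let ?H = "\<lambda>q. ?Gc q - ?Gd q"
  have contH: "continuous_on UNIV ?H" by (intro continuous_on_diff Gc Gd)
  \<comment> \<open>The derivatives of the bump function along \<open>Y\<close> agree in the two
    charts and cancel, so only the bump times the difference of the divergences is left.\<close>
  have Hin: "?H q = F q * ?h q" if "q \<in> ?O" for q
    using that chart_divergence_scale[OF g Y F c(1), of q] chart_divergence_scale[OF g Y F c(2), of q]
      chart_diff_transition[OF F Y c(1,2), of q] by (simp add: right_diff_distrib)
  have Hout: "?H q = 0" if "q \<notin> ?O" for q
  proof -
    have "q \<notin> chart_inv c ` K" using KM that by (auto simp: V_def)
    have "?Gc q = 0"
    proof (cases "q \<in> fst c")
      case True
      have "snd c q \<notin> K" using \<open>q \<notin> chart_inv c ` K\<close> chart_inv_left[OF c(1) True] by (metis imageI)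
      then show ?thesis
        using chart_divergence_eq_0[OF c(1) compact_imp_closed[OF K(1)], of ?Z q g] Zc True by simp
    qed simp
    moreover have "?Gd q = 0"
    proof (cases "q \<in> fst d")
      case True
      have "snd d q \<notin> Kd"
      proof
        assume "snd d q \<in> Kd"
        then obtain q' where "q' \<in> chart_inv c ` K" "snd d q = snd d q'" by (auto simp: Kd_def)
        moreover from this have "q' \<in> fst d" using KM by (auto simp: V_def)
        ultimately have "q = q'" using inj_onD[OF inj_on_chart[OF c(2)]] True by blast
        then show False using \<open>q' \<in> chart_inv c ` K\<close> \<open>q \<notin> chart_inv c ` K\<close> by simp
      qed
      then show ?thesis
        using chart_divergence_eq_0[OF c(2) compact_imp_closed[OF Kd(1)], of ?Z q g] Zd True by simp
    qed simp
    ultimately show ?thesis by simp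
  qed
  have Hnn: "0 \<le> ?H q" for q
  proof (cases "q \<in> chart_inv c ` K")
    case True
    then have "q \<in> V" using KM by auto
    moreover have "0 \<le> F q" by (simp add: F_def chart_lift_def \<phi>)
    ultimately show ?thesis using Hin[of q] by (simp add: V_def)
  next
    case False
    then show ?thesis using Fz[of q] Hin[of q] Hout[of q] by (cases "q \<in> ?O") auto
  qed
  have intH: "integrable (riemannian_volume A g) ?H" by (rule integrable_volume_continuous(2)[OF g contH])
  have "(LINT q|riemannian_volume A g. ?H q) = 0"
    using Gc(2) Gd(2) integrable_volume_continuous(2)[OF g Gc(1)] integrable_volume_continuous(2)[OF g Gd(1)]
    by (simp only: Bochner_Integration.integral_diff)
  \<comment> \<open>A nonnegative function with integral \<open>0\<close> vanishes almost
    everywhere. But \<open>?H\<close> is positive at \<open>p\<close>, hence on the open set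
    \<open>P\<close> below, whose volume is positive.\<close>
  then have AE: "AE q in riemannian_volume A g. ?H q = 0"
    using integral_nonneg_eq_0_iff_AE[OF intH] Hnn by simp
  define P where "P = ?H -` {0<..}"
  have P: "open P" unfolding P_def using contH by (intro open_vimage) auto
  have "F p = 1" using \<phi>(3)[of "snd c p"] r c by (simp add: F_def chart_lift_def)
  then have "p \<in> P" using Hin[of p] pV by (auto simp: P_def V_def)
  have "P \<in> null_sets (riemannian_volume A g)"
  proof (rule AE_iff_null_sets[THEN iffD2])
    show "P \<in> sets (riemannian_volume A g)" using open_manifold_sets[OF P] g by simp
    show "AE q in riemannian_volume A g. q \<notin> P"
      using AE by (rule eventually_mono) (simp only: P_def vimage_eq greaterThan_iff less_irrefl not_False_eq_True)
  qed
  then show False using emeasure_volume_open_pos[OF g P \<open>p \<in> P\<close>] by auto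
qed

text \<open>The inequality with the charts exchanged gives equality, in particular for the chart
  that \<open>SOME\<close> picks in \<open>divergence\<close>.\<close>

lemma divergence_eq_chart:
  assumes g: "riemannian_metric A g" and Y: "smooth_vector_field A Y" and c: "c \<in> A" "p \<in> fst c"
  shows "divergence A g Y p = chart_divergence g Y c p"
proof -
  let ?d = "SOME c. c \<in> A \<and> p \<in> fst c"
  have "?d \<in> A \<and> p \<in> fst ?d" by (rule someI[of _ c]) (use c in simp)
  then show ?thesis
    using chart_divergence_le[OF g Y c(1) _ c(2)] chart_divergence_le[OF g Y _ c(1) _ c(2)]
    unfolding divergence_def by (meson antisym)
qed

lemma divergence_continuous:
  assumes g: "riemannian_metric A g" and Y: "smooth_vector_field A Y"
  shows "continuous_on UNIV (divergence A g Y)"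
proof (rule continuous_on_UNIV_chartI)
  fix c assume c: "c \<in> A"
  show "continuous_on (fst c) (divergence A g Y)"
    by (rule continuous_on_eq[OF chart_divergence_continuous[OF g Y c]])
      (simp add: divergence_eq_chart[OF g Y c])
qed

end

context closed_manifold
begin

lemma closed_manifold_sets: "closed C \<Longrightarrow> C \<in> manifold_lebesgue_sets A"
proof -
  assume "closed C"
  interpret sigma_algebra UNIV "manifold_lebesgue_sets A" by (rule sigma_algebra_manifold_sets)
  have "UNIV - (- C) \<in> manifold_lebesgue_sets A"
    by (rule compl_sets) (rule open_manifold_sets, use \<open>closed C\<close> in \<open>simp add: open_Compl\<close>)
  then show ?thesis by (simp add: Diff_eq)
qed

lemma manifold_sets_Diff: "E \<in> manifold_lebesgue_sets A \<Longrightarrow> F \<in> manifold_lebesgue_sets A \<Longrightarrow>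
    E - F \<in> manifold_lebesgue_sets A"
  and manifold_sets_Un: "E \<in> manifold_lebesgue_sets A \<Longrightarrow> F \<in> manifold_lebesgue_sets A \<Longrightarrow>
    E \<union> F \<in> manifold_lebesgue_sets A"
proof -
  interpret sigma_algebra UNIV "manifold_lebesgue_sets A" by (rule sigma_algebra_manifold_sets)
  show "E \<in> manifold_lebesgue_sets A \<Longrightarrow> F \<in> manifold_lebesgue_sets A \<Longrightarrow> E - F \<in> manifold_lebesgue_sets A"
    by (rule Diff)
  show "E \<in> manifold_lebesgue_sets A \<Longrightarrow> F \<in> manifold_lebesgue_sets A \<Longrightarrow> E \<union> F \<in> manifold_lebesgue_sets A"
    by (rule Un)
qed

subsection \<open>Comparison of two metrics\<close>

definition density_ratio :: "('m, 'n) metric_field \<Rightarrow> ('m, 'n) metric_field \<Rightarrow> 'm \<Rightarrow> real" where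
  "density_ratio g g0 p =
     volume_density g (SOME c. c \<in> A \<and> p \<in> fst c) p / volume_density g0 (SOME c. c \<in> A \<and> p \<in> fst c) p"

context
  fixes g g0 assumes g: "riemannian_metric A g" and g0: "riemannian_metric A g0"
begin

text \<open>Both densities acquire the same Jacobian factor under a change of chart, and it cancels.
  The factor is nonzero because the densities are positive.\<close>

lemma density_ratio_chart:
  assumes c: "c \<in> A" "p \<in> fst c"
  shows "density_ratio g g0 p = volume_density g c p / volume_density g0 c p"
proof -
  let ?d = "SOME c. c \<in> A \<and> p \<in> fst c"
  have d: "?d \<in> A \<and> p \<in> fst ?d" by (rule someI[of _ c]) (use c in simp)
  then have "volume_density g c p =
      \<bar>det (matrix (frechet_derivative (transition c ?d) (at (snd c p))))\<bar> * volume_density g ?d p"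
    "volume_density g0 c p =
      \<bar>det (matrix (frechet_derivative (transition c ?d) (at (snd c p))))\<bar> * volume_density g0 ?d p"
    using volume_density_transition[OF g c(1) _ c(2)] volume_density_transition[OF g0 c(1) _ c(2)] by blast+
  moreover from this have "det (matrix (frechet_derivative (transition c ?d) (at (snd c p)))) \<noteq> 0"
    using volume_density_pos[OF g c] by auto
  ultimately show ?thesis unfolding density_ratio_def by simp
qed

lemma density_ratio_pos: "0 < density_ratio g g0 p"
proof -
  obtain c where c: "c \<in> A" "p \<in> fst c" using ex_chart by blast
  then show ?thesis
    using volume_density_pos[OF g c] volume_density_pos[OF g0 c] by (simp add: density_ratio_chart)
qed

lemma smooth_fun_density_ratio: "smooth_fun (density_ratio g g0)"
  unfolding smooth_fun_def
proof
  fix c assume c: "c \<in> A"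
  have "smooth_on (chart_image c)
      (\<lambda>x. volume_density g c (chart_inv c x) * inverse (volume_density g0 c (chart_inv c x)))"
    by (intro smooth_on_mult smooth_on_inverse volume_density_smooth[OF g c] volume_density_smooth[OF g0 c]
        open_chart(2)[OF c] volume_density_pos[OF g0 c] chart_inv_in[OF c])
  then show "smooth_on (chart_image c) (\<lambda>x. density_ratio g g0 (chart_inv c x))"
    by (rule smooth_on_cong[OF open_chart(2)[OF c]])
      (simp add: density_ratio_chart[OF c chart_inv_in[OF c]] divide_inverse)
qed

text \<open>By uniqueness it suffices to test sets inside one chart, where the ratio converts one
  density into the other.\<close>

lemma riemannian_volume_density:
  "riemannian_volume A g = density (riemannian_volume A g0) (\<lambda>p. ennreal (density_ratio g g0 p))"
proof (rule is_volume_unique[OF is_volume_riemannian_volume[OF g]])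
  let ?\<rho> = "\<lambda>p. ennreal (density_ratio g g0 p)"
  have m: "?\<rho> \<in> borel_measurable (riemannian_volume A g0)"
    using integrable_volume_continuous(1)[OF g0 smooth_fun_continuous[OF smooth_fun_density_ratio]] by simp
  show "is_volume g (density (riemannian_volume A g0) ?\<rho>)"
    unfolding is_volume_def
  proof (intro conjI ballI impI)
    fix c E assume c: "c \<in> A" and E: "E \<in> sets (density (riemannian_volume A g0) ?\<rho>)" "E \<subseteq> fst c"
    have E': "E \<in> sets (riemannian_volume A g0)" using E by simp
    have mE: "(\<lambda>p. ?\<rho> p * indicator E p) \<in> borel_measurable (riemannian_volume A g0)"
      by (intro borel_measurable_times_ennreal m borel_measurable_indicator E')
    have "emeasure (density (riemannian_volume A g0) ?\<rho>) E =
        (\<integral>\<^sup>+p. ?\<rho> p * indicator E p \<partial>riemannian_volume A g0)"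
      by (rule emeasure_density[OF m E'])
    also have "(\<integral>\<^sup>+p. ?\<rho> p * indicator E p \<partial>riemannian_volume A g0) =
       (\<integral>\<^sup>+x. ennreal (indicator (chart_image c) x * volume_density g0 c (chart_inv c x)) *
        (?\<rho> (chart_inv c x) * indicator E (chart_inv c x)) \<partial>lebesgue)"
      by (rule nn_integral_volume_chart[OF g0 c mE]) (use E(2) in \<open>auto simp: indicator_def\<close>)
    also have "\<dots> = (\<integral>\<^sup>+x\<in>snd c ` E. ennreal (volume_density g c (chart_inv c x)) \<partial>lebesgue)"
    proof (rule nn_integral_cong)
      fix x
      show "ennreal (indicator (chart_image c) x * volume_density g0 c (chart_inv c x)) *
          (?\<rho> (chart_inv c x) * indicator E (chart_inv c x)) =
        ennreal (volume_density g c (chart_inv c x)) * indicator (snd c ` E) x"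
      proof (cases "x \<in> chart_image c")
        case True
        have "x \<in> snd c ` E \<longleftrightarrow> chart_inv c x \<in> E"
          using chart_image_eq_vimage[OF c E(2)] True by auto
        moreover have "volume_density g0 c (chart_inv c x) * density_ratio g g0 (chart_inv c x) =
            volume_density g c (chart_inv c x)"
          using volume_density_pos[OF g0 c chart_inv_in[OF c True]]
          by (simp add: density_ratio_chart[OF c chart_inv_in[OF c True]])
        then have "ennreal (volume_density g0 c (chart_inv c x)) * ?\<rho> (chart_inv c x) =
            ennreal (volume_density g c (chart_inv c x))"
          using volume_density_pos[OF g0 c chart_inv_in[OF c True]]
          by (simp add: ennreal_mult'[symmetric])
        ultimately show ?thesis using True by (simp add: indicator_def)
      next
        case False
        then have "x \<notin> snd c ` E" using E(2) by auto
        then show ?thesis using False by simp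
      qed
    qed
    finally show "emeasure (density (riemannian_volume A g0) ?\<rho>) E =
      (\<integral>\<^sup>+x\<in>snd c ` E. ennreal (volume_density g c (chart_inv c x)) \<partial>lebesgue)" .
  qed (use g0 in auto)
qed

text \<open>The ratio times the density of \<open>g0\<close> is the density of \<open>g\<close>, so
  the expression under the derivatives is that of \<open>g\<close> up to the factor
  \<open>1 / k\<close>; only the density in the denominator differs. No derivative of the ratio is
  left over.\<close>

lemma chart_divergence_density:
  assumes Y: "smooth_vector_field A Y" and c: "c \<in> A" "p \<in> fst c" and k: "k \<noteq> 0"
  shows "chart_divergence g0 (\<lambda>c p. (density_ratio g g0 p / k) *\<^sub>R Y c p) c p =
    density_ratio g g0 p / k * chart_divergence g Y c p"
proof -
  let ?w = "\<lambda>x. volume_density g c (chart_inv c x)" and ?v = "\<lambda>x. volume_density g0 c (chart_inv c x)"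
  have x: "snd c p \<in> chart_image c" using c by auto
  have "frechet_derivative (\<lambda>x. ?v x * ((density_ratio g g0 (chart_inv c x) / k) *\<^sub>R Y c (chart_inv c x)) $ i) (at (snd c p))
     = (\<lambda>v. frechet_derivative (\<lambda>x. ?w x * Y c (chart_inv c x) $ i) (at (snd c p)) v / k)" for i
  proof -
    have "frechet_derivative (\<lambda>x. ?v x * ((density_ratio g g0 (chart_inv c x) / k) *\<^sub>R Y c (chart_inv c x)) $ i) (at (snd c p))
       = frechet_derivative (\<lambda>x. ?w x * Y c (chart_inv c x) $ i / k) (at (snd c p))"
    proof (rule frechet_derivative_cong_open[OF open_chart(2)[OF c(1)] x])
      fix x assume "x \<in> chart_image c"
      then have x: "chart_inv c x \<in> fst c" by (rule chart_inv_in[OF c(1)])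
      have "?v x \<noteq> 0" using volume_density_pos[OF g0 c(1) x] by simp
      then have "?v x * density_ratio g g0 (chart_inv c x) = ?w x"
        by (simp add: density_ratio_chart[OF c(1) x])
      then show "?v x * ((density_ratio g g0 (chart_inv c x) / k) *\<^sub>R Y c (chart_inv c x)) $ i =
          ?w x * Y c (chart_inv c x) $ i / k"
        by (simp add: mult.assoc[symmetric])
    qed
    also have "\<dots> = (\<lambda>v. frechet_derivative (\<lambda>x. ?w x * Y c (chart_inv c x) $ i) (at (snd c p)) v / k)"
      by (rule frechet_derivative_eqI, rule bounded_linear.has_derivative[OF bounded_linear_divide])
        (rule smooth_on_has_derivative[OF smooth_density_field[OF g Y c(1)] x])
    finally show ?thesis .
  qed
  then show ?thesis
    using volume_density_pos[OF g c] volume_density_pos[OF g0 c] k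
    by (simp add: chart_divergence_def density_ratio_chart[OF c] sum_divide_distrib[symmetric] field_simps)
qed

end

lemma compact_vector_field_support: "compact (vector_field_support A Y)"
  unfolding vector_field_support_def
  using compact_Int_closed[OF compact_M closed_closure] by simp

definition unit_fields :: "('m, 'n) metric_field \<Rightarrow> ('m, 'n) vec_field set" where
  "unit_fields g = {Y. smooth_vector_field A Y \<and> (\<forall>c\<in>A. \<forall>p\<in>fst c. sqrt (g c p (Y c p) (Y c p)) \<le> 1)}"

lemma perimeter_unit_fields:
  "perimeter A g E = (SUP Y \<in> unit_fields g. ereal (LINT p:E|riemannian_volume A g. divergence A g Y p))"
  by (simp add: perimeter_def unit_fields_def compact_vector_field_support)

lemma perimeter_upper: "Y \<in> unit_fields g \<Longrightarrow>
    ereal (LINT p:E|riemannian_volume A g. divergence A g Y p) \<le> perimeter A g E"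
  unfolding perimeter_unit_fields by (rule SUP_upper)

lemma metric_scale:
  assumes "riemannian_metric A g" "c \<in> A" "p \<in> fst c"
  shows "sqrt (g c p (k *\<^sub>R v) (k *\<^sub>R v)) = \<bar>k\<bar> * sqrt (g c p v v)"
proof -
  have "bilinear (g c p)" using metric_inner_form[OF assms] by (simp add: inner_form_def)
  then show ?thesis
    by (simp add: bilinear_lmul bilinear_rmul mult.assoc[symmetric] real_sqrt_mult)
qed

lemma unit_fields_scale:
  assumes g: "riemannian_metric A g" and Y: "Y \<in> unit_fields g" and f: "smooth_fun f" "\<And>p. \<bar>f p\<bar> \<le> 1"
  shows "(\<lambda>c p. f p *\<^sub>R Y c p) \<in> unit_fields g"
proof -
  have "sqrt (g c p (f p *\<^sub>R Y c p) (f p *\<^sub>R Y c p)) \<le> 1" if "c \<in> A" "p \<in> fst c" for c p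
    using mult_mono[of "\<bar>f p\<bar>" 1 "sqrt (g c p (Y c p) (Y c p))" 1] Y f(2)[of p] that
      metric_inner_form[OF g that]
    by (cases "Y c p = 0") (auto simp: metric_scale[OF g that] unit_fields_def inner_form_def less_imp_le bilinear_lzero)
  then show ?thesis using smooth_vector_field_scale[OF _ f(1)] Y by (simp add: unit_fields_def)
qed

text \<open>The factor \<open>density_ratio\<close> in the divergence of the rescaled field is the
  one that converts the volume of \<open>g0\<close> into that of \<open>g\<close>.\<close>

lemma set_integral_divergence_density:
  assumes g: "riemannian_metric A g" and g0: "riemannian_metric A g0"
    and Y: "smooth_vector_field A Y" and E: "E \<in> manifold_lebesgue_sets A" and k: "k \<noteq> 0"
  shows "(LINT p:E|riemannian_volume A g0. divergence A g0 (\<lambda>c p. (density_ratio g g0 p / k) *\<^sub>R Y c p) p) =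
    (LINT p:E|riemannian_volume A g. divergence A g Y p) / k"
proof -
  let ?\<rho> = "density_ratio g g0"
  have sm: "smooth_fun (\<lambda>p. ?\<rho> p / k)"
    unfolding smooth_fun_def divide_inverse
    using smooth_funD[OF smooth_fun_density_ratio[OF g g0]] open_chart(2)
    by (intro ballI smooth_on_mult smooth_on_const) auto
  have div: "divergence A g0 (\<lambda>c p. (?\<rho> p / k) *\<^sub>R Y c p) p = ?\<rho> p / k * divergence A g Y p" for p
  proof -
    obtain c where c: "c \<in> A" "p \<in> fst c" using ex_chart by blast
    show ?thesis
      using divergence_eq_chart[OF g0 smooth_vector_field_scale[OF Y sm] c] divergence_eq_chart[OF g Y c]
        chart_divergence_density[OF g g0 Y c k] by simp
  qed
  have m: "(\<lambda>p. indicator E p *\<^sub>R divergence A g Y p) \<in> borel_measurable (riemannian_volume A g0)"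
    by (intro borel_measurable_scaleR borel_measurable_indicator
        integrable_volume_continuous(1)[OF g0 divergence_continuous[OF g Y]]) (use E g0 in simp)
  have "(LINT p|riemannian_volume A g. indicator E p *\<^sub>R divergence A g Y p) =
      (LINT p|riemannian_volume A g0. ?\<rho> p *\<^sub>R (indicator E p *\<^sub>R divergence A g Y p))"
    unfolding riemannian_volume_density[OF g g0]
    by (rule integral_density[OF m])
      (use integrable_volume_continuous(1)[OF g0 smooth_fun_continuous[OF smooth_fun_density_ratio[OF g g0]]]
        density_ratio_pos[OF g g0] in \<open>auto intro: less_imp_le\<close>)
  then show ?thesis
    unfolding set_lebesgue_integral_def div
    by (simp add: mult_ac flip: Bochner_Integration.integral_divide_zero)
qed

text \<open>A test field \<open>Y\<close> for \<open>g\<close> is replaced by \<open>Z\<close>,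
  which is \<open>Y\<close> times the density ratio divided by \<open>k\<close>. By
  \<open>le\<close> the \<open>g0\<close>-length of \<open>Z\<close> is at most the
  \<open>g\<close>-length of \<open>Y\<close>, so \<open>Z\<close> is admissible for
  \<open>g0\<close>, and its integral is that of \<open>Y\<close> divided by
  \<open>k\<close>.\<close>

lemma perimeter_le:
  assumes g: "riemannian_metric A g" and g0: "riemannian_metric A g0" and k: "0 < k"
    and E: "E \<in> manifold_lebesgue_sets A"
    and le: "\<And>c p v. c \<in> A \<Longrightarrow> p \<in> fst c \<Longrightarrow>
      density_ratio g g0 p * sqrt (g0 c p v v) \<le> k * sqrt (g c p v v)"
  shows "perimeter A g E \<le> ereal k * perimeter A g0 E"
  unfolding perimeter_unit_fields[of g]
proof (rule SUP_least)
  fix Y assume Y: "Y \<in> unit_fields g"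
  let ?\<rho> = "density_ratio g g0"
  let ?Z = "\<lambda>c p. (?\<rho> p / k) *\<^sub>R Y c p"
  have sm: "smooth_fun (\<lambda>p. ?\<rho> p / k)"
    unfolding smooth_fun_def divide_inverse
    using smooth_funD[OF smooth_fun_density_ratio[OF g g0]] open_chart(2)
    by (intro ballI smooth_on_mult smooth_on_const) auto
  have sY: "smooth_vector_field A Y" using Y by (simp add: unit_fields_def)
  have "sqrt (g0 c p (?Z c p) (?Z c p)) \<le> 1" if c: "c \<in> A" "p \<in> fst c" for c p
  proof -
    have "sqrt (g0 c p (?Z c p) (?Z c p)) = ?\<rho> p * sqrt (g0 c p (Y c p) (Y c p)) / k"
      using k density_ratio_pos[OF g g0, of p] by (simp add: metric_scale[OF g0 c])
    also have "\<dots> \<le> k * sqrt (g c p (Y c p) (Y c p)) / k"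
      using le[OF c] k by (intro divide_right_mono) auto
    also have "\<dots> \<le> 1" using Y c k by (simp add: unit_fields_def)
    finally show ?thesis .
  qed
  then have "?Z \<in> unit_fields g0"
    using smooth_vector_field_scale[OF sY sm] by (simp add: unit_fields_def)
  from perimeter_upper[OF this, of E]
  have "ereal ((LINT p:E|riemannian_volume A g. divergence A g Y p) / k) \<le> perimeter A g0 E"
    using set_integral_divergence_density[OF g g0 sY E] k by simp
  then have "ereal k * ereal ((LINT p:E|riemannian_volume A g. divergence A g Y p) / k) \<le> ereal k * perimeter A g0 E"
    using k by (intro ereal_mult_left_mono) auto
  then show "ereal (LINT p:E|riemannian_volume A g. divergence A g Y p) \<le> ereal k * perimeter A g0 E"
    using k by simp
qed

text \<open>The zero field is admissible and contributes \<open>0\<close> to the supremum.\<close>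

lemma perimeter_nonneg:
  assumes g: "riemannian_metric A g" shows "0 \<le> perimeter A g E"
proof -
  let ?O = "\<lambda>c p. 0 :: real ^ 'n"
  have "0 = frechet_derivative (transition c d) (at (snd c p)) 0"
    if "c \<in> A" "d \<in> A" "p \<in> fst c" "p \<in> fst d" for c d p
    using linear_0[OF has_derivative_linear[OF transition_has_derivative[OF that]]] by simp
  then have s: "smooth_vector_field A ?O" by (simp add: smooth_vector_field_def)
  have "sqrt (g c p 0 0) \<le> 1" if "c \<in> A" "p \<in> fst c" for c p
    using metric_scale[OF g that, of 0 0] by simp
  then have "?O \<in> unit_fields g" using s by (simp add: unit_fields_def)
  moreover have "divergence A g ?O p = 0" for p
  proof -
    obtain c where c: "c \<in> A" "p \<in> fst c" using ex_chart by blast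
    then show ?thesis
      using divergence_eq_chart[OF g s c] chart_divergence_eq_0[of c "{}" ?O p g] by simp
  qed
  ultimately show ?thesis
    using perimeter_upper[of ?O g E] by (simp add: set_lebesgue_integral_def zero_ereal_def)
qed

subsection \<open>Adding and removing coordinate balls\<close>

text \<open>The squared \<open>g\<close>-length attains a positive minimum \<open>m\<close> on the
  compact product of \<open>K\<close> with the unit sphere, and homogeneity extends the bound to all
  vectors with \<open>L = 1 / sqrt m\<close>.\<close>

lemma metric_lower_bound:
  assumes g: "riemannian_metric A g" and c: "c \<in> A" and K: "compact K" "K \<subseteq> chart_image c"
  obtains L where "0 < L" "\<And>x v. x \<in> K \<Longrightarrow> norm v \<le> L * sqrt (g c (chart_inv c x) v v)"
proof (cases "K = {}")
  case True
  then show thesis using that[of 1] by simp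
next
  case False
  let ?S = "sphere (0 :: real ^ 'n) 1"
  let ?q = "\<lambda>z. g c (chart_inv c (fst z)) (snd z) (snd z)"
  have form: "inner_form (g c (chart_inv c x))" if "x \<in> K" for x
    using metric_inner_form[OF g c chart_inv_in[OF c]] K(2) that by blast
  have comp: "compact (K \<times> ?S)" by (intro compact_Times K(1) compact_sphere)
  have "axis undefined 1 \<in> ?S" by simp
  then have ne: "K \<times> ?S \<noteq> {}" using False by blast
  have entry: "continuous_on K (\<lambda>x. gram (g c (chart_inv c x)) $ i $ j)" for i j
  proof -
    have "smooth_on (chart_image c) (\<lambda>x. g c (chart_inv c x) u v)" for u v
      using g c unfolding riemannian_metric_def by blast
    from continuous_on_subset[OF smooth_on_continuous_on[OF this] K(2)]
    show ?thesis by (simp add: gram_def)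
  qed
  \<comment> \<open>A metric is smooth in the point for fixed pairs of vectors; the expansion
    through the Gram matrix gives continuity jointly in point and vector.\<close>
  have "continuous_on (K \<times> ?S) (\<lambda>z. \<Sum>i\<in>UNIV. snd z $ i * (\<Sum>j\<in>UNIV. gram (g c (chart_inv c (fst z))) $ i $ j * snd z $ j))"
    by (intro continuous_intros continuous_on_compose2[OF entry]) auto
  then have "continuous_on (K \<times> ?S) ?q"
  proof (rule continuous_on_eq)
    fix z assume "z \<in> K \<times> ?S"
    then have "bilinear (g c (chart_inv c (fst z)))" using form[of "fst z"] by (auto simp: inner_form_def)
    from bilinear_eq_gram[OF this, of "snd z" "snd z"]
    show "(\<Sum>i\<in>UNIV. snd z $ i * (\<Sum>j\<in>UNIV. gram (g c (chart_inv c (fst z))) $ i $ j * snd z $ j)) = ?q z"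
      by (simp add: inner_vec_def matrix_vector_mult_def)
  qed
  then obtain z0 where z0: "z0 \<in> K \<times> ?S" "\<And>z. z \<in> K \<times> ?S \<Longrightarrow> ?q z0 \<le> ?q z"
    using continuous_attains_inf[OF comp ne, of ?q] by blast
  define m where "m = ?q z0"
  have "snd z0 \<noteq> 0" using z0(1) by auto
  then have m: "0 < m" using form[of "fst z0"] z0(1) by (auto simp: m_def inner_form_def)
  show thesis
  proof (rule that[of "1 / sqrt m"])
    show "0 < 1 / sqrt m" using m by simp
    fix x v assume x: "x \<in> K"
    show "norm v \<le> 1 / sqrt m * sqrt (g c (chart_inv c x) v v)"
    proof (cases "v = 0")
      case True
      then show ?thesis
        using form[OF x] by (simp add: inner_form_def bilinear_lzero)
    next
      case False
      let ?u = "(1 / norm v) *\<^sub>R v"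
      have "m \<le> g c (chart_inv c x) ?u ?u"
        unfolding m_def using z0(2)[of "(x, ?u)"] x False by simp
      then have "sqrt m \<le> sqrt (g c (chart_inv c x) ?u ?u)" by simp
      also have "\<dots> = sqrt (g c (chart_inv c x) v v) / norm v"
        using metric_scale[OF g c chart_inv_in[OF c], of x "1 / norm v" v] x K(2) by auto
      finally show ?thesis using m False by (simp add: field_simps)
    qed
  qed
qed

context
  fixes g c a r C W L and s :: real and \<phi> :: "nat \<Rightarrow> real ^ 'n \<Rightarrow> real" and G S
  assumes g: "riemannian_metric A g" and c: "c \<in> A" and r: "0 < r" "cball a (2 * r) \<subseteq> chart_image c"
    and s: "0 \<le> s" "s \<le> r" and cut: "cutoff_family C a s r \<phi> G S"
    and W: "0 \<le> W" "\<And>x. x \<in> cball a (2 * r) \<Longrightarrow> volume_density g c (chart_inv c x) \<le> W"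
    and L: "0 < L" "\<And>x v. x \<in> cball a (2 * r) \<Longrightarrow> norm v \<le> L * sqrt (g c (chart_inv c x) v v)"
begin

lemma cutoff_facts:
  "smooth_on UNIV (\<phi> m)" "0 \<le> \<phi> m x" "\<phi> m x \<le> 1" "x \<notin> cball a (2 * r) \<Longrightarrow> \<phi> m x = 0"
  "S m \<in> sets lborel" "S m \<subseteq> cball a (2 * r)" "0 \<le> G m"
  "\<bar>frechet_derivative (\<phi> m) (at x) v\<bar> \<le> G m * norm v * indicator (S m) x"
  "G m * measure lborel (S m) \<le> C * r ^ (CARD('n) - 1)"
  "(\<lambda>m. \<phi> m x) \<longlonglongrightarrow> indicator (cball a s) x"
  using cut unfolding cutoff_family_def by blast+

lemma smooth_fun_cutoff: "smooth_fun (chart_lift c (\<phi> m))"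
  by (rule smooth_fun_chart_lift[OF c cutoff_facts(1) compact_cball r(2) cutoff_facts(4)])

lemma smooth_fun_cutoff': "smooth_fun (\<lambda>p. 1 - chart_lift c (\<phi> m) p)"
  using smooth_fun_cutoff[of m] open_chart(2) unfolding smooth_fun_def by (intro ballI smooth_on_diff) auto

lemma chart_lift_bounds: "0 \<le> chart_lift c (\<phi> m) p" "chart_lift c (\<phi> m) p \<le> 1"
  by (auto simp: chart_lift_def cutoff_facts)

lemma chart_lift_tendsto: "(\<lambda>m. chart_lift c (\<phi> m) p) \<longlonglongrightarrow> indicator (chart_inv c ` cball a s) p"
proof -
  have sub: "cball a s \<subseteq> chart_image c" 
    by (rule order_trans[OF subset_cball r(2)]) (use r(1) s in linarith)
  show ?thesis
  proof (cases "p \<in> fst c")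
    case True
    have "p \<in> chart_inv c ` cball a s \<longleftrightarrow> snd c p \<in> cball a s"
    proof
      assume "p \<in> chart_inv c ` cball a s"
      then obtain x where x: "x \<in> cball a s" "p = chart_inv c x" by blast
      then show "snd c p \<in> cball a s" using chart_inv_right[OF c] sub by auto
    next
      assume "snd c p \<in> cball a s"
      then show "p \<in> chart_inv c ` cball a s" using chart_inv_left[OF c True] by (metis imageI)
    qed
    then have "(indicator (chart_inv c ` cball a s) p :: real) = indicator (cball a s) (snd c p)"
      by (simp add: indicator_def)
    then show ?thesis using cutoff_facts(10)[of "snd c p"] True by (simp add: chart_lift_def)
  next
    case False
    then have "p \<notin> chart_inv c ` cball a s" using sub chart_inv_in[OF c] by blast
    then show ?thesis using False by (simp add: chart_lift_def)
  qed
qed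

text \<open>The derivative of the cutoff along \<open>Y\<close>, as
  \<open>cutoff_error_chart\<close> shows. Written as a difference of divergences it refers to no
  auxiliary chart, and its continuity is immediate.\<close>

definition cutoff_error :: "('m, 'n) vec_field \<Rightarrow> nat \<Rightarrow> 'm \<Rightarrow> real" where
  "cutoff_error Y m p = divergence A g (\<lambda>c' p. chart_lift c (\<phi> m) p *\<^sub>R Y c' p) p -
     chart_lift c (\<phi> m) p * divergence A g Y p"

lemma cutoff_error_chart:
  assumes Y: "smooth_vector_field A Y" and d: "d \<in> A" "p \<in> fst d"
  shows "cutoff_error Y m p = chart_diff (chart_lift c (\<phi> m)) d p (Y d p)"
  unfolding cutoff_error_def
  using divergence_eq_chart[OF g Y d] divergence_eq_chart[OF g smooth_vector_field_scale[OF Y smooth_fun_cutoff] d]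
    chart_divergence_scale[OF g Y smooth_fun_cutoff d] by simp

lemma divergence_cutoff':
  assumes Y: "smooth_vector_field A Y"
  shows "divergence A g (\<lambda>c' p. (1 - chart_lift c (\<phi> m) p) *\<^sub>R Y c' p) p =
    (1 - chart_lift c (\<phi> m) p) * divergence A g Y p - cutoff_error Y m p"
proof -
  obtain d where d: "d \<in> A" "p \<in> fst d" using ex_chart by blast
  let ?F = "chart_lift c (\<phi> m)"
  have x: "snd d p \<in> chart_image d" using d by auto
  have "((\<lambda>x. 1 - ?F (chart_inv d x)) has_derivative (\<lambda>v. 0 - chart_diff ?F d p v)) (at (snd d p))"
    unfolding chart_diff_def
    by (intro has_derivative_diff has_derivative_const smooth_on_has_derivative[OF smooth_funD[OF smooth_fun_cutoff d(1)] x])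
  from frechet_derivative_eqI[OF this]
  have "chart_diff (\<lambda>p. 1 - ?F p) d p (Y d p) = - chart_diff ?F d p (Y d p)"
    by (simp add: chart_diff_def)
  then show ?thesis
    using divergence_eq_chart[OF g Y d] divergence_eq_chart[OF g smooth_vector_field_scale[OF Y smooth_fun_cutoff'] d]
      chart_divergence_scale[OF g Y smooth_fun_cutoff' d] cutoff_error_chart[OF Y d] by simp
qed

lemma cutoff_error_continuous:
  assumes Y: "smooth_vector_field A Y" shows "continuous_on UNIV (cutoff_error Y m)"
  unfolding cutoff_error_def
  by (intro continuous_on_diff continuous_on_mult divergence_continuous[OF g] smooth_vector_field_scale[OF Y]
      smooth_fun_cutoff smooth_fun_continuous Y)

text \<open>In the chart the error is at most \<open>G m * L\<close> on \<open>S m\<close> and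
  \<open>0\<close> elsewhere. The density contributes at most \<open>W\<close>, and
  \<open>cutoff_family\<close> bounds \<open>G m\<close> times the measure of \<open>S m\<close>.
  The result depends neither on \<open>m\<close> nor on \<open>Y\<close>.\<close>

lemma cutoff_error_integral:
  assumes Y: "Y \<in> unit_fields g"
  shows "(LINT p|riemannian_volume A g. \<bar>cutoff_error Y m p\<bar>) \<le> W * L * C * r ^ (CARD('n) - 1)"
proof -
  let ?F = "chart_lift c (\<phi> m)" and ?w = "\<lambda>x. volume_density g c (chart_inv c x)"
  let ?K = "cball a (2 * r)"
  have sY: "smooth_vector_field A Y" using Y by (simp add: unit_fields_def)
  have out: "cutoff_error Y m p = 0" if p: "p \<notin> fst c" for p
  proof -
    obtain d where d: "d \<in> A" "p \<in> fst d" using ex_chart by blast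
    let ?O = "snd d ` (fst d - chart_inv c ` ?K)"
    have O: "open ?O"
      by (rule open_chart_image[OF d(1) open_Diff[OF open_chart(1)[OF d(1)] compact_chart_inv_image(2)[OF c compact_cball r(2)]]]) auto
    have "p \<notin> chart_inv c ` ?K" using p r(2) chart_inv_in[OF c] by blast
    then have pO: "snd d p \<in> ?O" using d by auto
    have "frechet_derivative (\<lambda>x. ?F (chart_inv d x)) (at (snd d p)) = frechet_derivative (\<lambda>_. 0) (at (snd d p))"
    proof (rule frechet_derivative_cong_open[OF O pO])
      fix y assume "y \<in> ?O"
      then obtain q where q: "y = snd d q" "q \<in> fst d" "q \<notin> chart_inv c ` ?K" by blast
      have "?F q = 0"
      proof (cases "q \<in> fst c")
        case True
        then have "snd c q \<notin> ?K" using q(3) chart_inv_left[OF c True] by (metis imageI)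
        then show ?thesis by (simp add: chart_lift_def cutoff_facts(4))
      qed (simp add: chart_lift_def)
      then show "?F (chart_inv d y) = 0" using q chart_inv_left[OF d(1)] by simp
    qed
    also have "\<dots> = (\<lambda>_. 0)" by (rule frechet_derivative_eqI) simp
    finally show ?thesis using cutoff_error_chart[OF sY d] by (simp add: chart_diff_def)
  qed
  have ins: "\<bar>cutoff_error Y m (chart_inv c x)\<bar> \<le> G m * L * indicator (S m) x" if x: "x \<in> chart_image c" for x
  proof -
    let ?p = "chart_inv c x"
    have p: "?p \<in> fst c" "snd c ?p = x" using x chart_inv_in[OF c] chart_inv_right[OF c] by auto
    have "frechet_derivative (\<lambda>y. ?F (chart_inv c y)) (at x) = frechet_derivative (\<phi> m) (at x)"
      by (rule frechet_derivative_cong_open[OF open_chart(2)[OF c] x])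
        (simp add: chart_lift_def chart_inv_in[OF c] chart_inv_right[OF c])
    then have "cutoff_error Y m ?p = frechet_derivative (\<phi> m) (at x) (Y c ?p)"
      using cutoff_error_chart[OF sY c p(1)] p(2) by (simp add: chart_diff_def)
    then have *: "\<bar>cutoff_error Y m ?p\<bar> \<le> G m * norm (Y c ?p) * indicator (S m) x"
      using cutoff_facts(8) by simp
    show ?thesis
    proof (cases "x \<in> S m")
      case True
      then have "norm (Y c ?p) \<le> L * sqrt (g c ?p (Y c ?p) (Y c ?p))" using cutoff_facts(6) L(2) by blast
      also have "\<dots> \<le> L * 1" using Y c p L(1) by (intro mult_left_mono) (auto simp: unit_fields_def)
      finally have "G m * norm (Y c ?p) \<le> G m * L" using cutoff_facts(7)[of m] by (simp add: mult_left_mono)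
      then show ?thesis using * True by simp
    qed (use * in simp)
  qed
  have fin: "emeasure lborel (S m) < \<infinity>"
    using emeasure_mono[OF cutoff_facts(6), of lborel m] emeasure_lborel_cball_finite[of a "2 * r"]
    by (simp add: le_less_trans)
  have Sl: "S m \<in> sets lebesgue" using cutoff_facts(5) by simp
  have "(LINT p|riemannian_volume A g. \<bar>cutoff_error Y m p\<bar>) =
     (LINT x|lebesgue. indicator (chart_image c) x * ?w x * \<bar>cutoff_error Y m (chart_inv c x)\<bar>)"
    by (rule integral_volume_chart[OF g c])
      (use integrable_volume_continuous(1)[OF g cutoff_error_continuous[OF sY]] out in auto)
  also have "\<dots> \<le> (LINT x|lebesgue. W * (G m * L) * indicator (S m) x)"
  proof (rule integral_mono')
    show "integrable lebesgue (\<lambda>x. W * (G m * L) * indicator (S m) x)"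
      by (intro integrable_mult_right integrable_real_indicator Sl) (use fin cutoff_facts(5) in simp)
    show "0 \<le> W * (G m * L) * indicator (S m) x" for x
      using W(1) L(1) cutoff_facts(7)[of m] by simp
    show "indicator (chart_image c) x * ?w x * \<bar>cutoff_error Y m (chart_inv c x)\<bar> \<le> W * (G m * L) * indicator (S m) x" for x
    proof (cases "x \<in> S m")
      case True
      then have x: "x \<in> ?K" "x \<in> chart_image c" using cutoff_facts(6) r(2) by blast+
      have "?w x * \<bar>cutoff_error Y m (chart_inv c x)\<bar> \<le> W * (G m * L)"
        using ins[OF x(2)] True W(1) W(2)[OF x(1)] by (intro mult_mono) auto
      then show ?thesis using True x by simp
    next
      case False
      then show ?thesis using ins[of x] by (auto simp: indicator_def)
    qed
  qed
  also have "\<dots> = W * L * (G m * measure lborel (S m))"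
    using cutoff_facts(5)[of m] by (simp add: mult_ac)
  also have "\<dots> \<le> W * L * (C * r ^ (CARD('n) - 1))"
    using W(1) L(1) cutoff_facts(9) by (intro mult_left_mono) auto
  finally show ?thesis by (simp add: mult_ac)
qed

text \<open>The field is supported in the single chart \<open>c\<close>, so
  \<open>integral_chart_divergence_eq_0\<close> applies. At a point outside \<open>c\<close> the
  divergence is read off in another chart, where the field vanishes nearby.\<close>

lemma integral_cutoff_divergence_eq_0:
  assumes Y: "smooth_vector_field A Y"
  shows "(LINT p|riemannian_volume A g. divergence A g (\<lambda>c' p. chart_lift c (\<phi> m) p *\<^sub>R Y c' p) p) = 0"
proof -
  let ?Z = "\<lambda>c' p. chart_lift c (\<phi> m) p *\<^sub>R Y c' p"
  have Z: "smooth_vector_field A ?Z" by (rule smooth_vector_field_scale[OF Y smooth_fun_cutoff])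
  have Z0: "?Z c p = 0" if "p \<in> fst c" "snd c p \<notin> cball a (2 * r)" for p
    using that by (simp add: chart_lift_def cutoff_facts(4))
  have "divergence A g ?Z p = (if p \<in> fst c then chart_divergence g ?Z c p else 0)" for p
  proof (cases "p \<in> fst c")
    case False
    obtain d where d: "d \<in> A" "p \<in> fst d" using ex_chart by blast
    let ?K = "snd d ` (fst d \<inter> chart_inv c ` cball a (2 * r))"
    let ?O = "snd d ` (fst d - chart_inv c ` cball a (2 * r))"
    have O: "open ?O"
      by (rule open_chart_image[OF d(1) open_Diff[OF open_chart(1)[OF d(1)] compact_chart_inv_image(2)[OF c compact_cball r(2)]]]) auto
    have nz: "p \<notin> chart_inv c ` cball a (2 * r)" using False r(2) chart_inv_in[OF c] by blast
    have "?Z d q = 0" if "q \<in> fst d" "snd d q \<notin> - ?O" for q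
    proof -
      from that obtain q' where q': "q' \<in> fst d" "q' \<notin> chart_inv c ` cball a (2 * r)" "snd d q = snd d q'" by blast
      then have "q = q'" using inj_onD[OF inj_on_chart[OF d(1)]] that by blast
      then have "snd c q \<notin> cball a (2 * r)" if "q \<in> fst c" using q'(2) chart_inv_left[OF c that] by (metis imageI)
      then show ?thesis by (simp add: chart_lift_def cutoff_facts(4))
    qed
    then have "chart_divergence g ?Z d p = 0"
      using chart_divergence_eq_0[OF d(1), of "- ?O" ?Z p g] O d nz by (simp add: closed_Compl)
    then show ?thesis using False divergence_eq_chart[OF g Z d] by simp
  qed (simp add: divergence_eq_chart[OF g Z c])
  then show ?thesis
    using integral_chart_divergence_eq_0(2)[OF g Z c compact_cball r(2) Z0] by simp
qed

text \<open>With \<open>F\<close> the lifted cutoff and \<open>B\<close> the ball, the indicator of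
  \<open>E - B\<close> is the limit of \<open>1_E * (1 - F)\<close>, and that of
  \<open>E \<union> B\<close> the limit of \<open>1_E * (1 - F) + F\<close>. By the product rule
  \<open>(1 - F) * div Y\<close> is the divergence of the admissible field
  \<open>(1 - F) * Y\<close> plus the cutoff error, and \<open>F * div Y\<close> is a divergence
  with integral \<open>0\<close> minus the same error. Beyond the perimeter of \<open>E\<close>,
  only the error is paid for.\<close>

lemma perimeter_ball_surgery:
  assumes E: "E \<in> manifold_lebesgue_sets A"
  shows "perimeter A g (E - chart_inv c ` cball a s) \<le> perimeter A g E + ereal (W * L * C * r ^ (CARD('n) - 1))"
    and "perimeter A g (E \<union> chart_inv c ` cball a s) \<le> perimeter A g E + ereal (W * L * C * r ^ (CARD('n) - 1))"
proof -
  let ?B = "chart_inv c ` cball a s" and ?\<eta> = "W * L * C * r ^ (CARD('n) - 1)"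
  let ?\<mu> = "riemannian_volume A g"
  interpret finite_measure ?\<mu> by (rule finite_measure_volume[OF g])
  have indE: "indicator E \<in> borel_measurable ?\<mu>" using E g by (simp add: borel_measurable_indicator)
  \<comment> \<open>\<open>u = 0\<close> stands for the removal of the ball and \<open>u = 1\<close>
    for its addition.\<close>
  have main: "ereal (LINT p|?\<mu>. h p * divergence A g Y p) \<le> perimeter A g E + ereal ?\<eta>"
    if Y: "Y \<in> unit_fields g"
      and h: "h = indicator (E - ?B) \<and> u = 0 \<or> h = indicator (E \<union> ?B) \<and> u = 1" for h Y and u :: real
  proof -
    let ?F = "\<lambda>m. chart_lift c (\<phi> m)"
    define D where "D = divergence A g Y"
    define e where "e = cutoff_error Y"
    define H where "H m p = indicator E p * (1 - ?F m p) + u * ?F m p" for m p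
    have sY: "smooth_vector_field A Y" using Y by (simp add: unit_fields_def)
    have u: "u = 0 \<or> u = 1" using h by auto
    have contD: "continuous_on UNIV D" unfolding D_def by (rule divergence_continuous[OF g sY])
    obtain M where M: "\<forall>y\<in>range D. norm y \<le> M"
      using compact_imp_bounded[OF compact_continuous_image[OF contD compact_M]] unfolding bounded_iff by blast
    have mD: "D \<in> borel_measurable ?\<mu>" by (rule integrable_volume_continuous(1)[OF g contD])
    have mF: "?F m \<in> borel_measurable ?\<mu>" for m
      by (rule integrable_volume_continuous(1)[OF g smooth_fun_continuous[OF smooth_fun_cutoff]])
    have Hlim: "(\<lambda>m. H m p) \<longlonglongrightarrow> h p" for p
    proof -
      have "(\<lambda>m. H m p) \<longlonglongrightarrow> indicator E p * (1 - indicator ?B p) + u * indicator ?B p"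
        unfolding H_def by (intro tendsto_intros chart_lift_tendsto)
      also have "indicator E p * (1 - indicator ?B p) + u * indicator ?B p = h p"
        using h by (auto simp: indicator_def)
      finally show ?thesis .
    qed
    have H1: "\<bar>H m p\<bar> \<le> 1" for m p
      using chart_lift_bounds[of m p] u by (auto simp: H_def indicator_def)
    have mH: "H m \<in> borel_measurable ?\<mu>" for m
      unfolding H_def[abs_def] using indE mF by measurable
    have mh: "h \<in> borel_measurable ?\<mu>"
      by (rule borel_measurable_LIMSEQ_real[OF Hlim mH])
    have lim: "(\<lambda>m. LINT p|?\<mu>. H m p * D p) \<longlonglongrightarrow> (LINT p|?\<mu>. h p * D p)"
    proof (rule integral_dominated_convergence[where w="\<lambda>_. M"])
      show "integrable ?\<mu> (\<lambda>_. M)" by simp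
      show "(\<lambda>p. h p * D p) \<in> borel_measurable ?\<mu>" using mh mD by measurable
      show "(\<lambda>p. H m p * D p) \<in> borel_measurable ?\<mu>" for m using mH[of m] mD by measurable
      show "AE p in ?\<mu>. (\<lambda>m. H m p * D p) \<longlonglongrightarrow> h p * D p"
        by (intro AE_I2 tendsto_mult Hlim tendsto_const)
      show "AE p in ?\<mu>. norm (H m p * D p) \<le> M" for m
      proof (rule AE_I2)
        fix p
        have "\<bar>H m p\<bar> * \<bar>D p\<bar> \<le> 1 * \<bar>D p\<bar>" by (rule mult_right_mono[OF H1]) simp
        also have "\<dots> \<le> M" using M by simp
        finally show "norm (H m p * D p) \<le> M" by (simp add: abs_mult)
      qed
    qed
    have bound: "ereal (LINT p|?\<mu>. H m p * D p) \<le> perimeter A g E + ereal ?\<eta>" for m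
    proof -
      let ?Z = "\<lambda>c' p. (1 - ?F m p) *\<^sub>R Y c' p" and ?X = "\<lambda>c' p. ?F m p *\<^sub>R Y c' p"
      have Zu: "?Z \<in> unit_fields g"
        by (rule unit_fields_scale[OF g Y smooth_fun_cutoff']) (use chart_lift_bounds[of m] in \<open>simp add: abs_le_iff\<close>)
      have sZ: "smooth_vector_field A ?Z" using Zu by (simp add: unit_fields_def)
      have sX: "smooth_vector_field A ?X" by (rule smooth_vector_field_scale[OF sY smooth_fun_cutoff])
      have iZ: "integrable ?\<mu> (\<lambda>p. indicator E p * divergence A g ?Z p)"
        using integrable_volume_continuous(2)[OF g divergence_continuous[OF g sZ]] E g
        by (intro integrable_real_mult_indicator[of E, simplified mult.commute[of _ "indicator E _"]]) auto
      have iX: "integrable ?\<mu> (\<lambda>p. u * divergence A g ?X p)"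
        using integrable_volume_continuous(2)[OF g divergence_continuous[OF g sX]] by simp
      have ie: "integrable ?\<mu> (e m)"
        unfolding e_def by (rule integrable_volume_continuous(2)[OF g cutoff_error_continuous[OF sY]])
      \<comment> \<open>In both cases the error comes with the factor
        \<open>indicator E p - u\<close>, which lies between \<open>-1\<close> and \<open>1\<close>,
        so it is controlled by the integral of the absolute error.\<close>
      have iEe: "integrable ?\<mu> (\<lambda>p. (indicator E p - u) * e m p)"
      proof (rule Bochner_Integration.integrable_bound[OF integrable_abs[OF ie]])
        show "(\<lambda>p. (indicator E p - u) * e m p) \<in> borel_measurable ?\<mu>"
          by (intro borel_measurable_times borel_measurable_diff indE borel_measurable_const
              borel_measurable_integrable[OF ie])
        show "AE p in ?\<mu>. norm ((indicator E p - u) * e m p) \<le> norm \<bar>e m p\<bar>"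
          using u by (intro AE_I2) (auto simp: indicator_def)
      qed
      have eZ: "divergence A g ?Z p = (1 - ?F m p) * D p - e m p" for p
        using divergence_cutoff'[OF sY, of m p] by (simp only: D_def e_def)
      have eX: "divergence A g ?X p = e m p + ?F m p * D p" for p
        by (simp add: D_def e_def cutoff_error_def)
      have "H m p * D p = indicator E p * divergence A g ?Z p + u * divergence A g ?X p + (indicator E p - u) * e m p" for p
        unfolding eZ eX H_def by (simp add: algebra_simps)
      then have "(LINT p|?\<mu>. H m p * D p) = (LINT p|?\<mu>. indicator E p * divergence A g ?Z p) +
          (LINT p|?\<mu>. u * divergence A g ?X p) + (LINT p|?\<mu>. (indicator E p - u) * e m p)"
        using iZ iX iEe by simp
      also have "(LINT p|?\<mu>. u * divergence A g ?X p) = 0"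
        using integral_cutoff_divergence_eq_0[OF sY, of m] by simp
      also have "(LINT p|?\<mu>. (indicator E p - u) * e m p) \<le> ?\<eta>"
      proof -
        have "(LINT p|?\<mu>. (indicator E p - u) * e m p) \<le> (LINT p|?\<mu>. \<bar>e m p\<bar>)"
          by (rule integral_mono[OF iEe integrable_abs[OF ie]]) (use u in \<open>auto simp: indicator_def\<close>)
        also have "\<dots> \<le> ?\<eta>" unfolding e_def by (rule cutoff_error_integral[OF Y])
        finally show ?thesis .
      qed
      finally have "(LINT p|?\<mu>. H m p * D p) \<le> (LINT p|?\<mu>. indicator E p * divergence A g ?Z p) + ?\<eta>" by simp
      then have "ereal (LINT p|?\<mu>. H m p * D p) \<le> ereal (LINT p:E|?\<mu>. divergence A g ?Z p) + ereal ?\<eta>"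
        by (simp add: set_lebesgue_integral_def)
      also have "\<dots> \<le> perimeter A g E + ereal ?\<eta>"
        by (rule add_right_mono[OF perimeter_upper[OF Zu]])
      finally show ?thesis .
    qed
    have "(\<lambda>m. ereal (LINT p|?\<mu>. H m p * D p)) \<longlonglongrightarrow> ereal (LINT p|?\<mu>. h p * D p)"
      using lim by simp
    then show ?thesis unfolding D_def[symmetric] by (rule LIMSEQ_le_const2) (use bound in blast)
  qed
  show "perimeter A g (E - ?B) \<le> perimeter A g E + ereal ?\<eta>"
    unfolding perimeter_unit_fields[of g "E - ?B"] set_lebesgue_integral_def
  proof (rule SUP_least)
    fix Y assume "Y \<in> unit_fields g"
    from main[OF this, of "indicator (E - ?B)" 0]
    show "ereal (LINT p|riemannian_volume A g. indicator (E - ?B) p *\<^sub>R divergence A g Y p) \<le> perimeter A g E + ereal ?\<eta>"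
      by simp
  qed
  show "perimeter A g (E \<union> ?B) \<le> perimeter A g E + ereal ?\<eta>"
    unfolding perimeter_unit_fields[of g "E \<union> ?B"] set_lebesgue_integral_def
  proof (rule SUP_least)
    fix Y assume "Y \<in> unit_fields g"
    from main[OF this, of "indicator (E \<union> ?B)" 1]
    show "ereal (LINT p|riemannian_volume A g. indicator (E \<union> ?B) p *\<^sub>R divergence A g Y p) \<le> perimeter A g E + ereal ?\<eta>"
      by simp
  qed
qed

end

end

text \<open>Increments of \<open>f\<close> are dominated by those of \<open>h\<close>, so
  \<open>f\<close> inherits the continuity. It will be applied to the volume inside a growing ball,
  with a multiple of the Euclidean ball volume as \<open>h\<close>.\<close>

lemma continuous_on_dist_le:
  fixes f :: "real \<Rightarrow> real" and h :: "real \<Rightarrow> real"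
  assumes "continuous_on S h" "\<And>s t. s \<in> S \<Longrightarrow> t \<in> S \<Longrightarrow> s \<le> t \<Longrightarrow> \<bar>f t - f s\<bar> \<le> h t - h s"
  shows "continuous_on S f"
proof -
  have le: "dist (f s) (f t) \<le> dist (h s) (h t)" if "s \<in> S" "t \<in> S" for s t
    using assms(2)[OF that] assms(2)[OF that(2,1)] by (cases "s \<le> t") (auto simp: dist_real_def)
  show ?thesis unfolding continuous_on_iff
  proof (intro ballI allI impI)
    fix x and e :: real assume "x \<in> S" "0 < e"
    then obtain d where "0 < d" "\<forall>y\<in>S. dist y x < d \<longrightarrow> dist (h y) (h x) < e"
      using assms(1) unfolding continuous_on_iff by blast
    then show "\<exists>d>0. \<forall>y\<in>S. dist y x < d \<longrightarrow> dist (f y) (f x) < e"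
      using le \<open>x \<in> S\<close> by (intro exI[of _ d]) (auto intro: le_less_trans)
  qed
qed

context closed_manifold
begin

abbreviation coord_ball :: "('m, 'n) chart \<Rightarrow> 'm \<Rightarrow> real \<Rightarrow> 'm set" where
  "coord_ball c p s \<equiv> chart_inv c ` cball (snd c p) s"

lemma coord_ball_sets:
  assumes "c \<in> A" "cball (snd c p) r \<subseteq> chart_image c" "s \<le> r"
  shows "coord_ball c p s \<in> manifold_lebesgue_sets A"
  by (rule closed_manifold_sets[OF compact_chart_inv_image(2)[OF assms(1) compact_cball]])
    (rule order_trans[OF subset_cball[OF assms(3)] assms(2)])

text \<open>Growing the radius from \<open>s\<close> to \<open>t\<close> adds at most the volume of
  a shell, and this is at most \<open>W\<close> times its Euclidean volume, whatever
  \<open>F\<close> is. At radius \<open>0\<close> the ball is a single point.\<close>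

lemma continuous_ball_volume:
  assumes g: "riemannian_metric A g" and c: "c \<in> A" and r: "cball (snd c p) r \<subseteq> chart_image c"
    and F: "F \<in> manifold_lebesgue_sets A"
  shows "continuous_on {0..r} (\<lambda>s. measure (riemannian_volume A g) (F \<inter> coord_ball c p s))"
    and "0 \<le> r \<Longrightarrow> measure (riemannian_volume A g) (F \<inter> coord_ball c p 0) = 0"
proof -
  let ?\<mu> = "riemannian_volume A g" and ?a = "snd c p"
  interpret finite_measure ?\<mu> by (rule finite_measure_volume[OF g])
  obtain W where W: "0 \<le> W" "\<And>S. S \<in> sets lebesgue \<Longrightarrow> S \<subseteq> cball ?a r \<Longrightarrow>
       chart_inv c ` S \<in> manifold_lebesgue_sets A \<Longrightarrow>
       emeasure ?\<mu> (chart_inv c ` S) \<le> ennreal W * emeasure lebesgue S"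
    using volume_chart_bound[OF g c compact_cball r] by metis
  have bound: "measure ?\<mu> (chart_inv c ` S) \<le> W * measure lebesgue S"
    if "S \<in> sets lebesgue" "S \<subseteq> cball ?a r" "chart_inv c ` S \<in> manifold_lebesgue_sets A" for S
  proof -
    have "S \<in> lmeasurable" using that(1,2) by (intro bounded_set_imp_lmeasurable bounded_subset[OF bounded_cball])
    then have "emeasure lebesgue S = ennreal (measure lebesgue S)" by (simp add: emeasure_eq_measure2)
    then have "ennreal (measure ?\<mu> (chart_inv c ` S)) \<le> ennreal (W * measure lebesgue S)"
      using W(2)[OF that] W(1) by (simp add: emeasure_eq_measure ennreal_mult)
    then show ?thesis using W(1) by (simp add: ennreal_le_iff)
  qed
  let ?B = "coord_ball c p"
  have sB: "?B s \<in> manifold_lebesgue_sets A" if "s \<le> r" for s by (rule coord_ball_sets[OF c r that])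
  have sF: "F \<inter> ?B s \<in> sets ?\<mu>" if "s \<le> r" for s
    using manifold_sets_Int[OF F sB[OF that]] g by simp
  show "continuous_on {0..r} (\<lambda>s. measure ?\<mu> (F \<inter> ?B s))"
  proof (rule continuous_on_dist_le)
    show "continuous_on {0..r} (\<lambda>s. W * (unit_ball_vol (real DIM(real ^ 'n)) * s ^ DIM(real ^ 'n)))"
      by (intro continuous_intros)
    fix s t assume st: "s \<in> {0..r}" "t \<in> {0..r}" "s \<le> t"
    let ?S = "cball ?a t - cball ?a s"
    have sub: "F \<inter> ?B s \<subseteq> F \<inter> ?B t" using st subset_cball[of s t ?a] by blast
    have imS: "chart_inv c ` ?S = ?B t - ?B s"
    proof -
      have "cball ?a t \<subseteq> chart_image c" using st r subset_cball[of t r ?a] by auto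
      then have "inj_on (chart_inv c) (cball ?a t)" by (meson inj_on_inv_into)
      then show ?thesis
        using inj_on_image_set_diff[of "chart_inv c" "cball ?a t" "cball ?a t" "cball ?a s"] subset_cball[of s t ?a] st
        by auto
    qed
    have mS: "chart_inv c ` ?S \<in> manifold_lebesgue_sets A"
      unfolding imS by (rule manifold_sets_Diff) (use sB st in auto)
    have "measure ?\<mu> (F \<inter> ?B t) - measure ?\<mu> (F \<inter> ?B s) = measure ?\<mu> (F \<inter> ?B t - F \<inter> ?B s)"
      by (rule finite_measure_Diff[symmetric]) (use sF sub st in auto)
    also have "\<dots> \<le> measure ?\<mu> (chart_inv c ` ?S)"
      unfolding imS by (rule finite_measure_mono) (use mS g in \<open>auto simp: imS\<close>)
    also have "\<dots> \<le> W * measure lebesgue ?S"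
      by (rule bound[OF _ _ mS]) (use st in auto)
    also have "measure lebesgue ?S = measure lebesgue (cball ?a t) - measure lebesgue (cball ?a s)"
      by (rule measurable_measure_Diff) (use st in auto)
    also have "\<dots> = unit_ball_vol (real DIM(real ^ 'n)) * t ^ DIM(real ^ 'n) - unit_ball_vol (real DIM(real ^ 'n)) * s ^ DIM(real ^ 'n)"
      using content_cball[of t ?a] content_cball[of s ?a] st by simp
    finally have "measure ?\<mu> (F \<inter> ?B t) - measure ?\<mu> (F \<inter> ?B s) \<le>
        W * (unit_ball_vol (real DIM(real ^ 'n)) * t ^ DIM(real ^ 'n)) -
        W * (unit_ball_vol (real DIM(real ^ 'n)) * s ^ DIM(real ^ 'n))"
      by (simp add: right_diff_distrib)
    moreover have "measure ?\<mu> (F \<inter> ?B s) \<le> measure ?\<mu> (F \<inter> ?B t)"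
      by (rule finite_measure_mono[OF sub]) (use sF st in auto)
    ultimately show "\<bar>measure ?\<mu> (F \<inter> ?B t) - measure ?\<mu> (F \<inter> ?B s)\<bar> \<le>
        W * (unit_ball_vol (real DIM(real ^ 'n)) * t ^ DIM(real ^ 'n)) -
        W * (unit_ball_vol (real DIM(real ^ 'n)) * s ^ DIM(real ^ 'n))" by simp
  qed
  assume r0: "0 \<le> r"
  have "measure ?\<mu> (F \<inter> ?B 0) \<le> measure ?\<mu> (chart_inv c ` {?a})"
    by (rule finite_measure_mono) (use sB[of 0] r0 g in auto)
  also have "\<dots> \<le> W * measure lebesgue {?a}"
    by (rule bound) (use r0 sB[of 0] in auto)
  finally have "measure ?\<mu> (F \<inter> ?B 0) \<le> 0" by simp
  then show "measure ?\<mu> (F \<inter> ?B 0) = 0" by (rule antisym) (rule measure_nonneg)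
qed

section \<open>Sets of prescribed volume ratio\<close>

definition vol_ratio :: "('m, 'n) metric_field \<Rightarrow> 'm set \<Rightarrow> real" where
  "vol_ratio g E = measure (riemannian_volume A g) E / measure (riemannian_volume A g) UNIV"

text \<open>The budget \<open>\<eta>\<close> is the same for every measurable \<open>E\<close> and
  every radius up to \<open>r p\<close>, so one covering serves all sets. \<open>c\<close> and
  \<open>r\<close> are total on the points, while \<open>P\<close> collects the finitely many
  centres of the covering.\<close>

definition cheap_cover :: "('m, 'n) metric_field \<Rightarrow> real \<Rightarrow> 'm set \<Rightarrow> ('m \<Rightarrow> ('m, 'n) chart) \<Rightarrow>
    ('m \<Rightarrow> real) \<Rightarrow> bool" where
  "cheap_cover g \<eta> P c r \<longleftrightarrow> finite P \<and> (\<Union>p\<in>P. coord_ball (c p) p (r p)) = UNIV \<and>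
    (\<forall>p. c p \<in> A \<and> 0 < r p \<and> cball (snd (c p) p) (r p) \<subseteq> chart_image (c p) \<and>
    (\<forall>s E. 0 \<le> s \<longrightarrow> s \<le> r p \<longrightarrow> E \<in> manifold_lebesgue_sets A \<longrightarrow>
      perimeter A g (E - coord_ball (c p) p s) \<le> perimeter A g E + ereal \<eta> \<and>
      perimeter A g (E \<union> coord_ball (c p) p s) \<le> perimeter A g E + ereal \<eta>))"

lemma cheap_coverD:
  assumes "cheap_cover g \<eta> P c r"
  shows "finite P" "(\<Union>p\<in>P. coord_ball (c p) p (r p)) = UNIV"
    "c p \<in> A" "0 < r p" "cball (snd (c p) p) (r p) \<subseteq> chart_image (c p)"
    "0 \<le> s \<Longrightarrow> s \<le> r p \<Longrightarrow> E \<in> manifold_lebesgue_sets A \<Longrightarrow>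
       perimeter A g (E - coord_ball (c p) p s) \<le> perimeter A g E + ereal \<eta>"
    "0 \<le> s \<Longrightarrow> s \<le> r p \<Longrightarrow> E \<in> manifold_lebesgue_sets A \<Longrightarrow>
       perimeter A g (E \<union> coord_ball (c p) p s) \<le> perimeter A g E + ereal \<eta>"
  using assms unfolding cheap_cover_def by blast+

context
  fixes g assumes g: "riemannian_metric A g"
begin

lemma measure_UNIV_pos: "0 < measure (riemannian_volume A g) UNIV"
proof -
  interpret finite_measure "riemannian_volume A g" by (rule finite_measure_volume[OF g])
  show ?thesis
    using emeasure_volume_open_pos[OF g open_UNIV UNIV_I] by (simp add: emeasure_eq_measure)
qed

lemma vol_ratio_bounds: "0 \<le> vol_ratio g E" "vol_ratio g E \<le> 1"
proof -
  interpret finite_measure "riemannian_volume A g" by (rule finite_measure_volume[OF g])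
  show "0 \<le> vol_ratio g E" by (simp add: vol_ratio_def)
  show "vol_ratio g E \<le> 1"
    using bounded_measure[of E] measure_UNIV_pos g by (simp add: vol_ratio_def)
qed

lemma vol_ratio_Un:
  assumes "E \<in> manifold_lebesgue_sets A" "F \<in> manifold_lebesgue_sets A" "E \<inter> F = {}"
  shows "vol_ratio g (E \<union> F) = vol_ratio g E + vol_ratio g F"
proof -
  interpret finite_measure "riemannian_volume A g" by (rule finite_measure_volume[OF g])
  show ?thesis
    using finite_measure_Union[of E F] assms g by (simp add: vol_ratio_def add_divide_distrib)
qed

lemma vol_ratio_UNIV: "vol_ratio g UNIV = 1"
  using measure_UNIV_pos by (simp add: vol_ratio_def)

lemma vol_ratio_Int_Diff:
  assumes "E \<in> manifold_lebesgue_sets A" "F \<in> manifold_lebesgue_sets A"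
  shows "vol_ratio g E = vol_ratio g (E \<inter> F) + vol_ratio g (E - F)"
  using vol_ratio_Un[OF manifold_sets_Int[OF assms] manifold_sets_Diff[OF assms]]
  by (simp add: Int_Diff_disjoint Int_Diff_Un)

lemma emeasure_iff_vol_ratio:
  assumes "0 \<le> \<xi>"
  shows "emeasure (riemannian_volume A g) E = ennreal \<xi> * emeasure (riemannian_volume A g) UNIV \<longleftrightarrow>
    vol_ratio g E = \<xi>"
proof -
  interpret finite_measure "riemannian_volume A g" by (rule finite_measure_volume[OF g])
  show ?thesis
    using assms measure_UNIV_pos
    by (simp add: emeasure_eq_measure ennreal_mult[symmetric] vol_ratio_def field_simps)
qed

text \<open>The intermediate value theorem in the radius, starting from a ball of volume
  \<open>0\<close>. Adding a ball gains the part of it outside \<open>E\<close>, removing it loses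
  the part inside, and both parts have continuous volume.\<close>

lemma exists_ball_radius:
  assumes c: "c \<in> A" and r: "0 \<le> r" "cball (snd c p) r \<subseteq> chart_image c"
    and E: "E \<in> manifold_lebesgue_sets A"
  shows "vol_ratio g E \<le> \<xi> \<Longrightarrow> \<xi> \<le> vol_ratio g (E \<union> coord_ball c p r) \<Longrightarrow>
      \<exists>s. 0 \<le> s \<and> s \<le> r \<and> vol_ratio g (E \<union> coord_ball c p s) = \<xi>"
    and "\<xi> \<le> vol_ratio g E \<Longrightarrow> vol_ratio g (E - coord_ball c p r) \<le> \<xi> \<Longrightarrow>
      \<exists>s. 0 \<le> s \<and> s \<le> r \<and> vol_ratio g (E - coord_ball c p s) = \<xi>"
proof -
  let ?B = "coord_ball c p"
  have sB: "?B s \<in> manifold_lebesgue_sets A" if "s \<le> r" for s by (rule coord_ball_sets[OF c r(2) that])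
  have "UNIV - E \<in> manifold_lebesgue_sets A" using manifold_sets_Diff[OF open_manifold_sets[OF open_UNIV] E] .
  then have cE: "- E \<in> manifold_lebesgue_sets A" by (simp add: Compl_eq_Diff_UNIV)
  have cont: "continuous_on {0..r} (\<lambda>s. vol_ratio g (F \<inter> ?B s))" and zero: "vol_ratio g (F \<inter> ?B 0) = 0"
    if "F \<in> manifold_lebesgue_sets A" for F
    using continuous_ball_volume[OF g c r(2) that] measure_UNIV_pos r(1)
    by (auto simp: vol_ratio_def intro!: continuous_intros)
  have un: "vol_ratio g (E \<union> ?B s) = vol_ratio g E + vol_ratio g (- E \<inter> ?B s)" if "s \<le> r" for s
  proof -
    have "E \<union> ?B s = E \<union> (- E \<inter> ?B s)" by blast
    then show ?thesis using vol_ratio_Un[OF E manifold_sets_Int[OF cE sB[OF that]]] by auto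
  qed
  have df: "vol_ratio g (E - ?B s) = vol_ratio g E - vol_ratio g (E \<inter> ?B s)" if "s \<le> r" for s
    using vol_ratio_Int_Diff[OF E sB[OF that]] by simp
  show "\<exists>s. 0 \<le> s \<and> s \<le> r \<and> vol_ratio g (E \<union> ?B s) = \<xi>"
    if "vol_ratio g E \<le> \<xi>" "\<xi> \<le> vol_ratio g (E \<union> ?B r)"
  proof -
    have "continuous_on {0..r} (\<lambda>s. vol_ratio g E + vol_ratio g (- E \<inter> ?B s))"
      by (intro continuous_intros cont[OF cE])
    from IVT'[OF _ _ r(1) this, of \<xi>] that zero[OF cE] un[of r]
    obtain s where "0 \<le> s" "s \<le> r" "vol_ratio g E + vol_ratio g (- E \<inter> ?B s) = \<xi>" by auto
    then show ?thesis using un by metis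
  qed
  show "\<exists>s. 0 \<le> s \<and> s \<le> r \<and> vol_ratio g (E - ?B s) = \<xi>"
    if "\<xi> \<le> vol_ratio g E" "vol_ratio g (E - ?B r) \<le> \<xi>"
  proof -
    have "continuous_on {0..r} (\<lambda>s. vol_ratio g E - vol_ratio g (E \<inter> ?B s))"
      by (intro continuous_intros cont[OF E])
    from IVT2'[OF _ _ r(1) this, of \<xi>] that zero[OF E] df[of r]
    obtain s where "0 \<le> s" "s \<le> r" "vol_ratio g E - vol_ratio g (E \<inter> ?B s) = \<xi>" by auto
    then show ?thesis using df by metis
  qed
qed

text \<open>Here \<open>n \<ge> 2\<close> is needed: small balls have small perimeter.\<close>

lemma cheap_balls:
  assumes n: "CARD('n) \<ge> 2" and \<eta>: "0 < \<eta>"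
  shows "\<exists>c r. c \<in> A \<and> p \<in> fst c \<and> 0 < r \<and> cball (snd c p) r \<subseteq> chart_image c \<and>
    (\<forall>s E. 0 \<le> s \<longrightarrow> s \<le> r \<longrightarrow> E \<in> manifold_lebesgue_sets A \<longrightarrow>
      perimeter A g (E - coord_ball c p s) \<le> perimeter A g E + ereal \<eta> \<and>
      perimeter A g (E \<union> coord_ball c p s) \<le> perimeter A g E + ereal \<eta>)"
proof (rule ball_cutoffs[where ?'n = 'n])
  fix C :: real
  assume C: "0 < C" "\<And>(a :: real ^ 'n) s r. 0 \<le> s \<Longrightarrow> s \<le> r \<Longrightarrow> 0 < r \<Longrightarrow> \<exists>\<phi> G E. cutoff_family C a s r \<phi> G E"
  obtain c where c: "c \<in> A" "p \<in> fst c" using ex_chart by blast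
  let ?a = "snd c p"
  obtain r0 where r0: "0 < r0" "cball ?a r0 \<subseteq> chart_image c"
    using open_chart(2)[OF c(1)] c(2) open_contains_cball by blast
  obtain W where W: "0 \<le> W" "\<And>x. x \<in> cball ?a r0 \<Longrightarrow> volume_density g c (chart_inv c x) \<le> W"
    using volume_chart_bound[OF g c(1) compact_cball r0(2)] by metis
  obtain L where L: "0 < L" "\<And>x v. x \<in> cball ?a r0 \<Longrightarrow> norm v \<le> L * sqrt (g c (chart_inv c x) v v)"
    using metric_lower_bound[OF g c(1) compact_cball r0(2)] by metis
  define Q where "Q = W * L * C"
  have Q: "0 \<le> Q" using W L C by (simp add: Q_def)
  \<comment> \<open>\<open>r0 / 2\<close> keeps the doubled ball where \<open>W\<close> and
    \<open>L\<close> are valid. From \<open>r \<le> 1\<close> and \<open>n \<ge> 2\<close> follows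
    \<open>r ^ (n - 1) \<le> r\<close>, and the last bound then gives
    \<open>(Q + 1) * r \<le> \<eta>\<close>. The \<open>1\<close> avoids a division by
    \<open>0\<close> should \<open>Q\<close> vanish.\<close>
  define r where "r = min (r0 / 2) (min 1 (\<eta> / (Q + 1)))"
  have r: "0 < r" "2 * r \<le> r0" "r \<le> 1" "r \<le> \<eta> / (Q + 1)" using r0 \<eta> Q by (auto simp: r_def)
  have sub: "cball ?a (2 * r) \<subseteq> cball ?a r0" using r(2) by (rule subset_cball)
  have "r ^ (CARD('n) - 1) \<le> r ^ 1" using r n by (intro power_decreasing) auto
  then have "Q * r ^ (CARD('n) - 1) \<le> (Q + 1) * r" using Q r(1) by (intro mult_mono) auto
  also have "\<dots> \<le> \<eta>" using r(4) Q by (simp add: field_simps)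
  finally have Qr: "ereal (W * L * C * r ^ (CARD('n) - 1)) \<le> ereal \<eta>" by (simp add: Q_def)
  show ?thesis
  proof (intro exI conjI allI impI)
    show "cball ?a r \<subseteq> chart_image c" using r r0 subset_cball[of r r0 ?a] by auto
    fix s E assume s: "0 \<le> s" "s \<le> r" and E: "E \<in> manifold_lebesgue_sets A"
    obtain \<phi> G S where cut: "cutoff_family C ?a s r \<phi> G S" using C(2)[OF s r(1)] by blast
    have sub2: "cball ?a (2 * r) \<subseteq> chart_image c" using sub r0(2) by blast
    have W': "\<And>x. x \<in> cball ?a (2 * r) \<Longrightarrow> volume_density g c (chart_inv c x) \<le> W" using W(2) sub by blast
    have L': "\<And>x v. x \<in> cball ?a (2 * r) \<Longrightarrow> norm v \<le> L * sqrt (g c (chart_inv c x) v v)" using L(2) sub by blast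
    note surg = perimeter_ball_surgery[OF g c(1) r(1) sub2 s cut W(1) W' L(1) L' E]
    show "perimeter A g (E - coord_ball c p s) \<le> perimeter A g E + ereal \<eta>"
      using surg(1) add_left_mono[OF Qr] by (rule order_trans)
    show "perimeter A g (E \<union> coord_ball c p s) \<le> perimeter A g E + ereal \<eta>"
      using surg(2) add_left_mono[OF Qr] by (rule order_trans)
  qed (use c r in auto)
qed

lemma finite_cheap_cover:
  assumes n: "CARD('n) \<ge> 2" and \<eta>: "0 < \<eta>"
  shows "\<exists>P c r. cheap_cover g \<eta> P c r"
proof -
  obtain c r where cr: "\<And>p. c p \<in> A \<and> p \<in> fst (c p) \<and> 0 < r p \<and> cball (snd (c p) p) (r p) \<subseteq> chart_image (c p) \<and>
    (\<forall>s E. 0 \<le> s \<longrightarrow> s \<le> r p \<longrightarrow> E \<in> manifold_lebesgue_sets A \<longrightarrow>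
      perimeter A g (E - coord_ball (c p) p s) \<le> perimeter A g E + ereal \<eta> \<and>
      perimeter A g (E \<union> coord_ball (c p) p s) \<le> perimeter A g E + ereal \<eta>)"
    using cheap_balls[OF n \<eta>] by metis
  let ?U = "\<lambda>p. chart_inv (c p) ` ball (snd (c p) p) (r p)"
  have oU: "open (?U p)" for p
    by (rule open_chart_inv_image) (use cr[of p] ball_subset_cball in blast)+
  have "p \<in> ?U p" for p
    using cr[of p] chart_inv_left[of "c p" p] by (metis centre_in_ball imageI)
  then have cov: "UNIV \<subseteq> (\<Union>p\<in>UNIV. ?U p)" by blast
  obtain P where P: "finite P" "UNIV \<subseteq> (\<Union>p\<in>P. ?U p)"
    by (rule compactE_image[OF compact_M oU cov])
  have "(\<Union>p\<in>P. ?U p) \<subseteq> (\<Union>p\<in>P. coord_ball (c p) p (r p))"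
    by (intro UN_mono order_refl image_mono ball_subset_cball)
  then have cov': "(\<Union>p\<in>P. coord_ball (c p) p (r p)) = UNIV"
    by (rule top.extremum_uniqueI[OF order_trans[OF P(2)]])
  have "cheap_cover g \<eta> P c r" unfolding cheap_cover_def using P(1) cov' cr by simp
  then show ?thesis by blast
qed

text \<open>Balls of a covering are added to the empty set one after another, each at finite cost,
  until the manifold is exhausted. The volume ratio passes through every value between
  \<open>0\<close> and \<open>1\<close>, so the growth can be stopped inside some ball at ratio
  \<open>\<xi>\<close>.\<close>

lemma exists_finite_perimeter:
  assumes n: "CARD('n) \<ge> 2" and \<xi>: "0 \<le> \<xi>" "\<xi> \<le> 1"
  shows "\<exists>E\<in>manifold_lebesgue_sets A. vol_ratio g E = \<xi> \<and> perimeter A g E < \<infinity>"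
proof -
  \<comment> \<open>The budget \<open>1\<close> is arbitrary: only finiteness of the perimeter
    matters here.\<close>
  obtain P c r where "cheap_cover g 1 P c r"
    using finite_cheap_cover[OF n zero_less_one] by blast
  note P = cheap_coverD[OF this]
  let ?U = "\<lambda>X. \<Union>p\<in>X. coord_ball (c p) p (r p)"
  have sB: "coord_ball (c p) p (r p) \<in> manifold_lebesgue_sets A" for p
    by (rule coord_ball_sets[OF P(3) P(5) order_refl])
  have fin: "perimeter A g (E \<union> coord_ball (c p) p s) < \<infinity>"
    if "perimeter A g E < \<infinity>" "E \<in> manifold_lebesgue_sets A" "0 \<le> s" "s \<le> r p" for E p s
  proof -
    have "perimeter A g (E \<union> coord_ball (c p) p s) \<le> perimeter A g E + ereal 1"
      by (rule P(7)) (use that in auto)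
    also have "\<dots> < \<infinity>" using that(1) by (cases "perimeter A g E") auto
    finally show ?thesis .
  qed
  have "?U X \<in> manifold_lebesgue_sets A \<and> perimeter A g (?U X) < \<infinity> \<and>
    (\<forall>\<xi>. 0 \<le> \<xi> \<and> \<xi> \<le> vol_ratio g (?U X) \<longrightarrow>
      (\<exists>E\<in>manifold_lebesgue_sets A. vol_ratio g E = \<xi> \<and> perimeter A g E < \<infinity>))" if "finite X" for X
    using that
  proof (induction X rule: finite_induct)
    case empty
    have "perimeter A g {} \<le> 0"
      unfolding perimeter_unit_fields by (rule SUP_least) (simp add: set_lebesgue_integral_def zero_ereal_def)
    then have "perimeter A g {} < \<infinity>" by (rule le_less_trans) simp
    moreover have "vol_ratio g {} = 0" by (simp add: vol_ratio_def)
    moreover have "{} \<in> manifold_lebesgue_sets A" by (rule open_manifold_sets) simp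
    ultimately show ?case by auto
  next
    case (insert p X)
    have U: "?U (insert p X) = ?U X \<union> coord_ball (c p) p (r p)" by auto
    have s: "?U X \<in> manifold_lebesgue_sets A" "perimeter A g (?U X) < \<infinity>" using insert.IH by auto
    have "\<exists>E\<in>manifold_lebesgue_sets A. vol_ratio g E = \<xi> \<and> perimeter A g E < \<infinity>"
      if x: "0 \<le> \<xi>" "\<xi> \<le> vol_ratio g (?U X \<union> coord_ball (c p) p (r p))" for \<xi>
    proof (cases "\<xi> \<le> vol_ratio g (?U X)")
      case True
      then show ?thesis using insert.IH x(1) by blast
    next
      case False
      then obtain t where t: "0 \<le> t" "t \<le> r p" "vol_ratio g (?U X \<union> coord_ball (c p) p t) = \<xi>"
        using exists_ball_radius(1)[OF P(3) less_imp_le[OF P(4)] P(5) s(1) less_imp_le x(2)] by (auto simp: not_le)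
      then show ?thesis
        using fin[OF s(2,1) t(1,2)] manifold_sets_Un[OF s(1) coord_ball_sets[OF P(3) P(5) t(2)]] by blast
    qed
    then show ?case
      unfolding U using manifold_sets_Un[OF s(1) sB] fin[OF s(2,1) less_imp_le[OF P(4)] order_refl] by blast
  qed
  from this[OF P(1)] show ?thesis unfolding P(2) vol_ratio_UNIV using \<xi> by blast
qed

end

text \<open>By the pigeonhole principle some ball of a finite covering contains a definite amount of
  volume of \<open>E\<close>, or of its complement. The covering is chosen for \<open>g0\<close> and serves all \<open>g\<close>.\<close>

lemma adjust_volume:
  assumes g0: "riemannian_metric A g0" and n: "CARD('n) \<ge> 2" and \<eta>: "0 < \<eta>" and \<xi>0: "0 < \<xi>0" "\<xi>0 < 1"
  obtains \<delta> where "0 < \<delta>" "\<And>g E \<xi>. riemannian_metric A g \<Longrightarrow> E \<in> manifold_lebesgue_sets A \<Longrightarrow>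
    \<bar>vol_ratio g E - \<xi>0\<bar> \<le> \<delta> \<Longrightarrow> \<bar>\<xi> - \<xi>0\<bar> \<le> \<delta> \<Longrightarrow>
    \<exists>E'\<in>manifold_lebesgue_sets A. vol_ratio g E' = \<xi> \<and> perimeter A g0 E' \<le> perimeter A g0 E + ereal \<eta>"
proof -
  obtain P c r where "cheap_cover g0 \<eta> P c r"
    using finite_cheap_cover[OF g0 n \<eta>] by blast
  note P = cheap_coverD[OF this]
  let ?B = "\<lambda>p. coord_ball (c p) p (r p)"
  define N where "N = real (card P)"
  have N: "0 \<le> N" by (simp add: N_def)
  \<comment> \<open>The ratio has to move by at most \<open>2 * \<delta>\<close>, since
    \<open>vol_ratio g E\<close> and \<open>\<xi>\<close> each deviate from \<open>\<xi>0\<close> by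
    at most \<open>\<delta>\<close>. One of \<open>N\<close> balls provides this amount if the set
    that is searched has ratio at least \<open>2 * \<delta> * N\<close>. For \<open>E\<close> and
    its complement only \<open>\<xi>0 - \<delta>\<close> and \<open>1 - \<xi>0 - \<delta>\<close>
    are guaranteed, hence the denominator \<open>2 * N + 1\<close>.\<close>
  define \<delta> where "\<delta> = min \<xi>0 (1 - \<xi>0) / (2 * N + 1)"
  have \<delta>: "0 < \<delta>" using \<xi>0 N by (simp add: \<delta>_def)
  have "(2 * N + 1) * \<delta> = min \<xi>0 (1 - \<xi>0)" using N by (simp add: \<delta>_def)
  then have \<delta>N: "2 * \<delta> * N + \<delta> \<le> \<xi>0" "2 * \<delta> * N + \<delta> \<le> 1 - \<xi>0" by (auto simp: algebra_simps)
  have sB: "?B p \<in> manifold_lebesgue_sets A" for p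
    by (rule coord_ball_sets[OF P(3) P(5) order_refl])
  show thesis
  proof (rule that[OF \<delta>])
    fix g E \<xi> assume g: "riemannian_metric A g" and E: "E \<in> manifold_lebesgue_sets A"
      and vE: "\<bar>vol_ratio g E - \<xi>0\<bar> \<le> \<delta>" and \<xi>: "\<bar>\<xi> - \<xi>0\<bar> \<le> \<delta>"
    have Pne: "P \<noteq> {}"
    proof
      assume "P = {}"
      then show False using P(2) by simp
    qed
    have pigeon: "\<exists>p\<in>P. 2 * \<delta> \<le> vol_ratio g (F \<inter> ?B p)"
      if F: "F \<in> manifold_lebesgue_sets A" "2 * \<delta> * N \<le> vol_ratio g F" for F
    proof (rule ccontr)
      interpret finite_measure "riemannian_volume A g" by (rule finite_measure_volume[OF g])
      assume "\<not> ?thesis"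
      then have lt: "vol_ratio g (F \<inter> ?B p) < 2 * \<delta>" if "p \<in> P" for p using that by auto
      have "F = F \<inter> (\<Union>p\<in>P. ?B p)" unfolding P(2) by simp
      also have "\<dots> = (\<Union>p\<in>P. F \<inter> ?B p)" by (rule Int_UN_distrib)
      finally have FU: "F = (\<Union>p\<in>P. F \<inter> ?B p)" .
      have "measure (riemannian_volume A g) F \<le> (\<Sum>p\<in>P. measure (riemannian_volume A g) (F \<inter> ?B p))"
        by (subst FU, rule finite_measure_subadditive_finite[OF P(1)])
          (use manifold_sets_Int[OF F(1) sB] g in auto)
      then have "vol_ratio g F \<le> (\<Sum>p\<in>P. vol_ratio g (F \<inter> ?B p))"
        using measure_UNIV_pos[OF g] by (simp add: vol_ratio_def sum_divide_distrib[symmetric] divide_right_mono)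
      also have "\<dots> < (\<Sum>p\<in>P. 2 * \<delta>)" by (rule sum_strict_mono[OF P(1) Pne lt])
      also have "\<dots> = 2 * \<delta> * N" by (simp add: N_def)
      finally show False using F(2) by simp
    qed
    show "\<exists>E'\<in>manifold_lebesgue_sets A. vol_ratio g E' = \<xi> \<and> perimeter A g0 E' \<le> perimeter A g0 E + ereal \<eta>"
    proof (cases "vol_ratio g E \<le> \<xi>")
      case True
      have cE: "UNIV - E \<in> manifold_lebesgue_sets A" using manifold_sets_Diff[OF open_manifold_sets[OF open_UNIV] E] .
      have "vol_ratio g (UNIV - E) = 1 - vol_ratio g E"
        using vol_ratio_Int_Diff[OF g open_manifold_sets[OF open_UNIV] E] vol_ratio_UNIV[OF g] by simp
      then obtain p where p: "p \<in> P" "2 * \<delta> \<le> vol_ratio g ((UNIV - E) \<inter> ?B p)"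
        using pigeon[OF cE] vE \<delta>N(2) by force
      have "vol_ratio g (E \<union> ?B p) = vol_ratio g E + vol_ratio g ((UNIV - E) \<inter> ?B p)"
      proof -
        have "E \<union> ?B p = E \<union> ((UNIV - E) \<inter> ?B p)" by blast
        then show ?thesis using vol_ratio_Un[OF g E manifold_sets_Int[OF cE sB]] by (metis Diff_disjoint Int_assoc Int_empty_left)
      qed
      then have "\<xi> \<le> vol_ratio g (E \<union> ?B p)" using p(2) vE \<xi> by linarith
      then obtain s where s: "0 \<le> s" "s \<le> r p" "vol_ratio g (E \<union> coord_ball (c p) p s) = \<xi>"
        using exists_ball_radius(1)[OF g P(3) less_imp_le[OF P(4)] P(5) E True] by blast
      then show ?thesis
        using P(7)[OF s(1,2) E] manifold_sets_Un[OF E coord_ball_sets[OF P(3) P(5) s(2)]] by blast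
    next
      case False
      obtain p where p: "p \<in> P" "2 * \<delta> \<le> vol_ratio g (E \<inter> ?B p)"
        using pigeon[OF E] vE \<delta>N(1) by force
      have "vol_ratio g (E - ?B p) = vol_ratio g E - vol_ratio g (E \<inter> ?B p)"
        using vol_ratio_Int_Diff[OF g E sB[of p]] by simp
      then have "vol_ratio g (E - ?B p) \<le> \<xi>" using p(2) vE \<xi> by linarith
      then obtain s where s: "0 \<le> s" "s \<le> r p" "vol_ratio g (E - coord_ball (c p) p s) = \<xi>"
        using exists_ball_radius(2)[OF g P(3) less_imp_le[OF P(4)] P(5) E, of \<xi>] False by force
      then show ?thesis
        using P(6)[OF s(1,2) E] manifold_sets_Diff[OF E coord_ball_sets[OF P(3) P(5) s(2)]] by blast
    qed
  qed
qed

section \<open>Quantitative comparison of uniformly close metrics\<close>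

definition metric_close :: "real \<Rightarrow> ('m, 'n) metric_field \<Rightarrow> ('m, 'n) metric_field \<Rightarrow> bool" where
  "metric_close \<epsilon> g g0 \<longleftrightarrow> (\<forall>c\<in>A. \<forall>p\<in>fst c. \<forall>v.
     g0 c p v v / (1 + \<epsilon>)\<^sup>2 \<le> g c p v v \<and> g c p v v \<le> (1 + \<epsilon>)\<^sup>2 * g0 c p v v)"

lemma metric_nonneg:
  assumes "riemannian_metric A g" "c \<in> A" "p \<in> fst c" shows "0 \<le> g c p v v"
  using metric_inner_form[OF assms]
  by (cases "v = 0") (auto simp: inner_form_def bilinear_lzero less_imp_le)

lemma metric_close_mono:
  assumes g: "riemannian_metric A g0" and close: "metric_close \<epsilon> g g0" and \<epsilon>: "0 < \<epsilon>" "\<epsilon> \<le> \<epsilon>'"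
  shows "metric_close \<epsilon>' g g0"
  unfolding metric_close_def
proof (intro ballI allI)
  fix c p v assume c: "c \<in> A" "p \<in> fst c"
  have q: "(1 + \<epsilon>)\<^sup>2 \<le> (1 + \<epsilon>')\<^sup>2" "0 < (1 + \<epsilon>)\<^sup>2" using \<epsilon> by (auto intro: power_mono)
  have "g0 c p v v / (1 + \<epsilon>')\<^sup>2 \<le> g0 c p v v / (1 + \<epsilon>)\<^sup>2"
    by (intro divide_left_mono mult_pos_pos less_le_trans[OF q(2) q(1)] q metric_nonneg[OF g c])
  moreover have "(1 + \<epsilon>)\<^sup>2 * g0 c p v v \<le> (1 + \<epsilon>')\<^sup>2 * g0 c p v v"
    using q metric_nonneg[OF g c] by (intro mult_right_mono)
  moreover have "g0 c p v v / (1 + \<epsilon>)\<^sup>2 \<le> g c p v v \<and> g c p v v \<le> (1 + \<epsilon>)\<^sup>2 * g0 c p v v"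
    using close c unfolding metric_close_def by blast
  ultimately show "g0 c p v v / (1 + \<epsilon>')\<^sup>2 \<le> g c p v v \<and> g c p v v \<le> (1 + \<epsilon>')\<^sup>2 * g0 c p v v"
    by linarith
qed

text \<open>The filter \<open>at t0 within I\<close> leaves out \<open>t0\<close> itself; this
  supplies the missing case in \<open>metric_family_close\<close>.\<close>

lemma metric_close_refl:
  assumes g: "riemannian_metric A g" and \<epsilon>: "0 < \<epsilon>"
  shows "metric_close \<epsilon> g g"
  unfolding metric_close_def
proof (intro ballI allI)
  fix c p v assume c: "c \<in> A" "p \<in> fst c"
  have q: "1 \<le> (1 + \<epsilon>)\<^sup>2" using \<epsilon> by (simp add: one_le_power)
  show "g c p v v / (1 + \<epsilon>)\<^sup>2 \<le> g c p v v \<and> g c p v v \<le> (1 + \<epsilon>)\<^sup>2 * g c p v v"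
  proof
    have "0 < (1 + \<epsilon>)\<^sup>2" using q by linarith
    then show "g c p v v / (1 + \<epsilon>)\<^sup>2 \<le> g c p v v"
      using divide_left_mono[OF q metric_nonneg[OF g c, of v]] by simp
    show "g c p v v \<le> (1 + \<epsilon>)\<^sup>2 * g c p v v"
      using mult_right_mono[OF q metric_nonneg[OF g c, of v]] by simp
  qed
qed

lemma measure_volume_le:
  assumes g: "riemannian_metric A g" and g0: "riemannian_metric A g0" and k: "0 \<le> k"
    "\<And>p. density_ratio g g0 p \<le> k" and E: "E \<in> manifold_lebesgue_sets A"
  shows "measure (riemannian_volume A g) E \<le> k * measure (riemannian_volume A g0) E"
proof -
  let ?\<mu> = "riemannian_volume A g0"
  interpret m: finite_measure "riemannian_volume A g" by (rule finite_measure_volume[OF g])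
  interpret m0: finite_measure ?\<mu> by (rule finite_measure_volume[OF g0])
  have E': "E \<in> sets ?\<mu>" using E g0 by simp
  have "(\<lambda>p. ennreal (density_ratio g g0 p)) \<in> borel_measurable ?\<mu>"
    using integrable_volume_continuous(1)[OF g0 smooth_fun_continuous[OF smooth_fun_density_ratio[OF g g0]]] by simp
  then have "emeasure (riemannian_volume A g) E = (\<integral>\<^sup>+p. ennreal (density_ratio g g0 p) * indicator E p \<partial>?\<mu>)"
    unfolding riemannian_volume_density[OF g g0] by (rule emeasure_density[OF _ E'])
  also have "\<dots> \<le> (\<integral>\<^sup>+p. ennreal k * indicator E p \<partial>?\<mu>)"
    by (intro nn_integral_mono mult_right_mono ennreal_leI k) simp
  also have "\<dots> = ennreal k * emeasure ?\<mu> E" by (rule nn_integral_cmult_indicator[OF E'])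
  finally have "ennreal (measure (riemannian_volume A g) E) \<le> ennreal (k * measure ?\<mu> E)"
    using k(1) by (simp add: m.emeasure_eq_measure m0.emeasure_eq_measure ennreal_mult)
  then show ?thesis using k(1) by (simp add: ennreal_le_iff)
qed

text \<open>One factor \<open>q\<close> comes from the volume of \<open>E\<close> and the other from
  the total volume.\<close>

lemma vol_ratio_le:
  assumes g: "riemannian_metric A g" and g0: "riemannian_metric A g0" and q: "0 < q"
    "\<And>p. density_ratio g g0 p \<le> q" "\<And>p. density_ratio g0 g p \<le> q" and E: "E \<in> manifold_lebesgue_sets A"
  shows "vol_ratio g E \<le> q\<^sup>2 * vol_ratio g0 E"
proof -
  let ?m = "measure (riemannian_volume A g)" and ?k = "measure (riemannian_volume A g0)"
  have a: "?m E \<le> q * ?k E" by (rule measure_volume_le[OF g g0 less_imp_le[OF q(1)] q(2) E])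
  have b: "?k UNIV \<le> q * ?m UNIV"
    by (rule measure_volume_le[OF g0 g less_imp_le[OF q(1)] q(3) open_manifold_sets[OF open_UNIV]])
  have "?m E * ?k UNIV \<le> (q * ?k E) * (q * ?m UNIV)"
    using a b q(1) by (intro mult_mono) auto
  then show ?thesis
    using measure_UNIV_pos[OF g] measure_UNIV_pos[OF g0]
    by (simp add: vol_ratio_def field_simps power2_eq_square)
qed

lemma metric_close_sqrt:
  assumes "metric_close \<epsilon> g g0" "0 < \<epsilon>" "c \<in> A" "p \<in> fst c"
  shows "sqrt (g0 c p v v) \<le> (1 + \<epsilon>) * sqrt (g c p v v)" "sqrt (g c p v v) \<le> (1 + \<epsilon>) * sqrt (g0 c p v v)"
proof -
  have *: "g0 c p v v / (1 + \<epsilon>)\<^sup>2 \<le> g c p v v" "g c p v v \<le> (1 + \<epsilon>)\<^sup>2 * g0 c p v v"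
    using assms unfolding metric_close_def by blast+
  have "0 < (1 + \<epsilon>)\<^sup>2" using assms(2) by simp
  then have "g0 c p v v \<le> (1 + \<epsilon>)\<^sup>2 * g c p v v" using *(1) by (simp add: field_simps)
  then have "sqrt (g0 c p v v) \<le> sqrt ((1 + \<epsilon>)\<^sup>2 * g c p v v)" "sqrt (g c p v v) \<le> sqrt ((1 + \<epsilon>)\<^sup>2 * g0 c p v v)"
    using *(2) by auto
  then show "sqrt (g0 c p v v) \<le> (1 + \<epsilon>) * sqrt (g c p v v)" "sqrt (g c p v v) \<le> (1 + \<epsilon>) * sqrt (g0 c p v v)"
    using assms(2) by (simp_all add: real_sqrt_mult)
qed

text \<open>Densities and lengths are both distorted by at most a factor \<open>q\<close>. The
  perimeter picks up one factor of each kind, the volume ratio one from the numerator and one from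
  the denominator, so \<open>q^2 \<le> 1 + \<theta>\<close> serves both.\<close>

lemma metric_close_estimates:
  assumes \<theta>: "0 < \<theta>"
  shows "\<exists>\<epsilon>>0. \<forall>g g0. riemannian_metric A g \<longrightarrow> riemannian_metric A g0 \<longrightarrow> metric_close \<epsilon> g g0 \<longrightarrow>
    (\<forall>E\<in>manifold_lebesgue_sets A. perimeter A g E \<le> ereal (1 + \<theta>) * perimeter A g0 E \<and>
       perimeter A g0 E \<le> ereal (1 + \<theta>) * perimeter A g E \<and> \<bar>vol_ratio g E - vol_ratio g0 E\<bar> \<le> \<theta>)"
proof -
  \<comment> \<open>With \<open>\<theta>' \<le> 1\<close> one gets \<open>q^2 = 1 + 2 * \<theta>' +
    \<theta>'^2 \<le> 1 + 3 * \<theta>' \<le> 1 + \<theta>\<close>.\<close>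
  define \<theta>' where "\<theta>' = min 1 (\<theta> / 3)"
  define q where "q = 1 + \<theta>'"
  have \<theta>': "0 < \<theta>'" "\<theta>' \<le> 1" "3 * \<theta>' \<le> \<theta>" using \<theta> by (auto simp: \<theta>'_def)
  have q: "1 < q" using \<theta>' by (simp add: q_def)
  have q2: "1 < q\<^sup>2" using q by (simp add: one_less_power)
  have "\<theta>' * \<theta>' \<le> 1 * \<theta>'" using \<theta>' by (intro mult_right_mono) auto
  moreover have "q\<^sup>2 = 1 + 2 * \<theta>' + \<theta>' * \<theta>'" by (simp add: q_def power2_eq_square algebra_simps)
  ultimately have q\<theta>: "q\<^sup>2 \<le> 1 + \<theta>" using \<theta>' by linarith
  \<comment> \<open>The determinant ratio is to lie between \<open>1 / q^2\<close> and
    \<open>q^2\<close>, so that its square root, the ratio of the densities, lies between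
    \<open>1 / q\<close> and \<open>q\<close>. The lower end dictates \<open>\<eta>\<close>, and
    \<open>up\<close> covers the upper end.\<close>
  define \<eta> where "\<eta> = 1 - 1 / q\<^sup>2"
  have "1 / q\<^sup>2 < 1 / 1" using q2 by (intro divide_strict_left_mono) auto
  then have \<eta>: "0 < \<eta>" by (simp add: \<eta>_def)
  have up: "1 + \<eta> \<le> q\<^sup>2"
  proof -
    have "(2 - q\<^sup>2) * q\<^sup>2 \<le> 1" using zero_le_square[of "q\<^sup>2 - 1"] by (simp add: algebra_simps)
    moreover have "0 < q\<^sup>2" using q2 by linarith
    ultimately have "2 - q\<^sup>2 \<le> 1 / q\<^sup>2" by (simp only: pos_le_divide_eq)
    then show ?thesis by (simp add: \<eta>_def)
  qed
  show ?thesis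
  proof (rule det_gram_ratio[OF \<eta>, where ?'n = 'n])
    fix \<epsilon>1 :: real
    assume \<epsilon>1: "0 < \<epsilon>1" and det: "\<And>B B0 :: real ^ 'n \<Rightarrow> real ^ 'n \<Rightarrow> real. inner_form B \<Longrightarrow> inner_form B0 \<Longrightarrow>
     (\<And>v. B0 v v / (1 + \<epsilon>1)\<^sup>2 \<le> B v v \<and> B v v \<le> (1 + \<epsilon>1)\<^sup>2 * B0 v v) \<Longrightarrow>
     \<bar>det (gram B) / det (gram B0) - 1\<bar> < \<eta>"
    define \<epsilon> where "\<epsilon> = min \<epsilon>1 \<theta>'"
    have \<epsilon>: "0 < \<epsilon>" "\<epsilon> \<le> \<epsilon>1" "1 + \<epsilon> \<le> q" using \<epsilon>1 \<theta>' by (auto simp: \<epsilon>_def q_def)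
    show ?thesis
    proof (intro exI[of _ \<epsilon>] conjI allI impI ballI \<epsilon>(1))
      fix g g0 E
      assume g: "riemannian_metric A g" and g0: "riemannian_metric A g0" and close: "metric_close \<epsilon> g g0"
        and E: "E \<in> manifold_lebesgue_sets A"
      have close1: "metric_close \<epsilon>1 g g0" by (rule metric_close_mono[OF g0 close \<epsilon>(1,2)])
      have ratio: "1 / q \<le> density_ratio g g0 p \<and> density_ratio g g0 p \<le> q \<and>
          density_ratio g0 g p = 1 / density_ratio g g0 p" for p
      proof -
        obtain c where c: "c \<in> A" "p \<in> fst c" using ex_chart by blast
        let ?R = "det (gram (g c p)) / det (gram (g0 c p))"
        have "\<bar>?R - 1\<bar> < \<eta>"
          by (rule det[OF metric_inner_form[OF g c] metric_inner_form[OF g0 c]])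
            (use close1 c in \<open>unfold metric_close_def, blast\<close>)
        then have R: "1 / q\<^sup>2 \<le> ?R" "?R \<le> q\<^sup>2" using up by (auto simp: \<eta>_def abs_less_iff)
        have \<rho>: "density_ratio g g0 p = sqrt ?R"
          by (simp add: density_ratio_chart[OF g g0 c] volume_density_gram real_sqrt_divide)
        have "sqrt (1 / q\<^sup>2) \<le> sqrt ?R" "sqrt ?R \<le> sqrt (q\<^sup>2)"
          using R by (simp_all only: real_sqrt_le_iff)
        then have "1 / q \<le> density_ratio g g0 p \<and> density_ratio g g0 p \<le> q"
          unfolding \<rho> using q by (simp add: real_sqrt_divide)
        moreover have "density_ratio g0 g p = 1 / density_ratio g g0 p"
          by (simp add: density_ratio_chart[OF g g0 c] density_ratio_chart[OF g0 g c])
        ultimately show ?thesis by blast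
      qed
      have r1: "density_ratio g g0 p \<le> q" for p using ratio by blast
      have r2: "density_ratio g0 g p \<le> q" for p
      proof -
        have "1 / density_ratio g g0 p \<le> 1 / (1 / q)"
          using ratio[of p] q density_ratio_pos[OF g g0, of p] by (intro divide_left_mono) auto
        then show ?thesis using ratio[of p] by simp
      qed
      have k: "density_ratio g1 g2 p * sqrt (g2 c p v v) \<le> (1 + \<theta>) * sqrt (g1 c p v v)"
        if "riemannian_metric A g1" "riemannian_metric A g2" "density_ratio g1 g2 p \<le> q"
          "sqrt (g2 c p v v) \<le> (1 + \<epsilon>) * sqrt (g1 c p v v)" "c \<in> A" "p \<in> fst c" for g1 g2 c p v
      proof -
        have nn: "0 \<le> sqrt (g1 c p v v)" "0 \<le> sqrt (g2 c p v v)" using metric_nonneg that by auto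
        have "density_ratio g1 g2 p * sqrt (g2 c p v v) \<le> q * ((1 + \<epsilon>) * sqrt (g1 c p v v))"
          using that(3,4) nn q by (intro mult_mono) auto
        also have "\<dots> \<le> q * (q * sqrt (g1 c p v v))"
          using \<epsilon>(3) nn q by (intro mult_left_mono mult_right_mono) auto
        also have "\<dots> = q\<^sup>2 * sqrt (g1 c p v v)" by (simp add: power2_eq_square)
        also have "\<dots> \<le> (1 + \<theta>) * sqrt (g1 c p v v)" using q\<theta> nn by (intro mult_right_mono)
        finally show ?thesis .
      qed
      show "perimeter A g E \<le> ereal (1 + \<theta>) * perimeter A g0 E"
        by (rule perimeter_le[OF g g0 _ E])
          (use \<theta> k[OF g g0 r1 metric_close_sqrt(1)[OF close \<epsilon>(1)]] in auto)
      show "perimeter A g0 E \<le> ereal (1 + \<theta>) * perimeter A g E"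
        by (rule perimeter_le[OF g0 g _ E])
          (use \<theta> k[OF g0 g r2 metric_close_sqrt(2)[OF close \<epsilon>(1)]] in auto)
      have q0: "0 < q" using q by simp
      have v: "vol_ratio g E \<le> q\<^sup>2 * vol_ratio g0 E" "vol_ratio g0 E \<le> q\<^sup>2 * vol_ratio g E"
        by (rule vol_ratio_le[OF g g0 q0 r1 r2 E], rule vol_ratio_le[OF g0 g q0 r2 r1 E])
      have "(q\<^sup>2 - 1) * vol_ratio g0 E \<le> \<theta> * 1" "(q\<^sup>2 - 1) * vol_ratio g E \<le> \<theta> * 1"
        using q\<theta> q2 \<theta> vol_ratio_bounds[OF g] vol_ratio_bounds[OF g0] by (auto intro!: mult_mono simp del: mult_1_right)
      then show "\<bar>vol_ratio g E - vol_ratio g0 E\<bar> \<le> \<theta>"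
        using v by (simp add: abs_le_iff left_diff_distrib)
    qed
  qed
qed

subsection \<open>The profile\<close>

lemma isoperimetric_profile_vol_ratio:
  assumes g: "riemannian_metric A g" and "0 \<le> \<xi>"
  shows "isoperimetric_profile A g \<xi> =
    (INF E \<in> {E \<in> manifold_lebesgue_sets A. vol_ratio g E = \<xi> \<and> perimeter A g E < \<infinity>}. perimeter A g E)"
  unfolding isoperimetric_profile_def emeasure_iff_vol_ratio[OF g assms(2)] riemannian_volume_sets(1)[OF g] ..

lemma isoperimetric_profile_finite:
  assumes g: "riemannian_metric A g" and n: "CARD('n) \<ge> 2" and \<xi>: "0 \<le> \<xi>" "\<xi> \<le> 1"
  shows "\<bar>isoperimetric_profile A g \<xi>\<bar> \<noteq> \<infinity>"
proof -
  obtain E where "E \<in> manifold_lebesgue_sets A" "vol_ratio g E = \<xi>" "perimeter A g E < \<infinity>"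
    using exists_finite_perimeter[OF g n \<xi>] by blast
  then have "isoperimetric_profile A g \<xi> \<le> perimeter A g E"
    unfolding isoperimetric_profile_vol_ratio[OF g \<xi>(1)] by (intro INF_lower) simp
  also note \<open>perimeter A g E < \<infinity>\<close>
  finally have "isoperimetric_profile A g \<xi> < \<infinity>" .
  moreover have "0 \<le> isoperimetric_profile A g \<xi>"
    unfolding isoperimetric_profile_vol_ratio[OF g \<xi>(1)] by (rule INF_greatest) (rule perimeter_nonneg[OF g])
  ultimately show ?thesis by auto
qed

lemma isoperimetric_profile_nonneg:
  assumes g: "riemannian_metric A g" and "0 \<le> \<xi>" shows "0 \<le> real_of_ereal (isoperimetric_profile A g \<xi>)"
  unfolding isoperimetric_profile_vol_ratio[OF assms]
  by (rule real_of_ereal_pos, rule INF_greatest) (rule perimeter_nonneg[OF g])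

context
  fixes g and \<xi> :: real
  assumes g: "riemannian_metric A g" and n: "CARD('n) \<ge> 2" and \<xi>: "0 \<le> \<xi>" "\<xi> \<le> 1"
begin

lemma profile_le:
  assumes E: "E \<in> manifold_lebesgue_sets A" "vol_ratio g E = \<xi>" "perimeter A g E \<le> ereal x"
  shows "real_of_ereal (isoperimetric_profile A g \<xi>) \<le> x"
proof -
  have "perimeter A g E < \<infinity>" using E(3) by (rule le_less_trans) simp
  then have "isoperimetric_profile A g \<xi> \<le> perimeter A g E"
    unfolding isoperimetric_profile_vol_ratio[OF g \<xi>(1)] using E by (intro INF_lower) simp
  also note E(3)
  finally show ?thesis
    using isoperimetric_profile_finite[OF g n \<xi>] by (cases "isoperimetric_profile A g \<xi>") auto
qed

lemma profile_approx:
  assumes "0 < \<eta>"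
  shows "\<exists>E\<in>manifold_lebesgue_sets A. vol_ratio g E = \<xi> \<and>
    perimeter A g E \<le> ereal (real_of_ereal (isoperimetric_profile A g \<xi>) + \<eta>)"
proof -
  let ?h = "real_of_ereal (isoperimetric_profile A g \<xi>)"
  have "isoperimetric_profile A g \<xi> < ereal (?h + \<eta>)"
    using isoperimetric_profile_finite[OF g n \<xi>] assms by (cases "isoperimetric_profile A g \<xi>") auto
  then obtain E where "E \<in> manifold_lebesgue_sets A" "vol_ratio g E = \<xi>" "perimeter A g E < ereal (?h + \<eta>)"
    unfolding isoperimetric_profile_vol_ratio[OF g \<xi>(1)] INF_less_iff by blast
  then show ?thesis by (intro bexI[of _ E]) auto
qed

end

text \<open>An almost optimal set is transferred in each direction: from \<open>g0\<close> and
  \<open>\<xi>0\<close> for the upper estimate, from \<open>g\<close> and \<open>\<xi>\<close> for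
  the lower one. Both times it is corrected at a cost measured in \<open>g0\<close>, while the
  volume ratio to be met is that of the target metric.\<close>

lemma profile_close:
  assumes g0: "riemannian_metric A g0" and n: "CARD('n) \<ge> 2" and \<xi>0: "0 < \<xi>0" "\<xi>0 < 1" and \<eta>: "0 < \<eta>"
  shows "\<exists>\<epsilon>>0. \<exists>\<delta>>0. \<forall>g \<xi>. riemannian_metric A g \<longrightarrow> metric_close \<epsilon> g g0 \<longrightarrow> 0 < \<xi> \<longrightarrow> \<xi> < 1 \<longrightarrow>
    \<bar>\<xi> - \<xi>0\<bar> \<le> \<delta> \<longrightarrow>
    \<bar>real_of_ereal (isoperimetric_profile A g \<xi>) - real_of_ereal (isoperimetric_profile A g0 \<xi>0)\<bar> \<le> \<eta>"
proof -
  let ?H = "\<lambda>g \<xi>. real_of_ereal (isoperimetric_profile A g \<xi>)"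
  define h where "h = ?H g0 \<xi>0"
  have h: "0 \<le> h" unfolding h_def using \<xi>0 by (intro isoperimetric_profile_nonneg[OF g0]) simp
  \<comment> \<open>The upper estimate spends one share each on approximation and correction, at
    most two on the distortion of these, and two on \<open>\<theta> * h\<close>. The lower estimate
    gets by with five in the same way.\<close>
  define \<eta>1 where "\<eta>1 = \<eta> / 8"
  have \<eta>1: "0 < \<eta>1" using \<eta> by (simp add: \<eta>1_def)
  show ?thesis
  proof (rule adjust_volume[OF g0 n \<eta>1 \<xi>0])
    fix d :: real
    assume d: "0 < d" and adj: "\<And>g E \<xi>. riemannian_metric A g \<Longrightarrow> E \<in> manifold_lebesgue_sets A \<Longrightarrow>
      \<bar>vol_ratio g E - \<xi>0\<bar> \<le> d \<Longrightarrow> \<bar>\<xi> - \<xi>0\<bar> \<le> d \<Longrightarrow>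
      \<exists>E'\<in>manifold_lebesgue_sets A. vol_ratio g E' = \<xi> \<and> perimeter A g0 E' \<le> perimeter A g0 E + ereal \<eta>1"
    \<comment> \<open>\<open>d / 2\<close> leaves room for the change of the volume ratio beside
      \<open>\<bar>\<xi> - \<xi>0\<bar> \<le> d / 2\<close>. The last bound gives
      \<open>\<theta> * (h + \<eta>) \<le> \<eta> / 4\<close>, where \<open>h + \<eta>\<close> will
      bound the profiles of both metrics.\<close>
    define \<theta> where "\<theta> = min (min 1 (d / 2)) (\<eta> / (4 * (h + \<eta>)))"
    have "0 < \<eta> / (4 * (h + \<eta>))" using h \<eta> by (intro divide_pos_pos) auto
    then have \<theta>: "0 < \<theta>" "\<theta> \<le> 1" "\<theta> \<le> d / 2" "\<theta> \<le> \<eta> / (4 * (h + \<eta>))"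
      using d unfolding \<theta>_def by linarith+
    have e8: "\<eta> = 8 * \<eta>1" by (simp add: \<eta>1_def)
    have \<theta>h: "\<theta> * (h + \<eta>) \<le> \<eta> / 4" using \<theta>(4) h \<eta> by (simp add: field_simps)
    obtain \<epsilon> where \<epsilon>: "0 < \<epsilon>" and est: "\<And>g E. riemannian_metric A g \<Longrightarrow> metric_close \<epsilon> g g0 \<Longrightarrow>
      E \<in> manifold_lebesgue_sets A \<Longrightarrow> perimeter A g E \<le> ereal (1 + \<theta>) * perimeter A g0 E \<and>
       perimeter A g0 E \<le> ereal (1 + \<theta>) * perimeter A g E \<and> \<bar>vol_ratio g E - vol_ratio g0 E\<bar> \<le> \<theta>"
      using metric_close_estimates[OF \<theta>(1)] g0 by blast
    have scale: "ereal (1 + \<theta>) * x \<le> ereal ((1 + \<theta>) * y)" if "x \<le> ereal y" for x y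
      using ereal_mult_left_mono[OF that, of "ereal (1 + \<theta>)"] \<theta>(1) by simp
    show ?thesis
    proof (rule exI[of _ \<epsilon>], rule conjI[OF \<epsilon>], rule exI[of _ "d / 2"], intro conjI allI impI)
      show "0 < d / 2" using d by simp
      fix g \<xi>
      assume g: "riemannian_metric A g" and close: "metric_close \<epsilon> g g0" and \<xi>: "0 < \<xi>" "\<xi> < 1"
        and \<xi>d: "\<bar>\<xi> - \<xi>0\<bar> \<le> d / 2"
      note est = est[OF g close]
      have \<xi>': "0 \<le> \<xi>" "\<xi> \<le> 1" "0 \<le> \<xi>0" "\<xi>0 \<le> 1" using \<xi> \<xi>0 by auto
      obtain E where E: "E \<in> manifold_lebesgue_sets A" "vol_ratio g0 E = \<xi>0" "perimeter A g0 E \<le> ereal (h + \<eta>1)"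
        using profile_approx[OF g0 n \<xi>'(3,4) \<eta>1] unfolding h_def by blast
      have "\<bar>vol_ratio g E - \<xi>0\<bar> \<le> d" using est[OF E(1)] E(2) \<theta>(3) d by simp
      then obtain E' where E': "E' \<in> manifold_lebesgue_sets A" "vol_ratio g E' = \<xi>"
        "perimeter A g0 E' \<le> perimeter A g0 E + ereal \<eta>1"
        using adj[OF g E(1), of \<xi>] \<xi>d d by auto
      have "perimeter A g0 E' \<le> ereal (h + 2 * \<eta>1)"
        using E'(3) add_right_mono[OF E(3), of "ereal \<eta>1"] by (simp add: order_trans add.assoc)
      then have "perimeter A g E' \<le> ereal ((1 + \<theta>) * (h + 2 * \<eta>1))"
        using est[OF E'(1)] scale order_trans by blast
      from profile_le[OF g n \<xi>'(1,2) E'(1,2) this]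
      have "?H g \<xi> \<le> h + 2 * \<eta>1 + \<theta> * h + 2 * (\<theta> * \<eta>1)" by (simp add: algebra_simps)
      moreover have "\<theta> * \<eta>1 \<le> \<eta>1" "\<theta> * h \<le> \<theta> * (h + \<eta>)" using \<theta>(1,2) \<eta>1 h \<eta> by (auto simp: mult_left_le_one_le)
      ultimately have upper: "?H g \<xi> \<le> h + \<eta>" using \<theta>h e8 \<eta>1 by linarith
      obtain F where F: "F \<in> manifold_lebesgue_sets A" "vol_ratio g F = \<xi>" "perimeter A g F \<le> ereal (?H g \<xi> + \<eta>1)"
        using profile_approx[OF g n \<xi>'(1,2) \<eta>1] by blast
      have "perimeter A g0 F \<le> ereal ((1 + \<theta>) * (?H g \<xi> + \<eta>1))"
        using est[OF F(1)] scale[OF F(3)] order_trans by blast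
      moreover have "\<bar>vol_ratio g0 F - \<xi>0\<bar> \<le> d" using est[OF F(1)] F(2) \<theta>(3) \<xi>d by linarith
      then obtain F' where F': "F' \<in> manifold_lebesgue_sets A" "vol_ratio g0 F' = \<xi>0"
        "perimeter A g0 F' \<le> perimeter A g0 F + ereal \<eta>1"
        using adj[OF g0 F(1), of \<xi>0] d by auto
      ultimately have "perimeter A g0 F' \<le> ereal ((1 + \<theta>) * (?H g \<xi> + \<eta>1) + \<eta>1)"
        using order_trans[OF F'(3) add_right_mono] by fastforce
      from profile_le[OF g0 n \<xi>'(3,4) F'(1,2) this]
      have "h \<le> ?H g \<xi> + \<theta> * ?H g \<xi> + 2 * \<eta>1 + \<theta> * \<eta>1" by (simp add: h_def algebra_simps)
      \<comment> \<open>The profile of \<open>g\<close> has no a priori bound; the upper estimate,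
        already available, controls its relative error.\<close>
      moreover have "\<theta> * ?H g \<xi> \<le> \<theta> * (h + \<eta>)" using upper \<theta>(1) by (intro mult_left_mono) auto
      ultimately have "h \<le> ?H g \<xi> + \<eta>" using \<theta>h \<open>\<theta> * \<eta>1 \<le> \<eta>1\<close> e8 \<eta>1 by linarith
      then show "\<bar>?H g \<xi> - ?H g0 \<xi>0\<bar> \<le> \<eta>" using upper by (simp add: h_def)
    qed
  qed
qed

lemma metric_family_close:
  assumes fam: "continuous_metric_family A I g" and met: "\<And>t. t \<in> I \<Longrightarrow> riemannian_metric A (g t)"
    and t0: "t0 \<in> I" and \<epsilon>: "0 < \<epsilon>"
  shows "\<exists>d>0. \<forall>t\<in>I. dist t t0 < d \<longrightarrow> metric_close \<epsilon> (g t) (g t0)"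
proof -
  have "\<forall>\<^sub>F t in at t0 within I. metric_close \<epsilon> (g t) (g t0)"
    using fam t0 \<epsilon> unfolding continuous_metric_family_def metric_close_def by blast
  then obtain d where d: "0 < d" "\<And>t. t \<in> I \<Longrightarrow> t \<noteq> t0 \<Longrightarrow> dist t t0 < d \<Longrightarrow> metric_close \<epsilon> (g t) (g t0)"
    unfolding eventually_at by blast
  have "metric_close \<epsilon> (g t) (g t0)" if "t \<in> I" "dist t t0 < d" for t
    using d(2)[OF that(1) _ that(2)] metric_close_refl[OF met[OF t0] \<epsilon>] by (cases "t = t0") auto
  then show ?thesis using d(1) by blast
qed

lemma profile_continuous:
  assumes fam: "continuous_metric_family A I g" and met: "\<And>t. t \<in> I \<Longrightarrow> riemannian_metric A (g t)"
    and n: "CARD('n) \<ge> 2"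
  shows "continuous_on (I \<times> {0<..<1}) (\<lambda>(t, \<xi>). isoperimetric_profile A (g t) \<xi>)"
proof -
  \<comment> \<open>Distances are estimated for the real value of the profile; finiteness on the
    whole domain carries the continuity back to the extended reals.\<close>
  let ?H = "\<lambda>z :: real \<times> real. real_of_ereal (isoperimetric_profile A (g (fst z)) (snd z))"
  have "continuous_on (I \<times> {0<..<1}) ?H"
    unfolding continuous_on_iff
  proof (intro ballI allI impI)
    fix z0 :: "real \<times> real" and e :: real assume z0: "z0 \<in> I \<times> {0<..<1}" and e: "0 < e"
    have t0: "fst z0 \<in> I" "0 < snd z0" "snd z0 < 1" and e2: "0 < e / 2" using z0 e by auto
    obtain \<epsilon> \<delta> where *: "0 < \<epsilon>" "0 < \<delta>" "\<And>g' \<xi>. riemannian_metric A g' \<Longrightarrow> metric_close \<epsilon> g' (g (fst z0)) \<Longrightarrow>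
      0 < \<xi> \<Longrightarrow> \<xi> < 1 \<Longrightarrow> \<bar>\<xi> - snd z0\<bar> \<le> \<delta> \<Longrightarrow>
      \<bar>real_of_ereal (isoperimetric_profile A g' \<xi>) - ?H z0\<bar> \<le> e / 2"
      using profile_close[OF met[OF t0(1)] n t0(2,3) e2] by blast
    obtain d where d: "0 < d" "\<And>t. t \<in> I \<Longrightarrow> dist t (fst z0) < d \<Longrightarrow> metric_close \<epsilon> (g t) (g (fst z0))"
      using metric_family_close[OF fam met t0(1) *(1)] by blast
    show "\<exists>d>0. \<forall>z\<in>I \<times> {0<..<1}. dist z z0 < d \<longrightarrow> dist (?H z) (?H z0) < e"
    proof (intro exI[of _ "min d \<delta>"] conjI ballI impI)
      show "0 < min d \<delta>" using d *(2) by simp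
      fix z assume z: "z \<in> I \<times> {0<..<1}" "dist z z0 < min d \<delta>"
      have "dist (fst z) (fst z0) < d" "dist (snd z) (snd z0) < \<delta>"
        using dist_fst_le[of z z0] dist_snd_le[of z z0] z(2) by auto
      then have "\<bar>?H z - ?H z0\<bar> \<le> e / 2"
        using z(1) by (intro *(3) met d(2)) (auto simp: dist_real_def)
      then show "dist (?H z) (?H z0) < e" using e by (simp add: dist_real_def)
    qed
  qed
  then have "continuous_on (I \<times> {0<..<1}) (\<lambda>z. ereal (?H z))"
    by (rule continuous_on_ereal)
  then show ?thesis
  proof (rule continuous_on_eq)
    fix z :: "real \<times> real" assume z: "z \<in> I \<times> {0<..<1}"
    then have "\<bar>isoperimetric_profile A (g (fst z)) (snd z)\<bar> \<noteq> \<infinity>"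
      by (intro isoperimetric_profile_finite met n) auto
    then show "ereal (?H z) = (case z of (t, \<xi>) \<Rightarrow> isoperimetric_profile A (g t) \<xi>)"
      by (simp add: ereal_real case_prod_beta)
  qed
qed

end

theorem theorem1p1:
  fixes A :: "('m::t2_space, 'n::finite) chart set"
    and I :: "real set"
    and g :: "real \<Rightarrow> ('m, 'n) metric_field"
  assumes "smooth_atlas A"
    and "compact (UNIV :: 'm set)"
    and "connected (UNIV :: 'm set)"
    and "CARD('n) \<ge> 2"
    and "is_interval I"
    and "\<And>t. t \<in> I \<Longrightarrow> riemannian_metric A (g t)"
    and "continuous_metric_family A I g"
  shows "(\<forall>t\<in>I. \<forall>\<xi>\<in>{0<..<1}. \<bar>isoperimetric_profile A (g t) \<xi>\<bar> \<noteq> \<infinity>) \<and>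
    continuous_on (I \<times> {0<..<1}) (\<lambda>(t, \<xi>). isoperimetric_profile A (g t) \<xi>)"
proof -
  interpret closed_manifold A using assms(1,2) by unfold_locales
  show ?thesis
    using isoperimetric_profile_finite[OF assms(6,4)] profile_continuous[OF assms(7,6,4)] by auto
qed

end
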